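(* For every integer $n\ge 1$, let $K_n$ be the $n$-th Kitrick polyhedron (which has $60n^2$ triangular faces and is inscribed in the unit sphere), and let $\eta(K_n)$ be the quotient (length of the longest edge of $K_n$)/(length of the shortest edge of $K_n$). Then $$e_{60n^2}\ \le\ \eta(K_n)\ =\ 2\sin 36^\circ\,\cos\left(\frac{\arccos\left(\cot 36^\circ/\sqrt3\right)}{2n}\right)\ =\ 2\sin 36^\circ\,\cos\left(\frac{37.37^\circ\ldots}{2n}\right)\ <\ 2\sin 36^\circ .$$ Consequently $\liminf_{m\to\infty}e_m\le 2\sin 36^\circ$. More exactly, consider the faces of $K_n$ that contain the centre (radially projected to the sphere) of a dodecahedron face, i.e. the faces with vertices $P_{0,0},P_{1,1},P_{1,-1}$ in the subdivided spherical triangles. These are isosceles triangles; their bases $P_{1,-1}P_{1,1}$ have maximal length among all edges of $K_n$, and their equal sides $P_{0,0}P_{1,1}$, $P_{0,0}P_{1,-1}$ have minimal length among all edges of $K_n$.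
   Context: All edge lengths are Euclidean lengths. $e_m$ denotes the infimum of (length of longest edge)/(length of shortest edge) over all convex polyhedra inscribed in a unit sphere in $3$-dimensional Euclidean space (i.e. with all vertices on the sphere), having $m$ faces, all of which are triangles (with $e_m=+\infty$ if there are none). Definition of Kitrick's polyhedron $K_n$ ($n\ge1$ an integer). Take a regular dodecahedron inscribed in the unit sphere and project its faces radially (from the centre) onto the sphere, obtaining a tiling by $12$ regular spherical pentagons. Decompose each pentagon into five isosceles spherical triangles whose common vertex is the centre of the pentagon and whose bases are the sides of the pentagon; this gives $60$ congruent isosceles spherical triangles with angles $72^\circ,60^\circ,60^\circ$. Each of them is subdivided into $n^2$ spherical triangles in the same way, as follows. Let $\Delta$ be one of them, with vertex $P_{0,0}$ at the $72^\circ$ angle, and choose geographic coordinates on the sphere such that the axis of symmetry of $\Delta$ lies on the equator; thus the two equal sides of $\Delta$ are mirror images in the equator (call them upper and lower), and the base lies on a meridian. Divide each of the two equal sides into $n$ equal parts; for $0\le i\le n$ let $P_{i,i}$ (resp. $P_{i,-i}$) be the division point on the upper (resp. lower) equal side whose spherical distance from $P_{0,0}$ is $i/n$ times the spherical length of that side. For $0\le i\le n$ let the $i$-th meridian be the meridian through $P_{i,i}$ and $P_{i,-i}$ (so the $n$-th one contains the base), and for $-n\le j\le n$ let the $j$-th parallel be the circle of latitude through $P_{|j|,j}$ (the $0$-th one is the equator). For $0\le i\le n$ and $|j|\le i$ let $P_{i,j}$ be the intersection point in $\Delta$ of the $i$-th meridian and the $j$-th parallel. The vertices of the subdivision of $\Delta$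 are the points $P_{i,j}$ with $0\le i\le n$, $|j|\le i$, $j\equiv i \pmod 2$ (every second point on each meridian, beginning with those on the equal sides). The edges are the shorter great circle arcs joining $P_{i,j-1}$ to $P_{i,j+1}$ (both being vertices of the subdivision), and joining $P_{i,j}$ to $P_{i+1,j+1}$ and to $P_{i+1,j-1}$ for vertices $P_{i,j}$ with $0\le i\le n-1$. This subdivides $\Delta$ into $n^2$ spherical triangles, namely those with vertices $P_{i,j},P_{i+1,j-1},P_{i+1,j+1}$ and those with vertices $P_{i,j-1},P_{i,j+1},P_{i+1,j}$. Doing this for all $60$ triangles gives a tiling of the sphere by $60n^2$ spherical triangles. $K_n$ is the polyhedron obtained by replacing each spherical triangle of this tiling by the planar triangle with the same vertices. *)

theory Defs
  imports "HOL-Analysis.Analysis"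
begin

(* Edges are represented as segments, whose length is their diameter. *)
definition edge_ratio :: "(real^3) set set \<Rightarrow> real" where
  "edge_ratio \<E> = Max (diameter ` \<E>) / Min (diameter ` \<E>)"

definition inscribed_triangular :: "nat \<Rightarrow> (real^3) set \<Rightarrow> bool" where
  "inscribed_triangular m Q \<longleftrightarrow>
     polytope Q \<and> aff_dim Q = 3 \<and>
     (\<exists>z. {v. v extreme_point_of Q} \<subseteq> sphere z 1) \<and>
     card {F. F facet_of Q} = m \<and> (\<forall>F. F facet_of Q \<longrightarrow> 2 simplex F)"

(* The infimum of the empty set is \<infinity> in ereal. *)
definition inf_edge_ratio :: "nat \<Rightarrow> ereal" where
  "inf_edge_ratio m = (INF Q\<in>{Q. inscribed_triangular m Q}. ereal (edge_ratio {E. E edge_of Q}))"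

(* sgn x = x / norm x is the radial projection onto the unit sphere. *)

definition sph_dist :: "real^3 \<Rightarrow> real^3 \<Rightarrow> real" where
  "sph_dist x y = arccos (x \<bullet> y)"

(* The shorter great circle arc between non-antipodal points of the unit sphere. *)
definition sph_arc :: "real^3 \<Rightarrow> real^3 \<Rightarrow> (real^3) set" where
  "sph_arc x y = sgn ` closed_segment x y"

definition sph_triangle :: "real^3 \<Rightarrow> real^3 \<Rightarrow> real^3 \<Rightarrow> (real^3) set" where
  "sph_triangle x y z = sgn ` (convex hull {x, y, z})"

(* The meridian (half great circle from pole to pole) and the circle of latitude through p,
   for geographic coordinates with north pole N. *)
definition meridian :: "real^3 \<Rightarrow> real^3 \<Rightarrow> (real^3) set" where
  "meridian N p = {x \<in> sphere 0 1. \<exists>s t. s \<ge> 0 \<and> x = s *\<^sub>R p + t *\<^sub>R N}"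

definition parallel :: "real^3 \<Rightarrow> real^3 \<Rightarrow> (real^3) set" where
  "parallel N p = {x \<in> sphere 0 1. x \<bullet> N = p \<bullet> N}"

definition golden :: real where
  "golden = (1 + sqrt 5) / 2"

(* The standard coordinates of a regular dodecahedron, with circumradius sqrt 3, rescaled. *)
definition dodecahedron :: "(real^3) set" where
  "dodecahedron = convex hull ((\<lambda>v. v /\<^sub>R sqrt 3) `
     ({vector [x, y, z] |x y z. x \<in> {-1, 1} \<and> y \<in> {-1, 1} \<and> z \<in> {-1, 1}} \<union>
      {vector [0, p, q] |p q. p \<in> {-1 / golden, 1 / golden} \<and> q \<in> {-golden, golden}} \<union>
      {vector [q, 0, p] |p q. p \<in> {-1 / golden, 1 / golden} \<and> q \<in> {-golden, golden}} \<union>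
      {vector [p, q, 0] |p q. p \<in> {-1 / golden, 1 / golden} \<and> q \<in> {-golden, golden}}))"

(* The radial projection of the centroid of the vertices; the factor 1/5 is irrelevant to sgn. *)
definition sph_centre :: "(real^3) set \<Rightarrow> real^3" where
  "sph_centre F = sgn (\<Sum>v | v extreme_point_of F. v)"

(* (c, a, b) is the spherical triangle with apex c at the centre of a pentagon and base from a to b,
   c-a being the upper and c-b the lower side. Each of the 60 triangles occurs twice, as (c, a, b)
   and (c, b, a); the two choices of the north pole give the same subdivision. *)
definition base_triangles :: "((real^3) \<times> (real^3) \<times> (real^3)) set" where
  "base_triangles =
     {(sph_centre F, a, b) |F a b. F facet_of dodecahedron \<and> closed_segment a b edge_of F}"

(* The k-th of the points dividing the arc from x to y into n equal parts. *)
definition div_point :: "nat \<Rightarrow> real^3 \<Rightarrow> real^3 \<Rightarrow> nat \<Rightarrow> real^3" where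
  "div_point n x y k = (THE p. p \<in> sph_arc x y \<and> sph_dist x p = real k / real n * sph_dist x y)"

(* The triangle is symmetric under the reflection exchanging a and b; hence the equator, which
   contains the axis of symmetry, is orthogonal to a - b, and the poles are the two unit vectors
   parallel to a - b. *)
fun kitrick_point :: "nat \<Rightarrow> (real^3) \<times> (real^3) \<times> (real^3) \<Rightarrow> nat \<Rightarrow> int \<Rightarrow> real^3" where
  "kitrick_point n (c, a, b) i j =
     (let N = sgn (a - b);
          q = (if j \<ge> 0 then div_point n c a (nat j) else div_point n c b (nat (- j)))
      in THE x. x \<in> sph_triangle c a b \<inter> meridian N (div_point n c a i) \<inter> parallel N q)"

definition kitrick_index :: "nat \<Rightarrow> nat \<Rightarrow> int \<Rightarrow> bool" where
  "kitrick_index n i j \<longleftrightarrow> i \<le> n \<and> \<bar>j\<bar> \<le> int i \<and> even (j - int i)"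

definition kitrick_vertices :: "nat \<Rightarrow> (real^3) set" where
  "kitrick_vertices n =
     {kitrick_point n T i j |T i j. T \<in> base_triangles \<and> kitrick_index n i j}"

definition kitrick_edges :: "nat \<Rightarrow> (real^3) set set" where
  "kitrick_edges n =
     {closed_segment (kitrick_point n T i (j - 1)) (kitrick_point n T i (j + 1)) |T i j.
        T \<in> base_triangles \<and> kitrick_index n i (j - 1) \<and> kitrick_index n i (j + 1)} \<union>
     {closed_segment (kitrick_point n T i j) (kitrick_point n T (i + 1) (j + 1)) |T i j.
        T \<in> base_triangles \<and> kitrick_index n i j \<and> i < n} \<union>
     {closed_segment (kitrick_point n T i j) (kitrick_point n T (i + 1) (j - 1)) |T i j.
        T \<in> base_triangles \<and> kitrick_index n i j \<and> i < n}"

definition kitrick_faces :: "nat \<Rightarrow> (real^3) set set" where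
  "kitrick_faces n =
     {convex hull {kitrick_point n T i j, kitrick_point n T (i + 1) (j - 1),
                   kitrick_point n T (i + 1) (j + 1)} |T i j.
        T \<in> base_triangles \<and> kitrick_index n i j \<and> i < n} \<union>
     {convex hull {kitrick_point n T i (j - 1), kitrick_point n T i (j + 1),
                   kitrick_point n T (i + 1) j} |T i j.
        T \<in> base_triangles \<and> kitrick_index n i (j - 1) \<and> kitrick_index n i (j + 1) \<and> i < n}"

definition kitrick_ratio :: "nat \<Rightarrow> real" where
  "kitrick_ratio n = edge_ratio (kitrick_edges n)"

definition kitrick_apex_face :: "nat \<Rightarrow> (real^3) \<times> (real^3) \<times> (real^3) \<Rightarrow> (real^3) set" where
  "kitrick_apex_face n T =
     convex hull {kitrick_point n T 0 0, kitrick_point n T 1 1, kitrick_point n T 1 (- 1)}"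

end

(* All base triangles are images of one of them under the reflection group W of the dodecahedron. In that
   triangle the point P(i, j) has latitude lat (j s) and longitude lon (i s), where s = side / n and, by
   Napier's rules, sin (lat t) = sin 36 sin t and tan (lon t) = cos 36 tan t (angles in degrees). As lat is
   concave and lon is convex on [0, side], every edge is at least as long as P(0,0)P(1,1), of length
   2 sin (s / 2), and at most as long as P(1,-1)P(1,1), of length 2 sin 36 sin s.

   To compare K_n with e_m one needs that K_n bounds the convex hull of its vertices, i.e. that the plane
   through a face leaves all other vertices on one side. The normal vector of the face is a positive
   combination of the vertices of the face. So it lies, up to the mirror image in the equator, in a chamber
   of W, and among the images of a vertex under W the one in that chamber has the largest component along
   the normal vector; this leaves the vertices in the same base triangle, where the claim is an inequality
   between latitudes and longitudes. As the faces meet every ray from the centre, there are no further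
   facets. *)

theory Submission
  imports Defs
begin

section \<open>The golden ratio and the side of the base triangle\<close>

text \<open>The number e_m ranges over convex polyhedra, whereas K_n is given as a list of
  triangles; so the edge lengths say nothing about e_m until K_n is known to be convex, and this
  shapes the proof. The test is the empty circle: the plane of a face supports the hull if no vertex
  lies inside the circumscribed circle of the face. That the normal vector is a positive combination
  of the vertices of the face rests on the faces being acute: the squares of the longest and the
  shortest edge have a ratio of at most 4 sin^2 36 = 3 - \<open>golden\<close>, about 1.38, which is
  below 2. Within a base triangle, the convexity of \<open>lon\<close> and the mirror symmetry
  settle every comparison except one: a face with two vertices on its western meridian has to be
  compared with the next meridian to the west, but the steps of longitude grow towards the east.
  There a numerical estimate is unavoidable; in units of the squared step it compares about 0.183
  with 0.173. The bound 0.66 that recurs in such estimates is an upper bound of \<open>side\<close>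
  in radians.\<close>

lemma golden_sq: "golden\<^sup>2 = golden + 1"
  unfolding golden_def by (simp add: power2_eq_square field_simps)

lemma golden_bounds: "1618033 / 1000000 < golden" "golden < 1618034 / 1000000"
proof -
  have "2236067 / 1000000 < sqrt 5" by (rule real_less_rsqrt) (simp add: power2_eq_square)
  then show "1618033 / 1000000 < golden" by (simp add: golden_def)
  have "sqrt 5 < 2236068 / 1000000" by (rule real_less_lsqrt) (simp_all add: power2_eq_square)
  then show "golden < 1618034 / 1000000" by (simp add: golden_def)
qed

lemma golden_pos [simp]: "golden > 0" "golden \<noteq> 0"
  using golden_bounds by linarith+

lemma inverse_golden: "1 / golden = golden - 1"
  using golden_sq by (simp add: field_simps power2_eq_square)

definition s36 :: real where "s36 = sin (pi / 5)"
definition c36 :: real where "c36 = cos (pi / 5)"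

text \<open>Since 3 * 36 = 180 - 2 * 36 degrees, the triple and double angle formulas yield a cubic
  for the cosine. Positivity discards its factor \<open>c + 1\<close> and the root
  \<open>(1 - golden) / 2\<close> of the remaining quadratic.\<close>

lemma c36_eq: "c36 = golden / 2"
proof -
  define c where "c = cos (pi / 5)"
  have "cos (3 * (pi / 5)) = - cos (2 * (pi / 5))"
    by (subst cos_pi_minus [symmetric]) (simp add: field_simps)
  then have "4 * c ^ 3 - 3 * c = 1 - 2 * c\<^sup>2"
    unfolding cos_treble_cos cos_double_cos c_def by simp
  then have "(c + 1) * (4 * c\<^sup>2 - 2 * c - 1) = 0" by algebra
  moreover have c: "c > 0" unfolding c_def by (rule cos_gt_zero) auto
  ultimately have "4 * c\<^sup>2 - 2 * c - 1 = 0" by simp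
  then have "(2 * c - golden) * (2 * c + golden - 1) = 0" using golden_sq by algebra
  moreover have "2 * c + golden - 1 \<noteq> 0" using c golden_bounds by linarith
  ultimately show ?thesis by (simp add: c36_def c_def)
qed

lemma s36_pos [simp]: "s36 > 0" and c36_pos [simp]: "c36 > 0"
  by (simp_all add: s36_def c36_def sin_gt_zero cos_gt_zero)

lemma s36_nonzero [simp]: "s36 \<noteq> 0" and c36_nonzero [simp]: "c36 \<noteq> 0"
  using s36_pos c36_pos by linarith+

lemma c36_sq: "c36\<^sup>2 = (golden + 1) / 4"
  using golden_sq by (simp add: c36_eq power_divide)

lemma s36_sq: "s36\<^sup>2 = (3 - golden) / 4"
proof -
  have "s36\<^sup>2 + c36\<^sup>2 = 1" by (simp add: s36_def c36_def)
  then show ?thesis by (simp add: c36_sq field_simps)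
qed

lemma s36_c36: "s36\<^sup>2 + c36\<^sup>2 = 1"
  by (simp add: s36_def c36_def)

text \<open>The common length of the equal sides: half of the base triangle is right-angled with
  further angles 36 and 60 degrees, and by Napier's rule its hypotenuse has cosine cot 36 cot
  60.\<close>

definition side :: real where "side = arccos (cot (pi / 5) / sqrt 3)"

lemma cos_side_sq_bound: "(c36 / (s36 * sqrt 3))\<^sup>2 = (golden + 1) / (9 - 3 * golden)"
  using golden_bounds by (simp add: power_divide power_mult_distrib c36_sq s36_sq field_simps)

lemma cos_side: "cos side = c36 / (s36 * sqrt 3)"
proof -
  have "(golden + 1) / (9 - 3 * golden) \<le> 1"
    using golden_bounds by (simp add: field_simps)
  then have "(c36 / (s36 * sqrt 3))\<^sup>2 \<le> 1\<^sup>2" unfolding cos_side_sq_bound by simp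
  then have "c36 / (s36 * sqrt 3) \<le> 1" by (rule power2_le_imp_le) simp
  moreover have "0 \<le> c36 / (s36 * sqrt 3)" by (simp add: less_imp_le)
  moreover have "cot (pi / 5) / sqrt 3 = c36 / (s36 * sqrt 3)"
    by (simp add: cot_def s36_def c36_def)
  ultimately show ?thesis unfolding side_def by simp
qed

lemma cos_side_sq: "(cos side)\<^sup>2 = (golden + 1) / (9 - 3 * golden)"
  using cos_side_sq_bound cos_side by simp

lemma cos_side_pos: "cos side > 0"
  by (simp add: cos_side)

lemma side_between: "0 \<le> side" "side \<le> pi"
proof -
  have "cot (pi / 5) / sqrt 3 = cos side"
    by (simp add: cos_side cot_def s36_def c36_def)
  then show "0 \<le> side" "side \<le> pi"
    unfolding side_def using arccos_lbound arccos_ubound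
    by (metis abs_cos_le_one abs_le_iff minus_le_iff)+
qed

section \<open>Decimal bounds for the side\<close>

lemma cos_Maclaurin_8:
  fixes x :: real
  shows "\<bar>cos x - (1 - x\<^sup>2 / 2 + x ^ 4 / 24 - x ^ 6 / 720)\<bar> \<le> x ^ 8 / 40320"
proof -
  obtain t where t: "cos x = (\<Sum>m<8. cos_coeff m * x ^ m) + cos (t + 1 / 2 * real 8 * pi) / fact 8 * x ^ 8"
    using Maclaurin_cos_expansion [of x 8] by blast
  have "(\<Sum>m<8. cos_coeff m * x ^ m) = 1 - x\<^sup>2 / 2 + x ^ 4 / 24 - x ^ 6 / 720"
    by (simp add: eval_nat_numeral cos_coeff_Suc sin_coeff_Suc)
  moreover have "\<bar>cos (t + 1 / 2 * real 8 * pi) / fact 8 * x ^ 8\<bar> \<le> 1 / fact 8 * x ^ 8"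
    unfolding abs_mult abs_divide by (intro mult_mono) (auto simp: divide_right_mono)
  ultimately show ?thesis unfolding t by (simp add: fact_numeral)
qed

text \<open>The cosine decreases on [0, pi], so cosines can be compared instead; they are squared
  because \<open>(cos side)\<^sup>2\<close> is rational in \<open>golden\<close>.\<close>

lemma side_bounds: "37.37 \<le> side * 180 / pi" "side * 180 / pi < 37.38"
proof -
  define x where "x = 37.37 * pi / 180"
  define y where "y = 37.38 * pi / 180"
  \<comment> \<open>Radian values of 37.37 and 37.38 degrees, rounded outwards. The decimals 0.79466
    and 0.79464 below enclose \<open>cos side\<close>, which is about 0.794654.\<close>
  have x: "(65222 / 100000) < x" "x < (65224 / 100000)" and y: "(65240 / 100000) < y" "y < (65241 / 100000)"
    unfolding x_def y_def using pi_approx by simp_all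
  show "37.37 \<le> side * 180 / pi"
  proof (rule ccontr)
    assume "\<not> ?thesis"
    then have "side < x" by (simp add: x_def field_simps)
    then have "cos x < cos side" using side_between x pi_gt3 by (intro cos_monotone_0_pi) auto
    have "1 - x\<^sup>2 / 2 + x ^ 4 / 24 - x ^ 6 / 720 - x ^ 8 / 40320 \<le> cos x"
      using cos_Maclaurin_8 [of x] by linarith
    moreover have "x\<^sup>2 \<le> (65224 / 100000)\<^sup>2" "(65222 / 100000) ^ 4 \<le> x ^ 4" "x ^ 6 \<le> (65224 / 100000) ^ 6" "x ^ 8 \<le> (65224 / 100000) ^ 8"
      using x by (intro power_mono; simp)+
    ultimately have "(79466 / 100000) \<le> cos x" by (simp add: power_numeral_reduce)
    then have "(79466 / 100000)\<^sup>2 < (cos side)\<^sup>2" using \<open>cos x < cos side\<close> by (intro power_strict_mono) auto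
    then show False unfolding cos_side_sq using golden_bounds by (simp add: field_simps)
  qed
  show "side * 180 / pi < 37.38"
  proof (rule ccontr)
    assume "\<not> ?thesis"
    then have "y \<le> side" by (simp add: y_def field_simps)
    then have "cos side \<le> cos y" using side_between y pi_gt3 by (intro cos_monotone_0_pi_le) auto
    have "cos y \<le> 1 - y\<^sup>2 / 2 + y ^ 4 / 24 - y ^ 6 / 720 + y ^ 8 / 40320"
      using cos_Maclaurin_8 [of y] by linarith
    moreover have "(65240 / 100000)\<^sup>2 \<le> y\<^sup>2" "y ^ 4 \<le> (65241 / 100000) ^ 4" "(65240 / 100000) ^ 6 \<le> y ^ 6" "y ^ 8 \<le> (65241 / 100000) ^ 8"
      using y by (intro power_mono; simp)+
    ultimately have "cos y \<le> (79464 / 100000)" by (simp add: power_numeral_reduce)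
    then have "(cos side)\<^sup>2 \<le> (79464 / 100000)\<^sup>2" using \<open>cos side \<le> cos y\<close> cos_side_pos by (intro power_mono) auto
    then show False unfolding cos_side_sq using golden_bounds by (simp add: field_simps)
  qed
qed

section \<open>Latitude and longitude along the equal sides\<close>

lemma increment_bounds:
  fixes f f' :: "real \<Rightarrow> real"
  assumes "a \<le> b"
    and "\<And>x. a \<le> x \<Longrightarrow> x \<le> b \<Longrightarrow> (f has_real_derivative f' x) (at x)"
    and "\<And>x. a \<le> x \<Longrightarrow> x \<le> b \<Longrightarrow> m \<le> f' x \<and> f' x \<le> M"
  shows "m * (b - a) \<le> f b - f a" "f b - f a \<le> M * (b - a)"
proof -
  have "m * (b - a) \<le> f b - f a \<and> f b - f a \<le> M * (b - a)"
  proof (cases "a < b")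
    case True
    then obtain z where "a < z" "z < b" "f b - f a = (b - a) * f' z"
      using MVT2 [of a b f f'] assms(2) by auto
    then show ?thesis using assms(3) [of z] True by (auto simp: mult.commute)
  qed (use assms(1) in simp)
  then show "m * (b - a) \<le> f b - f a" "f b - f a \<le> M * (b - a)" by auto
qed

text \<open>The function \<open>\<lambda>x. f (x + h) - f x\<close> has derivative
  \<open>f' (x + h) - f' x\<close>, nonnegative when \<open>f'\<close> is monotone. It is applied to
  \<open>lon\<close> and to the negative of \<open>lat\<close>.\<close>

lemma increment_mono:
  fixes f f' :: "real \<Rightarrow> real"
  assumes "t \<le> u" "0 \<le> h"
    and "\<And>x. t \<le> x \<Longrightarrow> x \<le> u + h \<Longrightarrow> (f has_real_derivative f' x) (at x)"
    and "\<And>x y. t \<le> x \<Longrightarrow> x \<le> y \<Longrightarrow> y \<le> u + h \<Longrightarrow> f' x \<le> f' y"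
  shows "f (t + h) - f t \<le> f (u + h) - f u"
proof (rule DERIV_nonneg_imp_nondecreasing [of t u "\<lambda>x. f (x + h) - f x"])
  show "\<exists>y. ((\<lambda>x. f (x + h) - f x) has_real_derivative y) (at x) \<and> 0 \<le> y" if "t \<le> x" "x \<le> u" for x
  proof (intro exI conjI)
    have "((\<lambda>x. f (x + h)) has_real_derivative f' (x + h)) (at x)"
      unfolding DERIV_shift [symmetric] using that assms(2) by (intro assms(3)) linarith+
    moreover have "(f has_real_derivative f' x) (at x)"
      using that assms(2) by (intro assms(3)) linarith+
    ultimately show "((\<lambda>x. f (x + h) - f x) has_real_derivative (f' (x + h) - f' x)) (at x)"
      by (rule DERIV_diff)
    show "0 \<le> f' (x + h) - f' x" using assms(4) [of x "x + h"] that assms(2) by simp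
  qed
qed (rule assms)

definition lat :: "real \<Rightarrow> real" where "lat t = arcsin (s36 * sin t)"
definition lon :: "real \<Rightarrow> real" where "lon t = arctan (c36 * tan t)"

lemma s36_sin_bounds: "\<bar>s36 * sin t\<bar> < 1"
proof -
  have "s36\<^sup>2 < 1\<^sup>2" unfolding s36_sq using golden_bounds by simp
  then have "\<bar>s36\<bar> < 1" by (simp add: abs_square_less_1)
  moreover have "\<bar>s36 * sin t\<bar> \<le> \<bar>s36\<bar> * 1" unfolding abs_mult by (intro mult_left_mono) auto
  ultimately show ?thesis by simp
qed

lemma s36_sin_bounds': "-1 < s36 * sin t" "s36 * sin t < 1" "-1 \<le> s36 * sin t" "s36 * sin t \<le> 1"
  using s36_sin_bounds [of t] by auto

lemma sin_lat: "sin (lat t) = s36 * sin t"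
  by (simp add: lat_def s36_sin_bounds')

lemma lat_between: "- (pi / 2) < lat t" "lat t < pi / 2"
  using arcsin_lt_bounded [of "s36 * sin t"] by (simp_all add: lat_def s36_sin_bounds')

lemma cos_lat_pos [simp]: "cos (lat t) > 0"
  using lat_between by (simp add: cos_gt_zero_pi)

lemma cos_lat_nonzero [simp]: "cos (lat t) \<noteq> 0"
  using cos_lat_pos [of t] by linarith

lemma trig_const_nonneg [simp]: "0 \<le> s36" "0 \<le> c36" "0 \<le> cos (lat t)"
  using s36_pos c36_pos cos_lat_pos [of t] by linarith+

text \<open>Both sides are the squared distance from the polar axis of the point at distance t along
  the equal side, whose coordinates are \<open>cos t\<close>, \<open>c36 * sin t\<close> and
  \<open>s36 * sin t\<close>.\<close>

lemma cos_lat_sq: "(cos (lat t))\<^sup>2 = (cos t)\<^sup>2 + c36\<^sup>2 * (sin t)\<^sup>2"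
proof -
  have "(cos (lat t))\<^sup>2 = 1 - (s36 * sin t)\<^sup>2" by (simp add: cos_squared_eq sin_lat)
  moreover have "s36\<^sup>2 = 1 - c36\<^sup>2" using s36_c36 by linarith
  ultimately show ?thesis by (simp add: power_mult_distrib cos_squared_eq algebra_simps)
qed

lemma lat_minus: "lat (- t) = - lat t"
  using s36_sin_bounds' [of t] by (simp add: lat_def arcsin_minus)

lemma lat_0 [simp]: "lat 0 = 0" and lon_0 [simp]: "lon 0 = 0"
  by (simp_all add: lat_def lon_def)

lemma sqrt_lon:
  assumes "cos t > 0"
  shows "1 + (c36 * tan t)\<^sup>2 = (cos (lat t) / cos t)\<^sup>2"
    "sqrt (1 + (c36 * tan t)\<^sup>2) = cos (lat t) / cos t"
proof -
  show *: "1 + (c36 * tan t)\<^sup>2 = (cos (lat t) / cos t)\<^sup>2"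
    using assms by (simp add: power_divide cos_lat_sq tan_def field_simps)
  show "sqrt (1 + (c36 * tan t)\<^sup>2) = cos (lat t) / cos t"
    unfolding * using assms by (simp add: less_imp_le)
qed

text \<open>The spherical theorem of Pythagoras. Together with \<open>cos_lat_sin_lon\<close> and
  \<open>sin_lat\<close> it converts the latitude and longitude of a point of the side into the
  coordinates \<open>cos t\<close>, \<open>c36 * sin t\<close>, \<open>s36 * sin t\<close>.\<close>

lemma cos_lat_cos_lon: "cos t > 0 \<Longrightarrow> cos (lat t) * cos (lon t) = cos t"
  by (simp add: lon_def cos_arctan sqrt_lon del: real_sqrt_one)

lemma cos_lat_sin_lon: "cos t > 0 \<Longrightarrow> cos (lat t) * sin (lon t) = c36 * sin t"
  unfolding lon_def sin_arctan sqrt_lon by (simp add: tan_def)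

lemma DERIV_lat: "(lat has_real_derivative s36 * cos t / cos (lat t)) (at t)"
proof -
  have "sqrt (1 - (s36 * sin t)\<^sup>2) = cos (lat t)"
    by (simp add: lat_def cos_arcsin s36_sin_bounds')
  moreover have "((\<lambda>t. arcsin (s36 * sin t)) has_real_derivative
      inverse (sqrt (1 - (s36 * sin t)\<^sup>2)) * (s36 * cos t)) (at t)"
    by (rule DERIV_chain2 [OF DERIV_arcsin]) (auto intro!: derivative_eq_intros simp: s36_sin_bounds')
  moreover have "inverse (cos (lat t)) * (s36 * cos t) = s36 * cos t / cos (lat t)"
    by (simp add: divide_inverse)
  ultimately show ?thesis unfolding lat_def [abs_def] by simp
qed

text \<open>The factor \<open>(cos t)\<^sup>2\<close> from the derivative of the tangent cancels.
  The slope then depends on t only through \<open>cos (lat t)\<close>, so its monotonicity is that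
  of a cosine.\<close>

lemma DERIV_lon:
  assumes "cos t > 0"
  shows "(lon has_real_derivative c36 / (cos (lat t))\<^sup>2) (at t)"
proof -
  have "(tan has_real_derivative inverse ((cos t)\<^sup>2)) (at t)" using assms by (intro DERIV_tan) simp
  then have "((\<lambda>t. c36 * tan t) has_real_derivative c36 * inverse ((cos t)\<^sup>2)) (at t)"
    by (rule DERIV_cmult)
  then have "(lon has_real_derivative inverse (1 + (c36 * tan t)\<^sup>2) * (c36 * inverse ((cos t)\<^sup>2))) (at t)"
    unfolding lon_def [abs_def] by (rule DERIV_chain2 [OF DERIV_arctan])
  moreover have "inverse (1 + (c36 * tan t)\<^sup>2) * (c36 * inverse ((cos t)\<^sup>2)) = c36 / (cos (lat t))\<^sup>2"
    unfolding sqrt_lon(1) [OF assms] using assms by (simp add: power_divide field_simps)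
  ultimately show ?thesis by simp
qed

lemma side_bound: "0 < side" "side < 66 / 100" "side < pi / 2"
proof -
  show "side < 66 / 100" using side_bounds(2) pi_approx by (simp add: field_simps)
  then show "side < pi / 2" using pi_gt3 by linarith
  show "0 < side" using side_bounds(1) pi_gt3 by (simp add: field_simps)
qed

lemma cos_pos_side: "\<bar>t\<bar> \<le> side \<Longrightarrow> cos t > 0"
  using side_bound by (intro cos_gt_zero_pi) auto

text \<open>\<open>lat side\<close> is half the base, the leg opposite the 36 degree angle in the
  right-angled half triangle; Napier's rule gives cos 36 = cos (half base) sin 60.\<close>

lemma cos_lat_side: "cos (lat side) = 2 * c36 / sqrt 3"
proof -
  have "(cos (lat side))\<^sup>2 = (2 * c36 / sqrt 3)\<^sup>2"
  proof -
    define X where "X = (cos side)\<^sup>2"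
    have "X * (3 - golden) = (golden + 1) / 3"
      unfolding X_def cos_side_sq using golden_bounds by (simp add: field_simps)
    moreover have "X + (golden + 1) / 4 * (1 - X) = (golden + 1) / 4 + X * (3 - golden) / 4"
      by (simp add: field_simps)
    ultimately have "X + (golden + 1) / 4 * (1 - X) = (golden + 1) / 3"
      by (simp add: field_simps)
    moreover have "(cos (lat side))\<^sup>2 = X + (golden + 1) / 4 * (1 - X)"
      by (simp only: cos_lat_sq sin_squared_eq c36_sq X_def)
    moreover have "(2 * c36 / sqrt 3)\<^sup>2 = (golden + 1) / 3"
      by (simp add: c36_sq power_divide power_mult_distrib)
    ultimately show ?thesis by simp
  qed
  then show ?thesis by (simp add: power2_eq_iff_nonneg)
qed

lemma cos_lat_antimono:
  assumes "0 \<le> t" "t \<le> u" "u \<le> side"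
  shows "cos (lat u) \<le> cos (lat t)"
proof -
  have "sin t \<le> sin u" using assms side_bound by (intro sin_monotone_2pi_le) auto
  moreover have "sin t \<ge> 0" using assms side_bound by (intro sin_ge_zero) auto
  ultimately have "(s36 * sin t)\<^sup>2 \<le> (s36 * sin u)\<^sup>2"
    by (intro power_mono mult_left_mono) auto
  then have "(cos (lat u))\<^sup>2 \<le> (cos (lat t))\<^sup>2" by (simp add: cos_squared_eq sin_lat)
  then show ?thesis by (rule power2_le_imp_le) simp
qed

text \<open>After clearing denominators and squaring, the two sides differ by
  \<open>c36\<^sup>2\<close> times the difference of the squared sines.\<close>

lemma lat_slope_antimono:
  assumes "0 \<le> t" "t \<le> u" "u \<le> side"
  shows "s36 * cos u / cos (lat u) \<le> s36 * cos t / cos (lat t)"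
proof -
  have "0 < cos u" "0 < cos t" using assms by (auto intro!: cos_pos_side)
  have "sin t \<le> sin u" using assms side_bound by (intro sin_monotone_2pi_le) auto
  moreover have "sin t \<ge> 0" using assms side_bound by (intro sin_ge_zero) auto
  ultimately have s: "(sin t)\<^sup>2 \<le> (sin u)\<^sup>2" by (intro power_mono) auto
  have "(cos u * cos (lat t))\<^sup>2 \<le> (cos t * cos (lat u))\<^sup>2"
  proof -
    have "(cos t * cos (lat u))\<^sup>2 - (cos u * cos (lat t))\<^sup>2 = c36\<^sup>2 * ((sin u)\<^sup>2 - (sin t)\<^sup>2)"
      unfolding power_mult_distrib cos_lat_sq unfolding cos_squared_eq by algebra
    moreover have "0 \<le> c36\<^sup>2 * ((sin u)\<^sup>2 - (sin t)\<^sup>2)" using s by simp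
    ultimately show ?thesis by linarith
  qed
  then have "cos u * cos (lat t) \<le> cos t * cos (lat u)"
    by (rule power2_le_imp_le) (use \<open>0 < cos t\<close> in simp)
  then show ?thesis by (simp add: field_simps)
qed

text \<open>The slope is the sine of the angle between the side and the circle of latitude. It falls
  from sin 36 at the apex to cos 60 = 1/2 at the base, which the side meets at 60 degrees.\<close>

lemma lat_slope_bounds:
  assumes "0 \<le> t" "t \<le> side"
  shows "1 / 2 \<le> s36 * cos t / cos (lat t)" "s36 * cos t / cos (lat t) \<le> s36"
  using lat_slope_antimono [of t side] lat_slope_antimono [of 0 t] assms
  by (simp_all add: cos_side cos_lat_side)

lemma lon_slope_bounds:
  assumes "0 \<le> t" "t \<le> side"
  shows "c36 \<le> c36 / (cos (lat t))\<^sup>2" "c36 / (cos (lat t))\<^sup>2 \<le> 3 / (4 * c36)"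
proof -
  have "(cos (lat t))\<^sup>2 \<le> 1" by (simp add: cos_squared_eq)
  then show "c36 \<le> c36 / (cos (lat t))\<^sup>2" by (simp add: field_simps)
  have "(cos (lat side))\<^sup>2 \<le> (cos (lat t))\<^sup>2"
    using assms by (intro power_mono cos_lat_antimono) auto
  then have "4 * c36\<^sup>2 / 3 \<le> (cos (lat t))\<^sup>2" by (simp add: cos_lat_side power_divide power_mult_distrib)
  then have "c36 / (cos (lat t))\<^sup>2 \<le> c36 / (4 * c36\<^sup>2 / 3)"
    by (intro divide_left_mono) auto
  then show "c36 / (cos (lat t))\<^sup>2 \<le> 3 / (4 * c36)" by (simp add: power2_eq_square)
qed

context
  fixes t u h :: real
  assumes tuh: "0 \<le> t" "t \<le> u" "0 \<le> h" "u + h \<le> side"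
begin

lemma lat_increment_antimono: "lat (u + h) - lat u \<le> lat (t + h) - lat t"
proof -
  have "- lat (t + h) - - lat t \<le> - lat (u + h) - - lat u"
  proof (rule increment_mono [where f = "\<lambda>x. - lat x"])
    show "((\<lambda>x. - lat x) has_real_derivative - (s36 * cos x / cos (lat x))) (at x)" for x
      by (intro derivative_intros DERIV_lat)
    show "- (s36 * cos x / cos (lat x)) \<le> - (s36 * cos y / cos (lat y))"
      if "t \<le> x" "x \<le> y" "y \<le> u + h" for x y
      using lat_slope_antimono [of x y] that tuh by simp
  qed (use tuh in auto)
  then show ?thesis by simp
qed

lemma lon_increment_mono: "lon (t + h) - lon t \<le> lon (u + h) - lon u"
proof -
  have deriv: "(lon has_real_derivative c36 / (cos (lat x))\<^sup>2) (at x)" if "t \<le> x" "x \<le> u + h" for x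
  proof (rule DERIV_lon, rule cos_pos_side)
    show "\<bar>x\<bar> \<le> side" using that tuh by linarith
  qed
  have mono: "c36 / (cos (lat x))\<^sup>2 \<le> c36 / (cos (lat y))\<^sup>2"
    if "t \<le> x" "x \<le> y" "y \<le> u + h" for x y
  proof -
    have "cos (lat y) \<le> cos (lat x)" using that tuh by (intro cos_lat_antimono) linarith+
    then have "(cos (lat y))\<^sup>2 \<le> (cos (lat x))\<^sup>2" by (rule power_mono) simp
    then show ?thesis by (intro divide_left_mono) simp_all
  qed
  show ?thesis by (rule increment_mono [OF tuh(2) tuh(3) deriv mono])
qed

end

lemma lat_increment_bounds:
  assumes "0 \<le> t" "0 \<le> h" "t + h \<le> side"
  shows "h / 2 \<le> lat (t + h) - lat t" "lat (t + h) - lat t \<le> s36 * h"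
proof -
  have le: "t \<le> t + h" using assms by simp
  have slope: "1 / 2 \<le> s36 * cos x / cos (lat x) \<and> s36 * cos x / cos (lat x) \<le> s36"
    if "t \<le> x" "x \<le> t + h" for x
    using lat_slope_bounds [of x] that assms by auto
  note * = increment_bounds [OF le DERIV_lat slope]
  show "h / 2 \<le> lat (t + h) - lat t" "lat (t + h) - lat t \<le> s36 * h"
    using *(1) *(2) by simp_all
qed

lemma lon_increment_bounds:
  assumes "0 \<le> t" "0 \<le> h" "t + h \<le> side"
  shows "c36 * h \<le> lon (t + h) - lon t" "lon (t + h) - lon t \<le> 3 / (4 * c36) * h"
proof -
  have le: "t \<le> t + h" using assms by simp
  have deriv: "(lon has_real_derivative c36 / (cos (lat x))\<^sup>2) (at x)"
    if "t \<le> x" "x \<le> t + h" for x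
    using that assms by (intro DERIV_lon cos_pos_side) linarith
  have slope: "c36 \<le> c36 / (cos (lat x))\<^sup>2 \<and> c36 / (cos (lat x))\<^sup>2 \<le> 3 / (4 * c36)"
    if "t \<le> x" "x \<le> t + h" for x
    using lon_slope_bounds [of x] that assms by auto
  note * = increment_bounds [OF le deriv slope]
  show "c36 * h \<le> lon (t + h) - lon t" "lon (t + h) - lon t \<le> 3 / (4 * c36) * h"
    using *(1) *(2) by simp_all
qed

section \<open>Facets of convex hulls\<close>

text \<open>A face of the hull of a compact set is the hull of some of its points; these points
  belong to S and lie on the hyperplane.\<close>

lemma convex_hull_Int_supporting_hyperplane:
  fixes S :: "'a::euclidean_space set"
  assumes "finite S" and le: "\<And>y. y \<in> S \<Longrightarrow> a \<bullet> y \<le> b"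
  shows "convex hull S \<inter> {y. a \<bullet> y = b} face_of convex hull S"
    and "convex hull S \<inter> {y. a \<bullet> y = b} = convex hull (S \<inter> {y. a \<bullet> y = b})"
proof -
  have "convex hull S \<subseteq> {y. a \<bullet> y \<le> b}"
    by (rule hull_minimal) (use le in \<open>auto simp: convex_halfspace_le\<close>)
  then show face: "convex hull S \<inter> {y. a \<bullet> y = b} face_of convex hull S"
    by (intro face_of_Int_supporting_hyperplane_le) auto
  obtain S' where S': "S' \<subseteq> S" "convex hull S \<inter> {y. a \<bullet> y = b} = convex hull S'"
    using face_of_convex_hull_subset [OF finite_imp_compact [OF \<open>finite S\<close>] face] by metis
  have "S' \<subseteq> convex hull S'" by (rule hull_subset)
  then have "S' \<subseteq> S \<inter> {y. a \<bullet> y = b}" using S' by auto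
  then have "convex hull S \<inter> {y. a \<bullet> y = b} \<subseteq> convex hull (S \<inter> {y. a \<bullet> y = b})"
    unfolding S'(2) by (rule hull_mono)
  moreover have "convex hull (S \<inter> {y. a \<bullet> y = b}) \<subseteq> convex hull S \<inter> {y. a \<bullet> y = b}"
  proof (rule hull_minimal)
    show "S \<inter> {y. a \<bullet> y = b} \<subseteq> convex hull S \<inter> {y. a \<bullet> y = b}"
      by (rule Int_mono [OF hull_subset order_refl])
    show "convex (convex hull S \<inter> {y. a \<bullet> y = b})"
      by (rule convex_Int [OF convex_convex_hull convex_hyperplane])
  qed
  ultimately show "convex hull S \<inter> {y. a \<bullet> y = b} = convex hull (S \<inter> {y. a \<bullet> y = b})"
    by (rule subset_antisym)
qed

lemma inner_eq_1_unit:
  fixes x y :: "'a::real_inner"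
  assumes "norm x = 1" "norm y = 1" "x \<bullet> y = 1"
  shows "x = y"
proof -
  have "x \<bullet> x = 1" "y \<bullet> y = 1" using assms by (simp_all add: dot_square_norm)
  then have "(x - y) \<bullet> (x - y) = 0"
    using assms(3) by (simp add: inner_diff_left inner_diff_right inner_commute [of y x])
  then show ?thesis by simp
qed

text \<open>The plane tangent to the sphere at x supports the hull and, by the equality case of
  Cauchy-Schwarz, contains no point of S other than x.\<close>

lemma unit_in_convex_hull_unit:
  fixes x :: "'a::euclidean_space"
  assumes "finite S" "S \<subseteq> sphere 0 1" "x \<in> convex hull S" "norm x = 1"
  shows "x \<in> S"
proof -
  have le: "x \<bullet> y \<le> 1" if "y \<in> S" for y
    using norm_cauchy_schwarz [of x y] that assms by auto
  have "x \<bullet> x = 1" using assms(4) by (simp add: dot_square_norm)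
  then have "x \<in> convex hull S \<inter> {y. x \<bullet> y = 1}" using assms(3) by simp
  then have "x \<in> convex hull (S \<inter> {y. x \<bullet> y = 1})"
    by (simp only: convex_hull_Int_supporting_hyperplane(2) [OF assms(1) le])
  moreover have "S \<inter> {y. x \<bullet> y = 1} \<subseteq> {x}"
  proof
    fix y assume "y \<in> S \<inter> {y. x \<bullet> y = 1}"
    then show "y \<in> {x}" using inner_eq_1_unit [of x y] assms by auto
  qed
  ultimately have "S \<inter> {y. x \<bullet> y = 1} \<noteq> {}" by force
  with \<open>S \<inter> {y. x \<bullet> y = 1} \<subseteq> {x}\<close> show ?thesis by blast
qed

lemma extreme_points_of_unit_hull:
  fixes S :: "'a::euclidean_space set"
  assumes "finite S" "S \<subseteq> sphere 0 1"
  shows "{v. v extreme_point_of convex hull S} = S"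
proof (intro subset_antisym subsetI)
  fix x assume "x \<in> S"
  then have x: "norm x = 1" using assms by auto
  have le: "x \<bullet> y \<le> 1" if "y \<in> S" for y
    using norm_cauchy_schwarz [of x y] that assms(2) x by auto
  have "y = x" if "y \<in> S" "x \<bullet> y = 1" for y
    using inner_eq_1_unit [of x y] that assms(2) x by auto
  moreover have "x \<bullet> x = 1" using x by (simp add: dot_square_norm)
  ultimately have "S \<inter> {y. x \<bullet> y = 1} = {x}" using \<open>x \<in> S\<close> by auto
  then have "convex hull S \<inter> {y. x \<bullet> y = 1} = {x}"
    by (simp only: convex_hull_Int_supporting_hyperplane(2) [OF assms(1) le] convex_hull_singleton)
  then have "{x} face_of convex hull S"
    using convex_hull_Int_supporting_hyperplane(1) [OF assms(1) le] by metis
  then show "x \<in> {v. v extreme_point_of convex hull S}" by (simp add: face_of_singleton)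
next
  fix x assume "x \<in> {v. v extreme_point_of convex hull S}"
  then show "x \<in> S" using extreme_point_of_convex_hull by blast
qed

context
  fixes Q :: "'a::euclidean_space set" and \<F> :: "'a set set"
  assumes Q: "convex Q"
    and facets: "\<And>F. F \<in> \<F> \<Longrightarrow> F facet_of Q"
    and cover: "\<And>x. x \<noteq> 0 \<Longrightarrow> \<exists>F\<in>\<F>. \<exists>t>0. t *\<^sub>R x \<in> F"
begin

lemma cover_ray: "x \<noteq> 0 \<Longrightarrow> \<exists>t>0. t *\<^sub>R x \<in> Q"
  using cover facets facet_of_imp_subset by blast

text \<open>Every nonzero point x of Q has a point of Q on the opposite ray. So 0 is interior to a
  segment in Q that starts at x, and a face through 0 must contain x.\<close>

lemma cover_zero_face:
  assumes "G face_of Q" "0 \<in> G"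
  shows "G = Q"
proof (intro subset_antisym subsetI)
  fix x assume x: "x \<in> Q"
  show "x \<in> G"
  proof (cases "x = 0")
    case False
    then obtain t where t: "t > 0" "t *\<^sub>R (- x) \<in> Q" using cover_ray [of "- x"] by auto
    have "0 \<in> open_segment x (t *\<^sub>R (- x))"
      unfolding in_segment
    proof (intro conjI exI)
      show "x \<noteq> t *\<^sub>R (- x)"
      proof
        assume "x = t *\<^sub>R (- x)"
        then have "(1 + t) *\<^sub>R x = t *\<^sub>R (- x) + t *\<^sub>R x"
          unfolding scaleR_add_left by simp
        then have "(1 + t) *\<^sub>R x = 0" by simp
        then show False using False t by simp
      qed
      have "1 - 1 / (1 + t) = t / (1 + t)" using t by (simp add: field_simps)
      then show "0 = (1 - 1 / (1 + t)) *\<^sub>R x + (1 / (1 + t)) *\<^sub>R t *\<^sub>R (- x)" by simp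
    qed (use t in auto)
    then show ?thesis using face_ofD [OF assms(1)] assms(2) x t by blast
  qed (use assms in simp)
qed (use assms face_of_imp_subset in blast)

lemma cover_zero: "0 \<in> Q"
proof -
  obtain b :: 'a where "b \<in> Basis" using nonempty_Basis by blast
  then have "b \<noteq> 0" by (simp add: nonzero_Basis)
  then obtain s t where st: "s > 0" "t > 0" "s *\<^sub>R b \<in> Q" "t *\<^sub>R (- b) \<in> Q"
    using cover_ray [of b] cover_ray [of "- b"] by auto
  have mem: "(t / (s + t)) *\<^sub>R s *\<^sub>R b + (s / (s + t)) *\<^sub>R t *\<^sub>R (- b) \<in> Q"
  proof (rule convexD [OF Q])
    show "t / (s + t) + s / (s + t) = 1"
      using st by (simp add: add_divide_distrib [symmetric] add.commute)
  qed (use st in auto)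
  have zero: "(t / (s + t)) *\<^sub>R s *\<^sub>R b + (s / (s + t)) *\<^sub>R t *\<^sub>R (- b) = 0"
    by (simp add: mult.commute)
  show "0 \<in> Q" using mem by (simp only: zero)
qed

lemma aff_dim_cover: "aff_dim Q = DIM('a)"
proof -
  have "0 \<in> Q" by (rule cover_zero)
  then have "affine hull Q = span Q" by (intro affine_hull_span_0 hull_inc)
  moreover have "x \<in> span Q" for x
  proof (cases "x = 0")
    case False
    then obtain t where "t > 0" "t *\<^sub>R x \<in> Q" using cover_ray by blast
    then have "(1 / t) *\<^sub>R t *\<^sub>R x \<in> span Q" by (intro span_scale span_base)
    then show ?thesis using \<open>t > 0\<close> by simp
  qed (simp add: span_zero)
  ultimately have "affine hull Q = UNIV" by auto
  then show ?thesis by (simp add: aff_dim_eq_full)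
qed

text \<open>Let x be a relative interior point of a facet G. The ray through x meets a member F of
  the family, and it does so at x itself, as otherwise G or F would contain 0. So F contains G, and
  equality of dimensions makes them equal.\<close>

lemma facet_of_cover: "G facet_of Q \<longleftrightarrow> G \<in> \<F>"
proof
  assume G: "G facet_of Q"
  then have face: "G face_of Q" "G \<noteq> {}" "G \<noteq> Q" and "convex G"
    using facet_of_irrefl face_of_imp_convex by (auto simp: facet_of_def)
  then obtain x where x: "x \<in> rel_interior G" using rel_interior_eq_empty by blast
  then have "x \<in> G" using rel_interior_subset by blast
  have zero: "0 \<notin> H" if "H facet_of Q" for H
    using cover_zero_face [of H] that facet_of_irrefl facet_of_imp_face_of by blast
  have "x \<noteq> 0" using zero [OF G] \<open>x \<in> G\<close> by blast
  then obtain F t where F: "F \<in> \<F>" "t > 0" "t *\<^sub>R x \<in> F" using cover by blast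
  then have FQ: "F facet_of Q" by (simp add: facets)
  have sub: "G \<subseteq> Q" "F \<subseteq> Q" using G FQ facet_of_imp_subset by blast+
  have "0 \<in> Q" by (rule cover_zero)
  have "t = 1"
  proof (rule ccontr)
    assume "t \<noteq> 1"
    then consider "t < 1" | "1 < t" by linarith
    then show False
    proof cases
      case 1
      then have "t *\<^sub>R x \<in> open_segment 0 x" using F \<open>x \<noteq> 0\<close> by (auto simp: in_segment)
      then show False
        using face_ofD [of F Q "t *\<^sub>R x" 0 x] facet_of_imp_face_of [OF FQ] F sub \<open>0 \<in> Q\<close> \<open>x \<in> G\<close> zero [OF FQ]
        by blast
    next
      case 2
      then have "x \<in> open_segment 0 (t *\<^sub>R x)" using F \<open>x \<noteq> 0\<close>
        unfolding in_segment by (intro conjI exI [of _ "1 / t"]) auto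
      then show False
        using face_ofD [of G Q x 0 "t *\<^sub>R x"] face(1) F sub \<open>0 \<in> Q\<close> \<open>x \<in> G\<close> zero [OF G]
        by blast
    qed
  qed
  then have "x \<in> F" using F by simp
  then have "G \<subseteq> F"
    using subset_of_face_of [OF facet_of_imp_face_of [OF FQ] sub(1)] x by (auto simp: disjnt_iff)
  moreover have "G face_of F" by (rule face_of_subset [OF face(1) \<open>G \<subseteq> F\<close> sub(2)])
  moreover have "convex F" using FQ face_of_imp_convex facet_of_imp_face_of by blast
  moreover have "aff_dim G = aff_dim F" using G FQ by (simp add: facet_of_def)
  ultimately have "G = F" using face_of_aff_dim_lt by force
  then show "G \<in> \<F>" using F by simp
qed (rule facets)

end

lemma triangle_simplex:
  fixes p q r :: "'a::euclidean_space"
  assumes "\<not> affine_dependent {p, q, r}" "p \<noteq> q" "p \<noteq> r" "q \<noteq> r"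
  shows "2 simplex convex hull {p, q, r}"
proof -
  have "card {p, q, r} = 3" using assms by simp
  then show ?thesis unfolding simplex_def using assms(1) by (intro exI [of _ "{p, q, r}"]) simp
qed

text \<open>The faces of a simplex are the hulls of subsets of its vertices; dimension 1 leaves the
  subsets with two elements.\<close>

lemma edge_of_triangle:
  fixes p q r :: "'a::euclidean_space"
  assumes "\<not> affine_dependent {p, q, r}" "E edge_of convex hull {p, q, r}"
  shows "E \<in> {closed_segment p q, closed_segment p r, closed_segment q r}"
proof -
  have E: "E face_of convex hull {p, q, r}" "aff_dim E = 1" using assms(2) by (auto simp: edge_of_def)
  then obtain c where c: "c \<subseteq> {p, q, r}" "E = convex hull c"
    unfolding face_of_convex_hull_affine_independent [OF assms(1)] by blast
  then have "aff_dim c = 1" using E aff_dim_convex_hull [of c] by simp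
  moreover have "\<not> affine_dependent c" using assms(1) c(1) affine_independent_subset by blast
  ultimately have "card c = 2" using aff_dim_affine_independent [of c] by simp
  then obtain x y where "c = {x, y}" "x \<noteq> y" by (auto simp: card_2_iff)
  then have "E = convex hull {x, y}" and xy: "x \<in> {p, q, r}" "y \<in> {p, q, r}" using c by auto
  then have E: "E = closed_segment x y" by (simp only: segment_convex_hull)
  from xy \<open>x \<noteq> y\<close> show ?thesis
    unfolding E by (elim insertE emptyE) (simp_all add: closed_segment_commute)
qed

lemma segment_edge_of_triangle:
  fixes p q r :: "'a::euclidean_space"
  assumes "\<not> affine_dependent {p, q, r}" "p \<noteq> q"
  shows "closed_segment p q edge_of convex hull {p, q, r}"
proof -
  have "convex hull {p, q} face_of convex hull {p, q, r}"
    unfolding face_of_convex_hull_affine_independent [OF assms(1)]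
    by (intro exI [of _ "{p, q}"]) simp
  moreover have "aff_dim (convex hull {p, q}) = 1"
    using assms(2) by (simp only: aff_dim_convex_hull aff_dim_2 if_False)
  ultimately show ?thesis by (simp add: edge_of_def segment_convex_hull)
qed

lemma diameter_closed_segment: "diameter (closed_segment a b) = dist a (b::'a::euclidean_space)"
proof (rule antisym)
  show "diameter (closed_segment a b) \<le> dist a b"
  proof (rule diameter_le)
    fix x y assume "x \<in> closed_segment a b" "y \<in> closed_segment a b"
    then obtain u v where uv: "0 \<le> u" "u \<le> 1" "x = (1 - u) *\<^sub>R a + u *\<^sub>R b"
      "0 \<le> v" "v \<le> 1" "y = (1 - v) *\<^sub>R a + v *\<^sub>R b"
      unfolding in_segment by blast
    then have "x - y = (v - u) *\<^sub>R (a - b)" unfolding uv(3,6) by (simp add: algebra_simps)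
    then have "norm (x - y) = \<bar>v - u\<bar> * dist a b" by (simp add: dist_norm)
    also have "\<dots> \<le> 1 * dist a b" using uv by (intro mult_right_mono) auto
    finally show "norm (x - y) \<le> dist a b" by simp
  qed simp
  show "dist a b \<le> diameter (closed_segment a b)"
    by (intro diameter_bounded_bound compact_imp_bounded compact_segment) auto
qed

context
  fixes f :: "'a::euclidean_space \<Rightarrow> 'a"
  assumes f: "orthogonal_transformation f"
begin

lemma orth_linear: "linear f" and orth_inj: "inj f"
  using f by (simp_all add: orthogonal_transformation_linear orthogonal_transformation_inj)

lemma orth_sgn: "f (sgn x) = sgn (f x)"
  using f by (simp add: sgn_div_norm orthogonal_transformation_norm linear_cmul [OF orth_linear])

lemma facet_of_orth_image: "f ` F facet_of f ` S \<longleftrightarrow> F facet_of S"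
  by (simp add: facet_of_def face_of_linear_image [OF orth_linear orth_inj] orth_linear orth_inj)

lemma edge_of_orth_image: "f ` F edge_of f ` S \<longleftrightarrow> F edge_of S"
  by (simp add: edge_of_def face_of_linear_image [OF orth_linear orth_inj] orth_linear orth_inj)

lemma orth_closed_segment: "f ` closed_segment a b = closed_segment (f a) (f b)"
  by (rule closed_segment_linear_image [OF orth_linear, symmetric])

lemma orth_hull: "f ` (convex hull S) = convex hull (f ` S)"
  by (rule convex_hull_linear_image [OF orth_linear])

lemma extreme_points_orth_image: "{v. v extreme_point_of f ` S} = f ` {v. v extreme_point_of S}"
proof -
  have "f v extreme_point_of f ` S \<longleftrightarrow> v extreme_point_of S" for v
    using face_of_linear_image [OF orth_linear orth_inj, of "{v}" S] by (simp add: face_of_singleton)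
  moreover have "v \<in> range f" if "v extreme_point_of f ` S" for v
    using that by (auto simp: extreme_point_of_def)
  ultimately show ?thesis by blast
qed

end

lemma sph_centre_orth_image:
  assumes "orthogonal_transformation f"
  shows "sph_centre (f ` F) = f (sph_centre F)"
proof -
  note f = orth_linear [OF assms] orth_inj [OF assms]
  have "(\<Sum>v | v extreme_point_of f ` F. v) = (\<Sum>v | v extreme_point_of F. f v)"
    unfolding extreme_points_orth_image [OF assms]
    using sum.reindex [OF inj_on_subset [OF f(2) subset_UNIV], where g = "\<lambda>v. v"] by (simp add: o_def)
  also have "\<dots> = f (\<Sum>v | v extreme_point_of F. v)"
    by (simp add: linear_sum [OF f(1)])
  finally show ?thesis by (simp add: sph_centre_def orth_sgn [OF assms])
qed

section \<open>The reflection group of the dodecahedron\<close>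

lemma vector3_eq_iff: "(vector [x, y, z] :: 'a::zero^3) = vector [x', y', z'] \<longleftrightarrow> x = x' \<and> y = y' \<and> z = z'"
  by (auto simp: vec_eq_iff forall_3)

lemma inner_vector3: "(vector [x, y, z] :: real^3) \<bullet> vector [x', y', z'] = x * x' + y * y' + z * z'"
  by (simp add: inner_vec_def sum_3)

lemma vector3_components: "v = vector [v $ 1, v $ 2, v $ 3]" for v :: "real^3"
  by (simp add: vec_eq_iff forall_3)

definition reflect :: "'a::real_inner \<Rightarrow> 'a \<Rightarrow> 'a" where
  "reflect \<alpha> x = x - (2 * (\<alpha> \<bullet> x)) *\<^sub>R \<alpha>"

lemma orthogonal_transformation_reflect:
  assumes "norm \<alpha> = 1"
  shows "orthogonal_transformation (reflect \<alpha>)"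
proof -
  have "\<alpha> \<bullet> \<alpha> = 1" using assms by (simp add: dot_square_norm)
  then show ?thesis
    unfolding orthogonal_transformation_def reflect_def
    by (auto intro!: linearI simp: inner_diff_left inner_diff_right inner_commute inner_add_right algebra_simps)
qed

lemma reflect_reflect:
  assumes "norm \<alpha> = 1"
  shows "reflect \<alpha> (reflect \<alpha> x) = x"
proof -
  have "\<alpha> \<bullet> \<alpha> = 1" using assms by (simp add: dot_square_norm)
  then show ?thesis by (simp add: reflect_def inner_diff_right algebra_simps)
qed

text \<open>Unit normal vectors of three mirror planes of the dodecahedron that bound a chamber.\<close>

definition root1 :: "real^3" where "root1 = vector [1, 0, 0]"
definition root2 :: "real^3" where "root2 = vector [0, 1, 0]"
definition root3 :: "real^3" where "root3 = vector [- 1 / 2, - golden / 2, (golden - 1) / 2]"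

lemmas root_defs = root1_def root2_def root3_def

text \<open>Rewrite rules that, together with ring normalisation, bring polynomials in
  \<open>golden\<close> to degree one.\<close>

lemma golden_mult: "golden * golden = golden + 1" "golden * (golden * x) = golden * x + x"
  using golden_sq by (simp_all add: power2_eq_square algebra_simps flip: mult.assoc)

lemma norm_roots [simp]: "norm root1 = 1" "norm root2 = 1" "norm root3 = 1"
  by (simp_all add: norm_eq_1 root_defs inner_vector3 golden_mult field_simps)

abbreviation "s1 \<equiv> reflect root1"
abbreviation "s2 \<equiv> reflect root2"
abbreviation "s3 \<equiv> reflect root3"

lemma s1_vector: "s1 (vector [x, y, z]) = vector [- x, y, z]"
  and s2_vector: "s2 (vector [x, y, z]) = vector [x, - y, z]"
  and s3_vector: "s3 (vector [x, y, z]) =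
    (let u = (- x - golden * y + (golden - 1) * z) / 2
     in vector [x + u, y + golden * u, z - (golden - 1) * u])"
  by (simp_all add: reflect_def root_defs inner_vector3 vec_eq_iff forall_3 Let_def field_simps)

text \<open>Unscaled, listed one by one for case analysis, and with \<open>golden - 1\<close> in
  place of \<open>1 / golden\<close> so that the arithmetic stays polynomial.\<close>

definition vertices20 :: "(real^3) set" where
  "vertices20 =
    {vector [1, 1, 1], vector [1, 1, - 1], vector [1, - 1, 1],
     vector [1, - 1, - 1], vector [- 1, 1, 1], vector [- 1, 1, - 1],
     vector [- 1, - 1, 1], vector [- 1, - 1, - 1], vector [0, golden - 1, golden],
     vector [0, golden - 1, - golden], vector [0, 1 - golden, golden], vector [0, 1 - golden, - golden],
     vector [golden, 0, golden - 1], vector [- golden, 0, golden - 1], vector [golden, 0, 1 - golden],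
     vector [- golden, 0, 1 - golden], vector [golden - 1, golden, 0], vector [golden - 1, - golden, 0],
     vector [1 - golden, golden, 0], vector [1 - golden, - golden, 0]}"

text \<open>Up to scale, the centres of the faces, i.e. the vertices of the dual
  icosahedron.\<close>

definition centres12 :: "(real^3) set" where
  "centres12 =
    {vector [1, 0, golden], vector [1, 0, - golden], vector [- 1, 0, golden],
     vector [- 1, 0, - golden], vector [golden, 1, 0], vector [- golden, 1, 0],
     vector [golden, - 1, 0], vector [- golden, - 1, 0], vector [0, golden, 1],
     vector [0, - golden, 1], vector [0, golden, - 1], vector [0, - golden, - 1]}"

text \<open>The reflections \<open>s1\<close> and \<open>s2\<close> merely change a sign;
  \<open>s3\<close> is the one whose action needs a table.\<close>

lemma s3_vertices20:
  "s3 (vector [1, 1, 1]) = vector [0, 1 - golden, golden]"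
  "s3 (vector [1, 1, - 1]) = vector [1 - golden, - golden, 0]"
  "s3 (vector [1, - 1, 1]) = vector [golden, 0, golden - 1]"
  "s3 (vector [1, - 1, - 1]) = vector [1, - 1, - 1]"
  "s3 (vector [- 1, 1, 1]) = vector [- 1, 1, 1]"
  "s3 (vector [- 1, 1, - 1]) = vector [- golden, 0, 1 - golden]"
  "s3 (vector [- 1, - 1, 1]) = vector [golden - 1, golden, 0]"
  "s3 (vector [- 1, - 1, - 1]) = vector [0, golden - 1, - golden]"
  "s3 (vector [0, golden - 1, golden]) = vector [0, golden - 1, golden]"
  "s3 (vector [0, golden - 1, - golden]) = vector [- 1, - 1, - 1]"
  "s3 (vector [0, 1 - golden, golden]) = vector [1, 1, 1]"
  "s3 (vector [0, 1 - golden, - golden]) = vector [0, 1 - golden, - golden]"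
  "s3 (vector [golden, 0, golden - 1]) = vector [1, - 1, 1]"
  "s3 (vector [- golden, 0, golden - 1]) = vector [1 - golden, golden, 0]"
  "s3 (vector [golden, 0, 1 - golden]) = vector [golden - 1, - golden, 0]"
  "s3 (vector [- golden, 0, 1 - golden]) = vector [- 1, 1, - 1]"
  "s3 (vector [golden - 1, golden, 0]) = vector [- 1, - 1, 1]"
  "s3 (vector [golden - 1, - golden, 0]) = vector [golden, 0, 1 - golden]"
  "s3 (vector [1 - golden, golden, 0]) = vector [- golden, 0, golden - 1]"
  "s3 (vector [1 - golden, - golden, 0]) = vector [1, 1, - 1]"
  by (simp_all add: s3_vector Let_def vector3_eq_iff algebra_simps golden_mult diff_divide_distrib add_divide_distrib)

lemma s3_centres12:
  "s3 (vector [1, 0, golden]) = vector [1, 0, golden]"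
  "s3 (vector [1, 0, - golden]) = vector [0, - golden, - 1]"
  "s3 (vector [- 1, 0, golden]) = vector [0, golden, 1]"
  "s3 (vector [- 1, 0, - golden]) = vector [- 1, 0, - golden]"
  "s3 (vector [golden, 1, 0]) = vector [0, - golden, 1]"
  "s3 (vector [- golden, 1, 0]) = vector [- golden, 1, 0]"
  "s3 (vector [golden, - 1, 0]) = vector [golden, - 1, 0]"
  "s3 (vector [- golden, - 1, 0]) = vector [0, golden, - 1]"
  "s3 (vector [0, golden, 1]) = vector [- 1, 0, golden]"
  "s3 (vector [0, - golden, 1]) = vector [golden, 1, 0]"
  "s3 (vector [0, golden, - 1]) = vector [- golden, - 1, 0]"
  "s3 (vector [0, - golden, - 1]) = vector [1, 0, - golden]"
  by (simp_all add: s3_vector Let_def vector3_eq_iff algebra_simps golden_mult diff_divide_distrib add_divide_distrib)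

lemma reflect_image_vertices20: "\<alpha> \<in> {root1, root2, root3} \<Longrightarrow> reflect \<alpha> ` vertices20 \<subseteq> vertices20"
  and reflect_image_centres12: "\<alpha> \<in> {root1, root2, root3} \<Longrightarrow> reflect \<alpha> ` centres12 \<subseteq> centres12"
  unfolding vertices20_def centres12_def
  by (elim insertE emptyE; hypsubst; simp only: image_insert image_empty insert_subset empty_subsetI insert_iff simp_thms
      s1_vector s2_vector s3_vertices20 s3_centres12 minus_minus minus_diff_eq minus_zero)+

text \<open>The Coxeter group of type H3: \<open>root3\<close> has inner product -1/2 with
  \<open>root1\<close> and -cos 36 with \<open>root2\<close>, and these two are orthogonal, so the
  mirrors meet at 60, 36 and 90 degrees. Left multiplication by generators yields inverses too, as
  each generator is its own inverse.\<close>

inductive_set W :: "(real^3 \<Rightarrow> real^3) set" where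
  W_id: "(\<lambda>x. x) \<in> W"
| W_step: "w \<in> W \<Longrightarrow> \<alpha> \<in> {root1, root2, root3} \<Longrightarrow> (\<lambda>x. reflect \<alpha> (w x)) \<in> W"

lemma norm_root: "\<alpha> \<in> {root1, root2, root3} \<Longrightarrow> norm \<alpha> = 1"
  by auto

lemma W_reflect: "\<alpha> \<in> {root1, root2, root3} \<Longrightarrow> reflect \<alpha> \<in> W"
  using W_step [OF W_id] by simp

lemma W_orth: "w \<in> W \<Longrightarrow> orthogonal_transformation w"
proof (induction rule: W.induct)
  case (W_step w \<alpha>)
  then show ?case
    using orthogonal_transformation_compose [OF orthogonal_transformation_reflect [OF norm_root]]
    by (simp add: o_def)
qed simp

lemma W_linear: "w \<in> W \<Longrightarrow> linear w"
  by (simp add: W_orth orthogonal_transformation_linear)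

lemma W_inner: "w \<in> W \<Longrightarrow> w x \<bullet> w y = x \<bullet> y"
  using W_orth by (simp add: orthogonal_transformation_def)

lemma W_norm: "w \<in> W \<Longrightarrow> norm (w x) = norm x"
  using W_orth by (simp add: orthogonal_transformation_norm)

lemma W_vertices20: "w \<in> W \<Longrightarrow> v \<in> vertices20 \<Longrightarrow> w v \<in> vertices20"
proof (induction rule: W.induct)
  case (W_step w \<alpha>)
  then show ?case using reflect_image_vertices20 [of \<alpha>] by blast
qed

lemma W_centres12: "w \<in> W \<Longrightarrow> v \<in> centres12 \<Longrightarrow> w v \<in> centres12"
proof (induction rule: W.induct)
  case (W_step w \<alpha>)
  then show ?case using reflect_image_centres12 [of \<alpha>] by blast
qed

lemma W_compose: "w \<in> W \<Longrightarrow> u \<in> W \<Longrightarrow> (\<lambda>x. w (u x)) \<in> W"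
proof (induction rule: W.induct)
  case (W_step w \<alpha>)
  then show ?case using W.W_step [of "\<lambda>x. w (u x)" \<alpha>] by blast
qed

text \<open>The last conclusion says that the inverse is also the adjoint; with it, group elements
  are moved across inner products.\<close>

lemma W_inverse:
  assumes "w \<in> W"
  obtains u where "u \<in> W" "\<And>x. u (w x) = x" "\<And>x. w (u x) = x" "\<And>x y. y \<bullet> w x = u y \<bullet> x"
proof -
  have "\<exists>u\<in>W. (\<forall>x. u (w x) = x) \<and> (\<forall>x. w (u x) = x)"
    using assms
  proof (induction rule: W.induct)
    case W_id
    then show ?case using W.W_id by auto
  next
    case (W_step w \<alpha>)
    then obtain u where u: "u \<in> W" "\<forall>x. u (w x) = x" "\<forall>x. w (u x) = x" by blast
    have "(\<lambda>x. u (reflect \<alpha> x)) \<in> W" by (rule W_compose [OF u(1) W_reflect [OF W_step.hyps(2)]])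
    then show ?case
      by (intro bexI [of _ "\<lambda>x. u (reflect \<alpha> x)"])
        (simp_all add: u reflect_reflect [OF norm_root [OF W_step.hyps(2)]])
  qed
  then obtain u where u: "u \<in> W" "\<And>x. u (w x) = x" "\<And>x. w (u x) = x" by blast
  moreover have "y \<bullet> w x = u y \<bullet> x" for x y
    using W_inner [OF assms, of "u y" x] u by simp
  ultimately show thesis by (rule that)
qed

text \<open>Up to positive factors: the centre of a face, the two ends of one of its edges, and the midpoint of that edge.\<close>

definition ctr :: "real^3" where "ctr = vector [1, 0, golden]"
definition vtx :: "real^3" where "vtx = vector [0, golden - 1, golden]"
definition vtx' :: "real^3" where "vtx' = vector [0, 1 - golden, golden]"
definition mid :: "real^3" where "mid = vector [0, 0, 1]"

lemmas gen_defs = ctr_def vtx_def vtx'_def mid_def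

section \<open>The fundamental chamber\<close>

definition hgt :: "real^3 \<Rightarrow> real" where
  "hgt x = x $ 3 - golden * x $ 1 - (golden + 1) * x $ 2"

definition chamber :: "(real^3) set" where
  "chamber = {x. 0 \<le> x $ 1 \<and> 0 \<le> x $ 2 \<and> 0 \<le> hgt x}"

text \<open>\<open>hgt\<close> is the functional of the third mirror, scaled to take the value 1 at
  \<open>mid\<close>.\<close>

lemma inner_root: "root1 \<bullet> x = x $ 1" "root2 \<bullet> x = x $ 2" "root3 \<bullet> x = (golden - 1) / 2 * hgt x"
  by (subst vector3_components [of x], simp add: root_defs inner_vector3 hgt_def field_simps golden_mult)+

lemma chamber_root: "x \<in> chamber \<longleftrightarrow> (\<forall>\<alpha>\<in>{root1, root2, root3}. 0 \<le> \<alpha> \<bullet> x)"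
  using golden_bounds by (simp add: chamber_def inner_root zero_le_mult_iff)

text \<open>The chamber is the simplicial cone over the three generators: each of the functionals
  \<open>x $ 1\<close>, \<open>x $ 2\<close> and \<open>hgt x\<close> vanishes at two of them, and
  the coefficient is read off at the third.\<close>

lemma chamber_decomposition:
  "x = x $ 1 *\<^sub>R ctr + (golden * x $ 2) *\<^sub>R vtx + hgt x *\<^sub>R mid"
  by (subst vector3_components [of x])
    (simp add: gen_defs vec_eq_iff forall_3 hgt_def field_simps golden_mult)

lemma gens_in_chamber: "ctr \<in> chamber" "vtx \<in> chamber" "mid \<in> chamber"
  using golden_bounds by (simp_all add: chamber_def gen_defs hgt_def field_simps golden_mult)

lemma mid_eq: "mid = (1 / (2 * golden)) *\<^sub>R (vtx + vtx')"
  by (simp add: gen_defs vec_eq_iff forall_3)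

text \<open>The coefficients of x in the three generators are nonnegative on the chamber. Equality
  at x makes every term of the sum vanish, hence equality holds at each generator with a positive
  coefficient.\<close>

lemma chamber_le:
  fixes f g :: "real^3 \<Rightarrow> real"
  assumes "linear f" "linear g" "f ctr \<le> g ctr" "f vtx \<le> g vtx" "f mid \<le> g mid" "x \<in> chamber"
  shows "f x \<le> g x"
    and "f x = g x \<Longrightarrow> 0 < x $ 1 \<Longrightarrow> f ctr = g ctr"
    and "f x = g x \<Longrightarrow> 0 < x $ 2 \<Longrightarrow> f vtx = g vtx"
    and "f x = g x \<Longrightarrow> 0 < hgt x \<Longrightarrow> f mid = g mid"
proof -
  define P Q R where "P = x $ 1 * (g ctr - f ctr)" and "Q = (golden * x $ 2) * (g vtx - f vtx)"
    and "R = hgt x * (g mid - f mid)"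
  have eq: "h x = x $ 1 * h ctr + (golden * x $ 2) * h vtx + hgt x * h mid"
    if "linear h" for h :: "real^3 \<Rightarrow> real"
    using arg_cong [OF chamber_decomposition [of x], of h]
    by (simp add: linear_add [OF that] linear_cmul [OF that])
  have sum: "g x - f x = P + Q + R"
    unfolding eq [OF assms(1)] eq [OF assms(2)] P_def Q_def R_def by (simp add: algebra_simps)
  have nonneg: "0 \<le> P" "0 \<le> Q" "0 \<le> R"
    unfolding P_def Q_def R_def using assms(3-6) by (auto simp: chamber_def less_imp_le [OF golden_pos(1)] intro!: mult_nonneg_nonneg)
  show "f x \<le> g x" using sum nonneg by linarith
  show "f ctr = g ctr" if "f x = g x" "0 < x $ 1"
  proof -
    have "P = 0" using sum nonneg that by linarith
    then show ?thesis using that by (simp add: P_def)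
  qed
  show "f vtx = g vtx" if "f x = g x" "0 < x $ 2"
  proof -
    have "Q = 0" using sum nonneg that by linarith
    then show ?thesis using that by (simp add: Q_def)
  qed
  show "f mid = g mid" if "f x = g x" "0 < hgt x"
  proof -
    have "R = 0" using sum nonneg that by linarith
    then show ?thesis using that by (simp add: R_def)
  qed
qed

lemma vtx_in_vertices20: "vtx \<in> vertices20" "vtx' \<in> vertices20"
  by (simp_all add: gen_defs vertices20_def)

lemma ctr_in_centres12: "ctr \<in> centres12"
  by (simp add: gen_defs centres12_def)

lemma ctr_inner_vertices20:
  assumes "v \<in> vertices20"
  shows "ctr \<bullet> v \<le> golden + 1"
  using assms golden_bounds unfolding vertices20_def
  by (elim insertE emptyE) (simp_all add: ctr_def inner_vector3 algebra_simps golden_mult)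

lemma mid_inner_vertices20:
  assumes "v \<in> vertices20"
  shows "mid \<bullet> v \<le> golden"
  using assms golden_bounds unfolding vertices20_def
  by (elim insertE emptyE) (simp_all add: mid_def inner_vector3)

lemma gens_inner: "ctr \<bullet> vtx = golden + 1" "ctr \<bullet> vtx' = golden + 1" "mid \<bullet> vtx = golden"
  "mid \<bullet> vtx' = golden" "ctr \<bullet> mid = golden" "ctr \<bullet> ctr = golden + 2" "vtx \<bullet> vtx = 3" "vtx' \<bullet> vtx' = 3"
  by (simp_all add: gen_defs inner_vector3 algebra_simps golden_mult)

text \<open>For a vector and its own image this is Cauchy-Schwarz, for vertices a finite check. The
  edge midpoint is reduced to vertices, being a multiple of \<open>vtx + vtx'\<close>; the bounds
  then fit because (golden + 1) / golden = golden.\<close>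

lemma W_inner_le_gens:
  assumes "w \<in> W"
  shows "x \<bullet> w x \<le> x \<bullet> x" "ctr \<bullet> w vtx \<le> ctr \<bullet> vtx" "mid \<bullet> w vtx \<le> mid \<bullet> vtx" "ctr \<bullet> w mid \<le> ctr \<bullet> mid"
proof -
  have "x \<bullet> w x \<le> norm x * norm (w x)" by (rule norm_cauchy_schwarz)
  then show "x \<bullet> w x \<le> x \<bullet> x" using W_norm [OF assms, of x] by (simp add: dot_square_norm power2_eq_square)
  show vtx: "ctr \<bullet> w vtx \<le> ctr \<bullet> vtx" "mid \<bullet> w vtx \<le> mid \<bullet> vtx"
    using ctr_inner_vertices20 mid_inner_vertices20 W_vertices20 [OF assms] vtx_in_vertices20
    by (simp_all add: gens_inner)
  have "ctr \<bullet> w vtx' \<le> golden + 1"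
    using ctr_inner_vertices20 W_vertices20 [OF assms] vtx_in_vertices20 by simp
  then have "ctr \<bullet> w vtx + ctr \<bullet> w vtx' \<le> 2 * golden * golden"
    using vtx(1) golden_mult(1) by (simp add: gens_inner)
  then have "(ctr \<bullet> w vtx + ctr \<bullet> w vtx') / (2 * golden) \<le> golden"
    using golden_pos(1) by (simp add: divide_le_eq mult.commute)
  then show "ctr \<bullet> w mid \<le> ctr \<bullet> mid"
    by (simp add: gens_inner) (simp add: mid_eq linear_cmul linear_add W_linear [OF assms] inner_add_right add_divide_distrib)
qed

lemma W_inner_le_swap:
  assumes "\<And>w. w \<in> W \<Longrightarrow> x \<bullet> w y \<le> x \<bullet> y" "w \<in> W"
  shows "y \<bullet> w x \<le> y \<bullet> x"
proof -
  obtain u where u: "u \<in> W" "\<And>x y. y \<bullet> w x = u y \<bullet> x" using W_inverse [OF assms(2)] by metis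
  show ?thesis using assms(1) [OF u(1)] u(2) [of y x] by (simp add: inner_commute)
qed

lemma linear_inner_W: "w \<in> W \<Longrightarrow> linear (\<lambda>x. y \<bullet> w x)"
  by (intro linear_compose [of w "\<lambda>x. y \<bullet> x", unfolded o_def] W_linear bounded_linear.linear bounded_linear_inner_right)

lemma W_inner_le_gen:
  assumes "w \<in> W" "x \<in> chamber" "u \<in> {ctr, vtx, mid}"
  shows "u \<bullet> w x \<le> u \<bullet> x"
proof (rule chamber_le(1) [OF linear_inner_W [OF assms(1)] linear_inner_W [OF W_id]])
  have swap: "vtx \<bullet> w ctr \<le> vtx \<bullet> ctr" "vtx \<bullet> w mid \<le> vtx \<bullet> mid" "mid \<bullet> w ctr \<le> mid \<bullet> ctr"
    by (rule W_inner_le_swap [OF _ assms(1)], erule W_inner_le_gens)+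
  then show "u \<bullet> w ctr \<le> u \<bullet> ctr" "u \<bullet> w vtx \<le> u \<bullet> vtx" "u \<bullet> w mid \<le> u \<bullet> mid"
    using assms(3) W_inner_le_gens [OF assms(1)] by auto
qed (rule assms)

text \<open>Linearity in both arguments reduces the inequality to pairs of generators. In the
  equality case \<open>ctr\<close> and \<open>mid\<close> have positive weight in y, and their inner
  products determine the first and third coordinates of \<open>w x\<close>; the norm then leaves
  only a sign in the second.\<close>

lemma
  assumes "w \<in> W" "x \<in> chamber" "y \<in> chamber"
  shows W_inner_le: "y \<bullet> w x \<le> y \<bullet> x"
    and W_inner_eq: "\<lbrakk>y \<bullet> w x = y \<bullet> x; 0 < y $ 1; 0 < hgt y\<rbrakk> \<Longrightarrow> w x = x \<or> y $ 2 = 0 \<and> w x = s2 x"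
proof -
  have lin: "linear (\<lambda>y. y \<bullet> w x)" "linear (\<lambda>y. y \<bullet> x)"
    by (simp_all add: bounded_linear.linear bounded_linear_inner_left)
  have gen: "ctr \<bullet> w x \<le> ctr \<bullet> x" "vtx \<bullet> w x \<le> vtx \<bullet> x" "mid \<bullet> w x \<le> mid \<bullet> x"
    by (rule W_inner_le_gen [OF assms(1,2)]; simp)+
  note le = chamber_le [where f = "\<lambda>y. y \<bullet> w x" and g = "\<lambda>y. y \<bullet> x", OF lin gen assms(3)]
  show "y \<bullet> w x \<le> y \<bullet> x" by (rule le(1))
  assume y: "y \<bullet> w x = y \<bullet> x" "0 < y $ 1" "0 < hgt y"
  have "ctr \<bullet> w x = ctr \<bullet> x" by (rule le(2) [OF y(1,2)])
  moreover have "mid \<bullet> w x = mid \<bullet> x" by (rule le(4) [OF y(1,3)])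
  moreover have inner: "ctr \<bullet> z = z $ 1 + golden * z $ 3" "mid \<bullet> z = z $ 3"
    "vtx \<bullet> z = (golden - 1) * z $ 2 + golden * z $ 3" "z \<bullet> z = (z $ 1)\<^sup>2 + (z $ 2)\<^sup>2 + (z $ 3)\<^sup>2" for z :: "real^3"
    by (simp_all add: gen_defs inner_vec_def sum_3 power2_eq_square)
  ultimately have 13: "w x $ 1 = x $ 1" "w x $ 3 = x $ 3" by simp_all
  have "(w x $ 2)\<^sup>2 = (x $ 2)\<^sup>2"
    using W_inner [OF assms(1), of x x] inner(4) [of "w x"] inner(4) [of x] 13 by simp
  then have "w x $ 2 = x $ 2 \<or> w x $ 2 = - x $ 2" by (simp add: power2_eq_iff)
  moreover have "w x $ 2 = x $ 2" if "0 < y $ 2"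
  proof -
    have "vtx \<bullet> w x = vtx \<bullet> x" by (rule le(3) [OF y(1) that])
    then show ?thesis using golden_bounds by (simp add: inner 13)
  qed
  moreover have "0 \<le> y $ 2" using assms(3) by (simp add: chamber_def)
  moreover have "s2 x = vector [x $ 1, - x $ 2, x $ 3]"
    by (subst vector3_components [of x]) (simp only: s2_vector)
  ultimately show "w x = x \<or> y $ 2 = 0 \<and> w x = s2 x"
    using 13 by (force simp: vec_eq_iff forall_3)
qed

text \<open>For y = w x the dominance inequality bounds the squared norm of w x by the inner product
  of w x and x; for vectors of equal norm this forces equality.\<close>

lemma W_chamber_unique:
  assumes "w \<in> W" "x \<in> chamber" "w x \<in> chamber"
  shows "w x = x"
proof -
  have "w x \<bullet> w x \<le> w x \<bullet> x" by (rule W_inner_le) (use assms in auto)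
  moreover have "w x \<bullet> w x = x \<bullet> x" by (rule W_inner [OF assms(1)])
  ultimately have "(w x - x) \<bullet> (w x - x) \<le> 0"
    by (simp add: inner_diff_left inner_diff_right inner_commute)
  then show ?thesis by (metis eq_iff_diff_eq_0 inner_ge_zero inner_eq_zero_iff order_antisym)
qed

lemma finite_vertices20: "finite vertices20" and finite_centres12: "finite centres12"
  by (simp_all add: vertices20_def centres12_def)

text \<open>The orbit of an interior point \<open>\<rho>\<close> of the chamber is finite, because W
  permutes vertices and centres. Take \<open>w \<rho>\<close> in it with the largest inner product
  with x: no reflection improves it, which says that the preimage of x under w is on the positive
  side of each mirror.\<close>

lemma W_cover:
  obtains w where "w \<in> W" "w x \<in> chamber"
proof -
  define \<rho> where "\<rho> = ctr + vtx + mid"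
  define orbit where "orbit = (\<lambda>w. w \<rho>) ` W"
  have "orbit \<subseteq> (\<lambda>(c, v, v'). c + v + (1 / (2 * golden)) *\<^sub>R (v + v')) ` (centres12 \<times> vertices20 \<times> vertices20)"
  proof
    fix y assume "y \<in> orbit"
    then obtain w where w: "w \<in> W" "y = w \<rho>" by (auto simp: orbit_def)
    then have "y = w ctr + w vtx + (1 / (2 * golden)) *\<^sub>R (w vtx + w vtx')"
      by (simp add: \<rho>_def mid_eq linear_cmul linear_add W_linear)
    then show "y \<in> (\<lambda>(c, v, v'). c + v + (1 / (2 * golden)) *\<^sub>R (v + v')) ` (centres12 \<times> vertices20 \<times> vertices20)"
      using w vtx_in_vertices20 ctr_in_centres12 W_vertices20 W_centres12
      by (intro image_eqI [of _ _ "(w ctr, w vtx, w vtx')"]) auto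
  qed
  then have "finite orbit" by (rule finite_subset) (intro finite_imageI finite_cartesian_product finite_vertices20 finite_centres12)
  moreover have "orbit \<noteq> {}" using W_id by (auto simp: orbit_def)
  ultimately obtain r where "r \<in> orbit" and max: "\<And>r'. r' \<in> orbit \<Longrightarrow> r' \<bullet> x \<le> r \<bullet> x"
    using Max_in [of "(\<lambda>r. r \<bullet> x) ` orbit"] Max_ge [of "(\<lambda>r. r \<bullet> x) ` orbit"] by fastforce
  then obtain w where w: "w \<in> W" "r = w \<rho>" by (auto simp: orbit_def)
  obtain u where u: "u \<in> W" "\<And>x. w (u x) = x" "\<And>x y. y \<bullet> w x = u y \<bullet> x" using W_inverse [OF w(1)] by metis
  have "0 \<le> \<alpha> \<bullet> u x" if \<alpha>: "\<alpha> \<in> {root1, root2, root3}" for \<alpha>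
  proof -
    have "w (reflect \<alpha> \<rho>) \<bullet> x \<le> w \<rho> \<bullet> x"
      using max [of "w (reflect \<alpha> \<rho>)"] W_compose [OF w(1) W_reflect [OF \<alpha>]] w(2)
      by (auto simp: orbit_def)
    then have "reflect \<alpha> \<rho> \<bullet> u x \<le> \<rho> \<bullet> u x"
      using u(3) [of x] by (metis inner_commute)
    then have "0 \<le> (\<alpha> \<bullet> \<rho>) * (\<alpha> \<bullet> u x)" by (simp add: reflect_def inner_diff_left)
    moreover have "0 < \<alpha> \<bullet> \<rho>"
      using \<alpha> golden_bounds by (auto simp: inner_root \<rho>_def gen_defs hgt_def algebra_simps golden_mult)
    ultimately show ?thesis by (simp add: zero_le_mult_iff)
  qed
  then show thesis using that [OF u(1)] by (simp add: chamber_root)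
qed

section \<open>Facets and edges of the dodecahedron\<close>

lemma W_image_eq:
  assumes "w \<in> W" "\<And>w v. w \<in> W \<Longrightarrow> v \<in> S \<Longrightarrow> w v \<in> S"
  shows "w ` S = S"
proof -
  obtain u where u: "u \<in> W" "\<And>x. w (u x) = x" using W_inverse [OF assms(1)] by metis
  have "v = w (u v)" "u v \<in> S" if "v \<in> S" for v using u assms(2) that by auto
  then show ?thesis using assms by blast
qed

definition unit_vertices :: "(real^3) set" where
  "unit_vertices = (\<lambda>v. v /\<^sub>R sqrt 3) ` vertices20"

lemma dodecahedron_eq: "dodecahedron = convex hull unit_vertices"
proof -
  have "- 1 / golden = 1 - golden" using inverse_golden by (simp add: field_simps)
  note * = this inverse_golden
  have "{vector [x, y, z] |x y z. x \<in> {-1, 1} \<and> y \<in> {-1, 1} \<and> z \<in> {-1, 1}} \<union>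
      {vector [0, p, q] |p q. p \<in> {-1 / golden, 1 / golden} \<and> q \<in> {-golden, golden}} \<union>
      {vector [q, 0, p] |p q. p \<in> {-1 / golden, 1 / golden} \<and> q \<in> {-golden, golden}} \<union>
      {vector [p, q, 0] |p q. p \<in> {-1 / golden, 1 / golden} \<and> q \<in> {-golden, golden}} = vertices20"
    (is "?A \<union> ?B \<union> ?C \<union> ?D = _")
  proof -
    have "?A = {vector [1, 1, 1], vector [1, 1, - 1], vector [1, - 1, 1], vector [1, - 1, - 1],
      vector [- 1, 1, 1], vector [- 1, 1, - 1], vector [- 1, - 1, 1], vector [- 1, - 1, - 1]}"
      by blast
    moreover have "?B = {vector [0, golden - 1, golden], vector [0, golden - 1, - golden],
      vector [0, 1 - golden, golden], vector [0, 1 - golden, - golden]}"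
      unfolding * by blast
    moreover have "?C = {vector [golden, 0, golden - 1], vector [- golden, 0, golden - 1],
      vector [golden, 0, 1 - golden], vector [- golden, 0, 1 - golden]}"
      unfolding * by blast
    moreover have "?D = {vector [golden - 1, golden, 0], vector [golden - 1, - golden, 0],
      vector [1 - golden, golden, 0], vector [1 - golden, - golden, 0]}"
      unfolding * by blast
    ultimately show ?thesis unfolding vertices20_def by (simp only: Un_insert_left Un_empty_left)
  qed
  then show ?thesis by (simp only: dodecahedron_def unit_vertices_def)
qed

lemma finite_unit_vertices: "finite unit_vertices"
  by (simp add: unit_vertices_def finite_vertices20)

lemma norm_vertices20: "v \<in> vertices20 \<Longrightarrow> norm v = sqrt 3"
proof -
  have "v \<in> vertices20 \<Longrightarrow> v \<bullet> v = 3"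
    unfolding vertices20_def
    by (elim insertE emptyE) (simp_all add: inner_vector3 algebra_simps golden_mult)
  then show "v \<in> vertices20 \<Longrightarrow> norm v = sqrt 3" by (simp add: norm_eq_sqrt_inner)
qed

lemma W_unit_vertices: "w \<in> W \<Longrightarrow> w ` unit_vertices = unit_vertices"
  by (rule W_image_eq) (auto simp: unit_vertices_def linear_cmul W_linear W_vertices20)

lemma W_dodecahedron: "w \<in> W \<Longrightarrow> w ` dodecahedron = dodecahedron"
  by (simp add: dodecahedron_eq orth_hull W_orth W_unit_vertices)

text \<open>In cyclic order; \<open>rot\<close> below carries each vertex to the next.\<close>

definition pentagon :: "(real^3) set" where
  "pentagon = {vtx', vtx, vector [1, 1, 1], vector [golden, 0, golden - 1], vector [1, - 1, 1]}"

definition top_facet :: "(real^3) set" where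
  "top_facet = convex hull ((\<lambda>v. v /\<^sub>R sqrt 3) ` pentagon)"

lemma pentagon_eq: "pentagon = vertices20 \<inter> {v. ctr \<bullet> v = golden + 1}"
proof (intro subset_antisym subsetI)
  show "v \<in> vertices20 \<inter> {v. ctr \<bullet> v = golden + 1}" if "v \<in> pentagon" for v
    using that unfolding pentagon_def vertices20_def gen_defs
    by (elim insertE emptyE) (simp_all add: inner_vector3 algebra_simps golden_mult)
  show "v \<in> pentagon" if "v \<in> vertices20 \<inter> {v. ctr \<bullet> v = golden + 1}" for v
    using that golden_bounds unfolding pentagon_def vertices20_def gen_defs
    by (elim IntE insertE emptyE) (simp_all add: inner_vector3 algebra_simps golden_mult)
qed

lemma top_facet_eq: "top_facet = dodecahedron \<inter> {v. ctr \<bullet> v = (golden + 1) / sqrt 3}"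
  and top_facet_face: "top_facet face_of dodecahedron"
proof -
  have le: "ctr \<bullet> v \<le> (golden + 1) / sqrt 3" if "v \<in> unit_vertices" for v
    using that ctr_inner_vertices20 by (auto simp: unit_vertices_def field_simps)
  have "unit_vertices \<inter> {v. ctr \<bullet> v = (golden + 1) / sqrt 3} = (\<lambda>v. v /\<^sub>R sqrt 3) ` pentagon"
    unfolding pentagon_eq unit_vertices_def by (auto simp: field_simps)
  then show "top_facet = dodecahedron \<inter> {v. ctr \<bullet> v = (golden + 1) / sqrt 3}"
    unfolding top_facet_def dodecahedron_eq
    by (simp only: convex_hull_Int_supporting_hyperplane(2) [OF finite_unit_vertices le])
  then show "top_facet face_of dodecahedron"
    using convex_hull_Int_supporting_hyperplane(1) [OF finite_unit_vertices le]
    by (simp add: dodecahedron_eq)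
qed

text \<open>Pairing a linear dependence with the cross product of two of the vectors isolates the
  coefficient of the third.\<close>

lemma affine_independent_triple:
  fixes p q r :: "real^3"
  assumes det: "p \<bullet> cross3 q r \<noteq> 0"
  shows "p \<noteq> q" "p \<noteq> r" "q \<noteq> r" "\<not> affine_dependent {p, q, r}" "aff_dim {p, q, r} = 2"
proof -
  show ne: "p \<noteq> q" "p \<noteq> r" "q \<noteq> r" using det by (auto simp: dot_cross_self cross_refl)
  show indep: "\<not> affine_dependent {p, q, r}"
  proof
    assume "affine_dependent {p, q, r}"
    then obtain U where U: "\<exists>v\<in>{p, q, r}. U v \<noteq> 0" "U p *\<^sub>R p + (U q *\<^sub>R q + U r *\<^sub>R r) = 0"
      using ne by (auto simp: affine_dependent_explicit_finite)
    have "U p * (p \<bullet> cross3 q r) = 0"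
      using arg_cong [OF U(2), of "\<lambda>x. x \<bullet> cross3 q r"] by (simp add: inner_add_left dot_cross_self)
    moreover have "U q * (q \<bullet> cross3 r p) = 0"
      using arg_cong [OF U(2), of "\<lambda>x. x \<bullet> cross3 r p"] by (simp add: inner_add_left dot_cross_self)
    moreover have "U r * (r \<bullet> cross3 p q) = 0"
      using arg_cong [OF U(2), of "\<lambda>x. x \<bullet> cross3 p q"] by (simp add: inner_add_left dot_cross_self)
    moreover have "q \<bullet> cross3 r p = p \<bullet> cross3 q r" "r \<bullet> cross3 p q = p \<bullet> cross3 q r"
      by (simp_all add: cross3_simps)
    ultimately show False using U(1) det by auto
  qed
  show "aff_dim {p, q, r} = 2"
    using aff_dim_affine_independent [OF indep] ne by simp
qed

lemma cross3_vector: "cross3 (vector [x, y, z]) (vector [x', y', z']) =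
   vector [y * z' - z * y', z * x' - x * z', x * y' - y * x']"
  by (simp add: cross3_def)

text \<open>The dimension is squeezed: three independent vertices give at least 2, and properness of
  the face, witnessed by the vertex opposite to \<open>vtx\<close>, gives less than 3.\<close>

lemma top_facet_facet: "top_facet facet_of dodecahedron"
proof -
  let ?p = "vtx /\<^sub>R sqrt 3" and ?q = "vtx' /\<^sub>R sqrt 3" and ?r = "vector [1, 1, 1] /\<^sub>R sqrt 3 :: real^3"
  have "vtx \<bullet> cross3 vtx' (vector [1, 1, 1]) \<noteq> 0"
    using golden_bounds by (simp add: gen_defs cross3_vector inner_vector3 algebra_simps golden_mult)
  then have det: "?p \<bullet> cross3 ?q ?r \<noteq> 0" by (simp add: cross_mult_left cross_mult_right)
  have "{?p, ?q, ?r} \<subseteq> top_facet"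
    unfolding top_facet_def pentagon_def by (rule subset_trans [OF _ hull_subset]) auto
  then have "aff_dim {?p, ?q, ?r} \<le> aff_dim top_facet" by (rule aff_dim_subset)
  moreover have "aff_dim {?p, ?q, ?r} = 2"
    by (rule affine_independent_triple(5) [OF det])
  moreover have "aff_dim top_facet < aff_dim dodecahedron"
  proof (rule face_of_aff_dim_lt [OF _ top_facet_face])
    show "convex dodecahedron" by (simp add: dodecahedron_eq)
    have "- vtx \<in> vertices20"
    proof -
      have "- vtx = vector [0, 1 - golden, - golden]" by (simp add: vtx_def vec_eq_iff forall_3)
      then show ?thesis by (simp add: vertices20_def)
    qed
    then have "(- vtx) /\<^sub>R sqrt 3 \<in> dodecahedron"
      unfolding dodecahedron_eq unit_vertices_def by (intro hull_inc imageI)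
    moreover have "(- vtx) /\<^sub>R sqrt 3 \<notin> top_facet"
    proof -
      have "ctr \<bullet> ((- vtx) /\<^sub>R sqrt 3) = - ((golden + 1) / sqrt 3)"
        by (simp add: gens_inner divide_inverse_commute)
      moreover have "0 < (golden + 1) / sqrt 3" using golden_bounds by simp
      ultimately have "ctr \<bullet> ((- vtx) /\<^sub>R sqrt 3) \<noteq> (golden + 1) / sqrt 3" by linarith
      then show ?thesis by (simp only: top_facet_eq Int_iff mem_Collect_eq) blast
    qed
    ultimately show "top_facet \<noteq> dodecahedron" by auto
  qed
  moreover have "aff_dim dodecahedron \<le> 3" using aff_dim_le_DIM [of dodecahedron] by simp
  ultimately show ?thesis using top_facet_face by (auto simp: facet_of_def)
qed

lemma pentagon_sum: "(\<Sum>v\<in>pentagon. v) = (golden + 2) *\<^sub>R ctr"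
proof -
  have "golden \<noteq> 1" "golden - 1 \<noteq> 1 - golden" "1 - golden \<noteq> golden - 1" "1 \<noteq> golden"
    using golden_bounds by auto
  then show ?thesis
    by (simp add: pentagon_def gen_defs vector3_eq_iff) (simp add: vec_eq_iff forall_3 algebra_simps golden_mult)
qed

lemma pentagon_subset: "pentagon \<subseteq> vertices20"
  by (simp add: pentagon_eq)

lemma finite_pentagon: "finite pentagon"
  by (simp add: pentagon_def)

lemma extreme_points_top_facet: "{v. v extreme_point_of top_facet} = (\<lambda>v. v /\<^sub>R sqrt 3) ` pentagon"
  unfolding top_facet_def
proof (rule extreme_points_of_unit_hull)
  show "finite ((\<lambda>v. v /\<^sub>R sqrt 3) ` pentagon)" by (simp add: finite_pentagon)
  show "(\<lambda>v. v /\<^sub>R sqrt 3) ` pentagon \<subseteq> sphere 0 1"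
    using pentagon_subset by (auto simp: norm_vertices20)
qed

lemma sph_centre_top_facet: "sph_centre top_facet = sgn ctr"
proof -
  have "(\<Sum>v | v extreme_point_of top_facet. v) = (\<Sum>v\<in>pentagon. v /\<^sub>R sqrt 3)"
    unfolding extreme_points_top_facet by (subst sum.reindex) (auto intro: inj_onI)
  also have "\<dots> = ((golden + 2) / sqrt 3) *\<^sub>R ctr"
    by (simp add: pentagon_sum divide_inverse_commute flip: scaleR_sum_right)
  finally have "sph_centre top_facet = sgn ((golden + 2) / sqrt 3) *\<^sub>R sgn ctr"
    by (simp only: sph_centre_def sgn_scaleR)
  moreover have "0 < (golden + 2) / sqrt 3" using golden_bounds by simp
  ultimately show ?thesis by (simp only: sgn_pos scaleR_one)
qed

lemma cone3_meets_hull: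
  fixes p q r :: "'a::real_vector"
  assumes "0 \<le> a" "0 \<le> b" "0 \<le> c" "0 < a + b + c" "x = a *\<^sub>R p + b *\<^sub>R q + c *\<^sub>R r"
  shows "\<exists>t>0. t *\<^sub>R x \<in> convex hull {p, q, r}"
proof (intro exI conjI)
  define s where "s = a + b + c"
  then have s: "0 < s" using assms by simp
  show "0 < 1 / s" using s by simp
  have "(1 / s) *\<^sub>R x = (a / s) *\<^sub>R p + (b / s) *\<^sub>R q + (c / s) *\<^sub>R r"
    by (simp add: assms(5) scaleR_add_right)
  moreover have "a / s + b / s + c / s = 1" using s by (simp add: s_def flip: add_divide_distrib)
  ultimately show "(1 / s) *\<^sub>R x \<in> convex hull {p, q, r}"
    unfolding convex_hull_3 using assms s
    by (intro CollectI exI [of _ "a / s"] exI [of _ "b / s"] exI [of _ "c / s"]) simp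
qed

lemma chamber_ray_meets_top_facet:
  assumes "x \<in> chamber" "x \<noteq> 0"
  shows "\<exists>t>0. t *\<^sub>R x \<in> top_facet"
proof -
  \<comment> \<open>The value of \<open>ctr \<bullet> v\<close> on the plane of the face. The points
    p, q, r are the multiples of the three generators on this plane: the centroid of the face, a
    vertex, and the midpoint of an edge.\<close>
  define d where "d = (golden + 1) / sqrt 3"
  have d: "d > 0" using golden_bounds by (simp add: d_def)
  define p q r where "p = (d / (golden + 2)) *\<^sub>R ctr" and "q = vtx /\<^sub>R sqrt 3" and "r = (d / golden) *\<^sub>R mid"
  have mem: "q \<in> top_facet" "vtx' /\<^sub>R sqrt 3 \<in> top_facet"
    unfolding top_facet_def q_def by (auto intro!: hull_inc simp: pentagon_def)
  have "convex top_facet" by (simp add: top_facet_def)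
  have "r = (1 / 2) *\<^sub>R q + (1 / 2) *\<^sub>R (vtx' /\<^sub>R sqrt 3)"
  proof -
    have "d / golden = golden / sqrt 3" by (simp add: d_def field_simps golden_mult)
    moreover have "golden / sqrt 3 * (1 / (2 * golden)) = 1 / 2 * inverse (sqrt 3)" by (simp add: field_simps)
    ultimately have "r = (1 / 2 * inverse (sqrt 3)) *\<^sub>R (vtx + vtx')"
      by (simp only: r_def mid_eq scaleR_scaleR)
    then show ?thesis by (simp only: q_def scaleR_add_right scaleR_scaleR)
  qed
  then have r: "r \<in> top_facet" using convexD [OF \<open>convex top_facet\<close> mem, of "1/2" "1/2"] by simp
  have "p = (\<Sum>v\<in>pentagon. (1 / 5) *\<^sub>R (v /\<^sub>R sqrt 3))"
  proof -
    \<comment> \<open>Equivalent to (golden + 2)^2 = 5 (golden + 1); it identifies the multiple of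
      \<open>ctr\<close> on the plane with the mean of the five vertices.\<close>
    have *: "golden + 1 = (golden + 2) * (golden + 2) / 5" by (simp add: algebra_simps golden_mult)
    have "golden + 2 \<noteq> 0" using golden_pos(1) by linarith
    then have "d / (golden + 2) = (golden + 2) / (5 * sqrt 3)"
      unfolding d_def * by simp
    moreover have "(\<Sum>v\<in>pentagon. (1 / 5) *\<^sub>R (v /\<^sub>R sqrt 3)) = (1 / (5 * sqrt 3)) *\<^sub>R (\<Sum>v\<in>pentagon. v)"
    proof -
      have "1 / 5 * inverse (sqrt 3) = 1 / (5 * sqrt 3)" by (simp add: field_simps)
      then show ?thesis by (simp only: scaleR_sum_right scaleR_scaleR)
    qed
    ultimately show ?thesis by (simp add: p_def pentagon_sum)
  qed
  moreover have "card pentagon = 5"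
  proof -
    have "golden \<noteq> 1" "golden - 1 \<noteq> 1 - golden" "1 - golden \<noteq> golden - 1" "1 \<noteq> golden"
      using golden_bounds by auto
    then show ?thesis by (simp add: pentagon_def gen_defs vector3_eq_iff)
  qed
  ultimately have p: "p \<in> top_facet"
    using convex_sum [OF finite_pentagon \<open>convex top_facet\<close>, of "\<lambda>v. 1 / 5" "\<lambda>v. v /\<^sub>R sqrt 3"]
    by (simp add: top_facet_def hull_inc)
  have nonneg: "0 \<le> x $ 1" "0 \<le> x $ 2" "0 \<le> hgt x" using assms(1) by (simp_all add: chamber_def)
  have eq: "x = (x $ 1 * (golden + 2) / d) *\<^sub>R p + (golden * x $ 2 * sqrt 3) *\<^sub>R q + (hgt x * golden / d) *\<^sub>R r"
  proof -
    have "golden + 2 \<noteq> 0" using golden_bounds by linarith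
    then have "x $ 1 * (golden + 2) / d * (d / (golden + 2)) = x $ 1" using d by simp
    moreover have "golden * x $ 2 * sqrt 3 * inverse (sqrt 3) = golden * x $ 2" by (simp add: field_simps)
    moreover have "hgt x * golden / d * (d / golden) = hgt x" using d by simp
    ultimately show ?thesis
      using chamber_decomposition [of x] by (simp only: p_def q_def r_def scaleR_scaleR)
  qed
  have "\<exists>t>0. t *\<^sub>R x \<in> convex hull {p, q, r}"
  proof (rule cone3_meets_hull [OF _ _ _ _ eq])
    show "0 \<le> x $ 1 * (golden + 2) / d" "0 \<le> golden * x $ 2 * sqrt 3" "0 \<le> hgt x * golden / d"
      using nonneg d golden_bounds by simp_all
    moreover have "\<not> (x $ 1 = 0 \<and> x $ 2 = 0 \<and> hgt x = 0)"
      using chamber_decomposition [of x] assms(2) by auto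
    then have "x $ 1 * (golden + 2) / d \<noteq> 0 \<or> golden * x $ 2 * sqrt 3 \<noteq> 0 \<or> hgt x * golden / d \<noteq> 0"
      using d golden_bounds by auto
    ultimately show "0 < x $ 1 * (golden + 2) / d + golden * x $ 2 * sqrt 3 + hgt x * golden / d" by linarith
  qed
  moreover have "convex hull {p, q, r} \<subseteq> top_facet"
    using p mem r \<open>convex top_facet\<close> by (intro hull_minimal) auto
  ultimately show ?thesis by blast
qed

text \<open>The images of the chamber under W cover the space, and every ray of the chamber meets
  \<open>top_facet\<close>. So the images of \<open>top_facet\<close> are a family of facets that
  meets every ray, hence they are all the facets.\<close>

lemma facet_of_dodecahedron: "F facet_of dodecahedron \<longleftrightarrow> F \<in> (\<lambda>w. w ` top_facet) ` W"
proof (rule facet_of_cover)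
  show "convex dodecahedron" by (simp add: dodecahedron_eq)
  show "F facet_of dodecahedron" if F: "F \<in> (\<lambda>w. w ` top_facet) ` W" for F
  proof -
    obtain w where w: "w \<in> W" "F = w ` top_facet" using F by blast
    then show ?thesis
      using top_facet_facet facet_of_orth_image [OF W_orth [OF w(1)], of top_facet dodecahedron]
      by (simp add: W_dodecahedron)
  qed
  show "\<exists>F\<in>(\<lambda>w. w ` top_facet) ` W. \<exists>t>0. t *\<^sub>R x \<in> F" if x: "x \<noteq> 0" for x
  proof -
    obtain w where w: "w \<in> W" "w x \<in> chamber" using W_cover by blast
    have "w x \<noteq> 0" using W_norm [OF w(1), of x] x by auto
    then obtain t where t: "t > 0" "t *\<^sub>R w x \<in> top_facet" using chamber_ray_meets_top_facet [OF w(2)] by blast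
    obtain u where u: "u \<in> W" "\<And>x. u (w x) = x" using W_inverse [OF w(1)] by metis
    have "t *\<^sub>R x = u (t *\<^sub>R w x)" by (simp add: linear_cmul W_linear u)
    then show ?thesis using t u(1) by blast
  qed
qed

section \<open>The rotations of a face and its five edges\<close>

definition rot :: "real^3 \<Rightarrow> real^3" where "rot x = s3 (s2 x)"

lemma s2_in_W: "s2 \<in> W"
  by (intro W_reflect) auto

lemma rot_in_W: "rot \<in> W"
  using W_step [OF s2_in_W, of root3] by (simp add: rot_def [abs_def])

lemma rot_power_in_W: "rot ^^ k \<in> W"
proof (induction k)
  case (Suc k)
  then show ?case using W_compose [OF rot_in_W Suc] by (simp add: o_def)
qed (simp add: W_id id_def)

lemma s2_gens: "s2 ctr = ctr" "s2 mid = mid" "s2 vtx = vtx'" "s2 vtx' = vtx"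
  by (simp_all add: gen_defs s2_vector)

text \<open>As the product of two reflections whose mirrors contain \<open>ctr\<close> and meet at
  36 degrees, \<open>rot\<close> turns the face by 72 degrees.\<close>

lemma rot_gens: "rot ctr = ctr" "rot vtx' = vtx" "rot vtx = vector [1, 1, 1]"
  "rot (vector [1, 1, 1]) = vector [golden, 0, golden - 1]"
  "rot (vector [golden, 0, golden - 1]) = vector [1, - 1, 1]"
  "rot (vector [1, - 1, 1]) = vtx'"
  by (simp_all add: rot_def gen_defs s2_vector s3_vertices20 s3_centres12)

lemma rot_power_ctr: "(rot ^^ k) ctr = ctr"
  by (induction k) (simp_all add: rot_gens)

lemma W_eqI:
  assumes "w \<in> W" "u \<in> W" "w ctr = u ctr" "w vtx = u vtx" "w mid = u mid"
  shows "w = u"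
proof
  fix x
  have eq: "v x = x $ 1 *\<^sub>R v ctr + (golden * x $ 2) *\<^sub>R v vtx + hgt x *\<^sub>R v mid" if "v \<in> W" for v
    using arg_cong [OF chamber_decomposition [of x], of v]
    by (simp only: linear_add linear_cmul W_linear [OF that])
  show "w x = u x" unfolding eq [OF assms(1)] eq [OF assms(2)] assms(3-5) ..
qed

lemma W_top_facet:
  assumes "w \<in> W" "w ctr = ctr"
  shows "w ` top_facet = top_facet"
proof -
  obtain u where u: "u \<in> W" "\<And>x. u (w x) = x" "\<And>x. w (u x) = x" using W_inverse [OF assms(1)] by metis
  then have "u ctr = ctr" using assms(2) by metis
  have sub: "v x \<in> top_facet" if "v \<in> W" "v ctr = ctr" "x \<in> top_facet" for v x
    using W_dodecahedron [OF that(1)] W_inner [OF that(1), of ctr x] that(2,3) by (auto simp: top_facet_eq)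
  have "x \<in> w ` top_facet" if "x \<in> top_facet" for x
    by (rule image_eqI [where x = "u x"]) (simp_all add: u(3) sub [OF u(1) \<open>u ctr = ctr\<close> that])
  then show ?thesis using sub [OF assms] by blast
qed

text \<open>Two diagonals of a regular pentagon cross in the golden section, which is what the
  assumed relation expresses. If the diagonal from u to v were a face, it would contain the end p of
  the crossing diagonal; but a chord of a sphere meets the sphere only in its own ends.\<close>

lemma pentagon_diagonal:
  assumes "{u, v, p, q} \<subseteq> pentagon" "u + golden *\<^sub>R v = q + golden *\<^sub>R p" "p \<notin> {q, u, v}"
  shows "\<not> closed_segment (u /\<^sub>R sqrt 3) (v /\<^sub>R sqrt 3) face_of top_facet"
proof
  let ?f = "\<lambda>x::real^3. x /\<^sub>R sqrt 3"
  assume face: "closed_segment (?f u) (?f v) face_of top_facet"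
  define s where "s = golden / (1 + golden)"
  have pos: "0 < 1 + golden" using golden_bounds by linarith
  then have s: "0 < s" "s < 1" "1 - s = 1 / (1 + golden)" by (simp_all add: s_def field_simps)
  have eq: "(1 - s) *\<^sub>R ?f x + s *\<^sub>R ?f y = (1 / (1 + golden)) *\<^sub>R ?f (x + golden *\<^sub>R y)" for x y
    unfolding s(3) by (simp add: s_def scaleR_add_right)
  define z where "z = (1 - s) *\<^sub>R ?f u + s *\<^sub>R ?f v"
  have "z = (1 - s) *\<^sub>R ?f q + s *\<^sub>R ?f p" unfolding z_def eq assms(2) ..
  then have "z \<in> open_segment (?f q) (?f p)" using s assms(3) by (auto simp: in_segment)
  moreover have "z \<in> closed_segment (?f u) (?f v)"
    unfolding in_segment z_def using s(1,2) by (intro exI [of _ s] conjI refl) simp_all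
  moreover have "?f q \<in> top_facet" "?f p \<in> top_facet"
    using assms(1) unfolding top_facet_def by (auto intro!: hull_inc)
  ultimately have "?f p \<in> closed_segment (?f u) (?f v)" using face_ofD [OF face] by blast
  then have hull: "?f p \<in> convex hull {?f u, ?f v}" by (simp only: segment_convex_hull)
  have fin: "finite {?f u, ?f v}" by simp
  have unit: "{?f u, ?f v} \<subseteq> sphere 0 1" "norm (?f p) = 1"
    using assms(1) pentagon_subset by (auto simp: norm_vertices20 subset_iff)
  have "?f p \<in> {?f u, ?f v}" by (rule unit_in_convex_hull_unit [OF fin unit(1) hull unit(2)])
  then show False using assms(3) by auto
qed

lemma pentagon_pair:
  fixes x y :: 'a
  assumes "x \<in> {x0, x1, x2, x3, x4}" "y \<in> {x0, x1, x2, x3, x4}" "x \<noteq> y"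
    "{x, y} \<noteq> {x0, x2}" "{x, y} \<noteq> {x1, x3}" "{x, y} \<noteq> {x2, x4}" "{x, y} \<noteq> {x3, x0}" "{x, y} \<noteq> {x4, x1}"
  shows "{x, y} \<in> {{x1, x0}, {x2, x1}, {x3, x2}, {x4, x3}, {x0, x4}}"
  using assms by (elim insertE emptyE) (simp_all add: insert_commute)

text \<open>Of the ten pairs of vertices, five are diagonals and excluded by
  \<open>pentagon_diagonal\<close>; the five sides are the images of one side under powers of
  \<open>rot\<close>.\<close>

lemma edge_of_top_facet:
  assumes "a \<in> pentagon" "b \<in> pentagon" "closed_segment (a /\<^sub>R sqrt 3) (b /\<^sub>R sqrt 3) edge_of top_facet"
  shows "\<exists>k<5. a = (rot ^^ k) vtx \<and> b = (rot ^^ k) vtx' \<or> a = (rot ^^ k) vtx' \<and> b = (rot ^^ k) vtx"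
proof -
  let ?u2 = "vector [1, 1, 1] :: real^3" and ?u3 = "vector [golden, 0, golden - 1] :: real^3"
    and ?u4 = "vector [1, - 1, 1] :: real^3"
  have neq: "golden \<noteq> 1" "golden - 1 \<noteq> 1 - golden" "1 - golden \<noteq> golden - 1" "1 \<noteq> golden"
    "golden \<noteq> 0" "0 \<noteq> golden" "1 - golden \<noteq> - 1" "- 1 \<noteq> 1 - golden" "golden - 1 \<noteq> 1" "1 \<noteq> golden - 1" "golden \<noteq> 2"
    using golden_bounds by auto
  have face: "closed_segment (a /\<^sub>R sqrt 3) (b /\<^sub>R sqrt 3) face_of top_facet"
    using assms(3) by (simp add: edge_of_def)
  have diag: "{a, b} \<noteq> {x, y}"
    if "{x, y, p, q} \<subseteq> pentagon" "x + golden *\<^sub>R y = q + golden *\<^sub>R p" "p \<notin> {q, x, y}" for x y p q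
  proof
    assume "{a, b} = {x, y}"
    then have "closed_segment (x /\<^sub>R sqrt 3) (y /\<^sub>R sqrt 3) face_of top_facet"
      using face closed_segment_commute by (metis doubleton_eq_iff)
    then show False using pentagon_diagonal [OF that] by contradiction
  qed
  have sub: "{vtx', ?u2, vtx, ?u3} \<subseteq> pentagon" "{vtx, ?u3, ?u2, ?u4} \<subseteq> pentagon" "{?u2, ?u4, ?u3, vtx'} \<subseteq> pentagon"
    "{?u3, vtx', ?u4, vtx} \<subseteq> pentagon" "{?u4, vtx, vtx', ?u2} \<subseteq> pentagon"
    by (auto simp: pentagon_def)
  have rel: "vtx' + golden *\<^sub>R ?u2 = ?u3 + golden *\<^sub>R vtx" "vtx + golden *\<^sub>R ?u3 = ?u4 + golden *\<^sub>R ?u2"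
    "?u2 + golden *\<^sub>R ?u4 = vtx' + golden *\<^sub>R ?u3" "?u3 + golden *\<^sub>R vtx' = vtx + golden *\<^sub>R ?u4"
    "?u4 + golden *\<^sub>R vtx = ?u2 + golden *\<^sub>R vtx'"
    by (simp_all add: gen_defs vec_eq_iff forall_3 algebra_simps golden_mult)
  have nin: "vtx \<notin> {?u3, vtx', ?u2}" "?u2 \<notin> {?u4, vtx, ?u3}" "?u3 \<notin> {vtx', ?u2, ?u4}" "?u4 \<notin> {vtx, ?u3, vtx'}"
    "vtx' \<notin> {?u2, ?u4, vtx}"
    by (simp_all add: gen_defs vector3_eq_iff neq)
  have "a \<noteq> b" using assms(3) by (auto simp: edge_of_def)
  from assms(1,2) have "a \<in> {vtx', vtx, ?u2, ?u3, ?u4}" "b \<in> {vtx', vtx, ?u2, ?u3, ?u4}"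
    by (simp_all only: pentagon_def)
  from pentagon_pair [OF this \<open>a \<noteq> b\<close> diag [OF sub(1) rel(1) nin(1)] diag [OF sub(2) rel(2) nin(2)]
      diag [OF sub(3) rel(3) nin(3)] diag [OF sub(4) rel(4) nin(4)] diag [OF sub(5) rel(5) nin(5)]]
  have "{a, b} \<in> {{vtx, vtx'}, {?u2, vtx}, {?u3, ?u2}, {?u4, ?u3}, {vtx', ?u4}}" .
  moreover have pow: "(rot ^^ 0) vtx = vtx" "(rot ^^ 0) vtx' = vtx'" "(rot ^^ 1) vtx = ?u2" "(rot ^^ 1) vtx' = vtx"
    "(rot ^^ 2) vtx = ?u3" "(rot ^^ 2) vtx' = ?u2" "(rot ^^ 3) vtx = ?u4" "(rot ^^ 3) vtx' = ?u3"
    "(rot ^^ 4) vtx = vtx'" "(rot ^^ 4) vtx' = ?u4"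
    by (simp_all add: rot_gens eval_nat_numeral)
  ultimately have "{a, b} \<in> {{(rot ^^ 0) vtx, (rot ^^ 0) vtx'}, {(rot ^^ 1) vtx, (rot ^^ 1) vtx'},
      {(rot ^^ 2) vtx, (rot ^^ 2) vtx'}, {(rot ^^ 3) vtx, (rot ^^ 3) vtx'}, {(rot ^^ 4) vtx, (rot ^^ 4) vtx'}}"
    by (simp only:)
  moreover have "0 < (5::nat)" "1 < (5::nat)" "2 < (5::nat)" "3 < (5::nat)" "4 < (5::nat)" by simp_all
  ultimately obtain k where "k < 5" "{a, b} = {(rot ^^ k) vtx, (rot ^^ k) vtx'}" by blast
  then show ?thesis by (auto simp: doubleton_eq_iff)
qed

text \<open>The inner product with \<open>mid\<close> is maximal on the face exactly along this
  side.\<close>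

lemma top_edge: "closed_segment (vtx /\<^sub>R sqrt 3) (vtx' /\<^sub>R sqrt 3) edge_of top_facet"
proof -
  have le: "mid \<bullet> x \<le> golden / sqrt 3" if "x \<in> (\<lambda>v. v /\<^sub>R sqrt 3) ` pentagon" for x
    using that mid_inner_vertices20 pentagon_subset by (auto simp: field_simps)
  have "pentagon \<inter> {v. mid \<bullet> v = golden} = {vtx, vtx'}"
    using golden_bounds by (auto simp: pentagon_def gen_defs inner_vector3)
  then have "(\<lambda>v. v /\<^sub>R sqrt 3) ` pentagon \<inter> {x. mid \<bullet> x = golden / sqrt 3} = (\<lambda>v. v /\<^sub>R sqrt 3) ` {vtx, vtx'}"
    by (auto simp: field_simps)
  then have "closed_segment (vtx /\<^sub>R sqrt 3) (vtx' /\<^sub>R sqrt 3) face_of top_facet"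
    using convex_hull_Int_supporting_hyperplane
      [where S = "(\<lambda>v. v /\<^sub>R sqrt 3) ` pentagon", OF finite_imageI [OF finite_pentagon] le]
    by (simp add: segment_convex_hull top_facet_def)
  moreover have "vtx /\<^sub>R sqrt 3 \<noteq> vtx' /\<^sub>R sqrt 3" using golden_bounds by (simp add: gen_defs vector3_eq_iff)
  then have "aff_dim (convex hull {vtx /\<^sub>R sqrt 3, vtx' /\<^sub>R sqrt 3}) = 1"
    by (simp only: aff_dim_convex_hull aff_dim_2 if_False)
  ultimately show ?thesis by (simp add: edge_of_def segment_convex_hull)
qed

definition c0 :: "real^3" where "c0 = sgn ctr"
definition a0 :: "real^3" where "a0 = vtx /\<^sub>R sqrt 3"
definition b0 :: "real^3" where "b0 = vtx' /\<^sub>R sqrt 3"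

lemma W_c0: "w \<in> W \<Longrightarrow> w c0 = sgn (w ctr)"
  by (simp add: c0_def orth_sgn W_orth)

text \<open>W is transitive on pairs of a face and a directed edge of it: the face is moved to
  \<open>top_facet\<close>, a rotation then moves the edge, and \<open>s2\<close> reverses its
  direction, which accounts for the two occurrences of each triangle.\<close>

lemma base_triangles_eq: "base_triangles = (\<lambda>w. (w c0, w a0, w b0)) ` W"
proof (intro subset_antisym subsetI)
  fix T assume "T \<in> base_triangles"
  then obtain F a b where T: "T = (sph_centre F, a, b)" "F facet_of dodecahedron" "closed_segment a b edge_of F"
    unfolding base_triangles_def by blast
  then obtain w where w: "w \<in> W" "F = w ` top_facet" unfolding facet_of_dodecahedron by blast
  obtain u where u: "u \<in> W" "\<And>x. w (u x) = x" using W_inverse [OF w(1)] by metis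
  have "w ` closed_segment (u a) (u b) edge_of w ` top_facet"
    using T(3) w(2) u(2) by (simp add: orth_closed_segment W_orth [OF w(1)])
  then have edge: "closed_segment (u a) (u b) edge_of top_facet"
    by (simp add: edge_of_orth_image W_orth [OF w(1)])
  then have face: "convex hull {u a, u b} face_of top_facet" by (simp add: edge_of_def segment_convex_hull)
  have "convex hull {u a} face_of convex hull {u a, u b}" "convex hull {u b} face_of convex hull {u a, u b}"
    unfolding face_of_convex_hull_affine_independent [OF affine_independent_2] by blast+
  then have "{u a} face_of top_facet" "{u b} face_of top_facet" using face_of_trans [OF _ face] by simp_all
  then have "u a \<in> (\<lambda>v. v /\<^sub>R sqrt 3) ` pentagon" "u b \<in> (\<lambda>v. v /\<^sub>R sqrt 3) ` pentagon"
    unfolding extreme_points_top_facet [symmetric] by (simp_all add: face_of_singleton)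
  then obtain a' b' where ab: "a' \<in> pentagon" "b' \<in> pentagon" "u a = a' /\<^sub>R sqrt 3" "u b = b' /\<^sub>R sqrt 3" by blast
  then obtain k where k: "a' = (rot ^^ k) vtx \<and> b' = (rot ^^ k) vtx' \<or> a' = (rot ^^ k) vtx' \<and> b' = (rot ^^ k) vtx"
    using edge_of_top_facet edge by metis
  define g where "g = (if a' = (rot ^^ k) vtx \<and> b' = (rot ^^ k) vtx' then rot ^^ k else (\<lambda>x. (rot ^^ k) (s2 x)))"
  have g: "g \<in> W" "g vtx = a'" "g vtx' = b'" "g ctr = ctr"
    using k rot_power_in_W [of k] W_compose [OF rot_power_in_W s2_in_W, of k]
    by (auto simp: g_def s2_gens rot_power_ctr)
  have wg: "(\<lambda>x. w (g x)) \<in> W" by (rule W_compose [OF w(1) g(1)])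
  have "g a0 = u a" "g b0 = u b"
    by (simp_all add: a0_def b0_def linear_cmul [OF W_linear [OF g(1)]] g ab)
  then have "w (g a0) = a" "w (g b0) = b" by (simp_all add: u(2))
  moreover have "w (g c0) = sph_centre F"
    unfolding w(2) sph_centre_orth_image [OF W_orth [OF w(1)]] sph_centre_top_facet W_c0 [OF g(1)] g(4) ..
  ultimately show "T \<in> (\<lambda>w. (w c0, w a0, w b0)) ` W" unfolding T(1) by (intro image_eqI [OF _ wg]) simp
next
  fix T assume "T \<in> (\<lambda>w. (w c0, w a0, w b0)) ` W"
  then obtain w where w: "w \<in> W" "T = (w c0, w a0, w b0)" by blast
  have "w ` top_facet facet_of dodecahedron" using w(1) by (auto simp: facet_of_dodecahedron)
  moreover have "w ` closed_segment a0 b0 edge_of w ` top_facet"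
    using top_edge by (simp add: edge_of_orth_image W_orth [OF w(1)] a0_def b0_def)
  then have "closed_segment (w a0) (w b0) edge_of w ` top_facet"
    by (simp add: orth_closed_segment W_orth [OF w(1)])
  moreover have "sph_centre (w ` top_facet) = w c0"
    by (simp add: sph_centre_orth_image W_orth [OF w(1)] sph_centre_top_facet c0_def)
  ultimately show "T \<in> base_triangles" unfolding base_triangles_def w(2)
    by (intro CollectI exI [of _ "w ` top_facet"] exI [of _ "w a0"] exI [of _ "w b0"]) simp
qed

text \<open>The stabiliser of a centre is dihedral of order 10, since an element is determined by
  its image of one directed edge of the face. This is for counting the faces of K_n.\<close>

lemma W_fix_ctr:
  assumes "w \<in> W" "w ctr = ctr"
  shows "\<exists>k<5. w = rot ^^ k \<or> w = (\<lambda>x. (rot ^^ k) (s2 x))"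
proof -
  have "w ` closed_segment (vtx /\<^sub>R sqrt 3) (vtx' /\<^sub>R sqrt 3) edge_of w ` top_facet"
    using top_edge by (simp add: edge_of_orth_image W_orth [OF assms(1)])
  then have "closed_segment (w vtx /\<^sub>R sqrt 3) (w vtx' /\<^sub>R sqrt 3) edge_of top_facet"
    by (simp add: orth_closed_segment W_orth [OF assms(1)] W_top_facet [OF assms] linear_cmul W_linear [OF assms(1)])
  moreover have "w v \<in> pentagon" if "v \<in> {vtx, vtx'}" for v
    using that W_vertices20 [OF assms(1), of v] vtx_in_vertices20 W_inner [OF assms(1), of ctr v] assms(2)
    by (auto simp: pentagon_eq gens_inner)
  ultimately obtain k where k: "k < 5" "w vtx = (rot ^^ k) vtx \<and> w vtx' = (rot ^^ k) vtx' \<or>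
      w vtx = (rot ^^ k) vtx' \<and> w vtx' = (rot ^^ k) vtx"
    using edge_of_top_facet [of "w vtx" "w vtx'"] by auto
  have mid: "v mid = (1 / (2 * golden)) *\<^sub>R (v vtx + v vtx')" if "v \<in> W" for v
    by (simp only: mid_eq linear_add linear_cmul W_linear [OF that])
  note W = rot_power_in_W [of k] W_compose [OF rot_power_in_W s2_in_W, of k]
  from k(2) show ?thesis
  proof
    assume *: "w vtx = (rot ^^ k) vtx \<and> w vtx' = (rot ^^ k) vtx'"
    have "w mid = (rot ^^ k) mid" unfolding mid [OF assms(1)] mid [OF W(1)] using * by simp
    then have "w = rot ^^ k"
      by (intro W_eqI [OF assms(1) W(1)]) (simp_all add: assms(2) rot_power_ctr *)
    then show ?thesis using k(1) by blast
  next
    assume *: "w vtx = (rot ^^ k) vtx' \<and> w vtx' = (rot ^^ k) vtx"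
    have "w mid = (rot ^^ k) mid" unfolding mid [OF assms(1)] mid [OF W(1)] using * by (simp add: add.commute)
    then have "w = (\<lambda>x. (rot ^^ k) (s2 x))"
      by (intro W_eqI [OF assms(1) W(2)]) (simp_all add: assms(2) rot_power_ctr * s2_gens)
    then show ?thesis using k(1) by blast
  qed
qed

section \<open>The points of the subdivision\<close>

lemma sgn_scaleR_unit: "0 < k \<Longrightarrow> norm p = 1 \<Longrightarrow> sgn (k *\<^sub>R p) = p" for p :: "'a::real_normed_vector"
  by (simp add: sgn_div_norm)

lemma fraction_mult_le:
  assumes "k \<le> n" "0 < n" "0 \<le> (x::real)"
  shows "0 \<le> real k / real n * x" "real k / real n * x \<le> x"
proof -
  have "real k / real n \<le> 1" using assms by simp
  from mult_right_mono [OF this assms(3)] show "real k / real n * x \<le> x" by simp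
qed (use assms in simp)

text \<open>Here u is the unit tangent vector at c in the direction of y, so that the arc is
  parametrised by its length t as \<open>cos t *\<^sub>R c + sin t *\<^sub>R u\<close>.\<close>

lemma div_point_eq:
  fixes c u :: "real^3"
  assumes c: "c \<bullet> c = 1" and u: "u \<bullet> u = 1" and cu: "c \<bullet> u = 0" "u \<bullet> c = 0"
    and y: "y = cos \<theta> *\<^sub>R c + sin \<theta> *\<^sub>R u" and \<theta>: "0 < \<theta>" "\<theta> < pi" and k: "k \<le> n" "0 < n"
  shows "div_point n c y k = cos (real k / real n * \<theta>) *\<^sub>R c + sin (real k / real n * \<theta>) *\<^sub>R u"
  unfolding div_point_def
proof (rule the_equality)
  define t where "t = real k / real n * \<theta>"
  have t: "0 \<le> t" "t \<le> \<theta>"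
    using fraction_mult_le [OF k, of \<theta>] \<theta> by (simp_all only: t_def less_imp_le)
  define p where "p = cos t *\<^sub>R c + sin t *\<^sub>R u"
  have "p \<bullet> p = 1"
    by (simp add: p_def inner_add_left inner_add_right c u cu flip: power2_eq_square)
  then have p: "norm p = 1" by (simp add: norm_eq_1)
  have cy: "c \<bullet> y = cos \<theta>" by (simp add: y inner_add_right c cu)
  then have dist: "sph_dist c y = \<theta>" using \<theta> by (simp add: sph_dist_def arccos_cos)
  have "sin \<theta> > 0" using \<theta> by (rule sin_gt_zero)
  have "p \<in> sph_arc c y"
  proof -
    \<comment> \<open>The identity behind this is sin (\<theta> - t) c + sin t y = sin \<theta> p;
      division by D makes the left side a convex combination.\<close>
    define D where "D = sin (\<theta> - t) + sin t"
    have "0 \<le> sin (\<theta> - t)" "0 \<le> sin t" using t \<theta> by (auto intro!: sin_ge_zero)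
    moreover have "\<not> (sin (\<theta> - t) = 0 \<and> sin t = 0)"
    proof
      assume *: "sin (\<theta> - t) = 0 \<and> sin t = 0"
      have "sin \<theta> = sin (\<theta> - t) * cos t + cos (\<theta> - t) * sin t"
        using sin_add [of "\<theta> - t" t] by simp
      then show False using * \<open>sin \<theta> > 0\<close> by simp
    qed
    ultimately have D: "0 < D" "0 \<le> sin t / D" "sin t / D \<le> 1"
      unfolding D_def by (auto simp: less_le add_nonneg_eq_0_iff)
    have "1 - sin t / D = sin (\<theta> - t) / D" using D(1) by (simp add: D_def field_simps)
    then have "1 - sin t / D + sin t / D * cos \<theta> = (sin (\<theta> - t) + sin t * cos \<theta>) / D"
      by (simp add: add_divide_distrib)
    also have "\<dots> = sin \<theta> / D * cos t" by (simp add: sin_diff mult.commute)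
    finally have "1 - sin t / D + sin t / D * cos \<theta> = sin \<theta> / D * cos t" .
    moreover have "(1 - sin t / D) *\<^sub>R c + (sin t / D) *\<^sub>R y =
        (1 - sin t / D + sin t / D * cos \<theta>) *\<^sub>R c + (sin t / D * sin \<theta>) *\<^sub>R u"
      by (simp add: y algebra_simps)
    ultimately have "(1 - sin t / D) *\<^sub>R c + (sin t / D) *\<^sub>R y = (sin \<theta> / D) *\<^sub>R p"
      by (simp add: p_def scaleR_add_right mult.commute)
    moreover have "sgn ((sin \<theta> / D) *\<^sub>R p) = p"
      using D(1) \<open>sin \<theta> > 0\<close> p by (intro sgn_scaleR_unit) auto
    ultimately show ?thesis
      unfolding sph_arc_def in_segment using D
      by (intro image_eqI [where x = "(sin \<theta> / D) *\<^sub>R p"]) (auto simp: in_segment)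
  qed
  moreover have "sph_dist c p = real k / real n * sph_dist c y"
  proof -
    have "c \<bullet> p = cos t" by (simp add: p_def inner_add_right c cu)
    then show ?thesis using t \<theta> unfolding dist t_def [symmetric] by (simp add: sph_dist_def arccos_cos)
  qed
  ultimately show "cos (real k / real n * \<theta>) *\<^sub>R c + sin (real k / real n * \<theta>) *\<^sub>R u \<in> sph_arc c y \<and>
     sph_dist c (cos (real k / real n * \<theta>) *\<^sub>R c + sin (real k / real n * \<theta>) *\<^sub>R u) = real k / real n * sph_dist c y"
    by (simp only: p_def t_def simp_thms)
  fix x assume x: "x \<in> sph_arc c y \<and> sph_dist c x = real k / real n * sph_dist c y"
  then obtain s where s: "0 \<le> s" "s \<le> 1" "x = sgn ((1 - s) *\<^sub>R c + s *\<^sub>R y)"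
    by (auto simp: sph_arc_def in_segment)
  define q where "q = (1 - s) *\<^sub>R c + s *\<^sub>R y"
  have q: "q = (1 - s + s * cos \<theta>) *\<^sub>R c + (s * sin \<theta>) *\<^sub>R u"
    by (simp add: q_def y algebra_simps)
  have "q \<noteq> 0"
  proof
    assume "q = 0"
    then have "c \<bullet> q = 0" "u \<bullet> q = 0" by auto
    then have "1 - s + s * cos \<theta> = 0" "s * sin \<theta> = 0"
      unfolding q by (simp_all add: inner_add_right c u cu)
    then show False using \<open>sin \<theta> > 0\<close> by auto
  qed
  \<comment> \<open>On the arc the coordinate along u is nonnegative, so it is determined by the
    coordinate along c, which the distance fixes.\<close>
  define A B where "A = (1 - s + s * cos \<theta>) / norm q" and "B = s * sin \<theta> / norm q"
  have xAB: "x = A *\<^sub>R c + B *\<^sub>R u"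
    unfolding s(3) q_def [symmetric] sgn_div_norm A_def B_def
    by (subst q) (simp add: scaleR_add_right divide_inverse_commute)
  have "0 \<le> B" using s \<open>sin \<theta> > 0\<close> by (simp add: B_def)
  have "norm x = 1" using \<open>q \<noteq> 0\<close> by (simp add: s(3) q_def [symmetric] norm_sgn)
  then have AB: "A\<^sup>2 + B\<^sup>2 = 1"
    by (simp add: norm_eq_1 xAB inner_add_left inner_add_right c u cu power2_eq_square)
  then have "A\<^sup>2 \<le> 1\<^sup>2" by (metis le_add_same_cancel1 one_power2 zero_le_power2)
  then have "\<bar>A\<bar> \<le> 1" by (simp only: abs_le_square_iff [symmetric] abs_one)
  moreover have "arccos A = t"
    using x unfolding dist t_def [symmetric] by (simp add: sph_dist_def xAB inner_add_right c cu)
  ultimately have A: "A = cos t" using cos_arccos_abs by metis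
  then have "B\<^sup>2 = (sin t)\<^sup>2" using AB by (simp add: cos_squared_eq)
  moreover have "0 \<le> sin t" using t \<theta> by (intro sin_ge_zero) auto
  ultimately have "B = sin t" using \<open>0 \<le> B\<close> by (simp add: power2_eq_iff_nonneg)
  then show "x = cos (real k / real n * \<theta>) *\<^sub>R c + sin (real k / real n * \<theta>) *\<^sub>R u"
    by (simp only: xAB A t_def)
qed

lemma sin_side_pos: "0 < sin side"
  using side_bound pi_gt3 by (intro sin_gt_zero) auto

text \<open>The point of longitude l and latitude m, with f3 as north pole and f1 as origin of the
  longitudes.\<close>

definition frame_pt :: "real^3 \<Rightarrow> real^3 \<Rightarrow> real^3 \<Rightarrow> real \<Rightarrow> real \<Rightarrow> real^3" where
  "frame_pt f1 f2 f3 l m = (cos m * cos l) *\<^sub>R f1 + (cos m * sin l) *\<^sub>R f2 + sin m *\<^sub>R f3"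

context
  fixes f1 f2 f3 :: "real^3"
  assumes frame: "f1 \<bullet> f1 = 1" "f2 \<bullet> f2 = 1" "f3 \<bullet> f3 = 1" "f1 \<bullet> f2 = 0" "f1 \<bullet> f3 = 0" "f2 \<bullet> f3 = 0"
begin

lemma frame': "f2 \<bullet> f1 = 0" "f3 \<bullet> f1 = 0" "f3 \<bullet> f2 = 0"
  using frame by (simp_all add: inner_commute)

lemmas frame_simps = inner_add_left inner_add_right inner_diff_left inner_diff_right frame frame'

lemma norm_frame: "norm (x *\<^sub>R f1 + y *\<^sub>R f2 + z *\<^sub>R f3) = 1 \<longleftrightarrow> x\<^sup>2 + y\<^sup>2 + z\<^sup>2 = 1"
  by (simp add: norm_eq_1 frame_simps power2_eq_square)

text \<open>The meridian and the parallel determine the point; membership in the triangle is then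
  verified by exhibiting nonnegative coefficients. An arbitrary orthonormal frame is allowed, of
  either orientation, so that all base triangles are treated at once.\<close>

lemma kitrick_point_frame:
  assumes a: "a = cos side *\<^sub>R f1 + (sin side * c36) *\<^sub>R f2 + (sin side * s36) *\<^sub>R f3"
    and b: "b = cos side *\<^sub>R f1 + (sin side * c36) *\<^sub>R f2 - (sin side * s36) *\<^sub>R f3"
    and i: "0 < n" "i \<le> n" and j: "\<bar>j\<bar> \<le> int i"
  shows "kitrick_point n (f1, a, b) i j =
    frame_pt f1 f2 f3 (lon (real i / real n * side)) (lat (real_of_int j / real n * side))"
proof -
  define t where "t k = k / real n * side" for k
  define x where "x = frame_pt f1 f2 f3 (lon (t i)) (lat (t j))"
  have sq: "c36 * c36 + s36 * s36 = 1" using s36_c36 by (simp add: power2_eq_square)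
  have div_a: "div_point n f1 a k = cos (t k) *\<^sub>R f1 + (sin (t k) * c36) *\<^sub>R f2 + (sin (t k) * s36) *\<^sub>R f3"
    if "k \<le> n" for k
  proof -
    have "div_point n f1 a k = cos (t k) *\<^sub>R f1 + sin (t k) *\<^sub>R (c36 *\<^sub>R f2 + s36 *\<^sub>R f3)"
      unfolding t_def
      by (rule div_point_eq) (use side_bound i that pi_gt3 sq in \<open>auto simp: frame_simps a scaleR_add_right\<close>)
    then show ?thesis by (simp add: scaleR_add_right)
  qed
  have div_b: "div_point n f1 b k = cos (t k) *\<^sub>R f1 + (sin (t k) * c36) *\<^sub>R f2 - (sin (t k) * s36) *\<^sub>R f3"
    if "k \<le> n" for k
  proof -
    have "div_point n f1 b k = cos (t k) *\<^sub>R f1 + sin (t k) *\<^sub>R (c36 *\<^sub>R f2 - s36 *\<^sub>R f3)"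
      unfolding t_def
      by (rule div_point_eq) (use side_bound i that pi_gt3 sq in \<open>auto simp: frame_simps b scaleR_diff_right\<close>)
    then show ?thesis by (simp add: scaleR_diff_right)
  qed
  have "a - b = (2 * (sin side * s36)) *\<^sub>R f3" by (simp add: a b algebra_simps flip: scaleR_add_left)
  moreover have "0 < 2 * (sin side * s36)" using sin_side_pos by simp
  moreover have "norm f3 = 1" using frame by (simp add: norm_eq_1)
  ultimately have N: "sgn (a - b) = f3" using sgn_scaleR_unit by metis
  define q where "q = (if j \<ge> 0 then div_point n f1 a (nat j) else div_point n f1 b (nat (- j)))"
  have q: "q \<bullet> f3 = sin (lat (t j))"
  proof (cases "j \<ge> 0")
    case True
    then have "nat j \<le> n" "real (nat j) = real_of_int j" using j i by auto
    then show ?thesis using True by (simp add: q_def div_a frame_simps sin_lat)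
  next
    case False
    then have "nat (- j) \<le> n" "real (nat (- j)) = - real_of_int j" using j i by auto
    moreover have "t (- real_of_int j) = - t j" by (simp add: t_def)
    ultimately show ?thesis using False by (simp add: q_def div_b frame_simps sin_lat)
  qed
  have ti: "0 \<le> t i" "t i \<le> side" using fraction_mult_le [OF i(2,1), of side] side_bound
    by (simp_all only: t_def less_imp_le)
  have cos_ti: "0 < cos (t i)" using ti by (intro cos_pos_side) auto
  have tj: "\<bar>t j\<bar> \<le> t i"
    using j side_bound i by (auto simp: t_def abs_mult intro!: mult_right_mono divide_right_mono)
  have abs: "\<bar>t j\<bar> = t \<bar>real_of_int j\<bar>" using side_bound i by (simp add: t_def abs_mult)
  have cos_le: "cos (lat (t i)) \<le> cos (lat (t j))"
  proof -
    have "cos (lat (t i)) \<le> cos (lat \<bar>t j\<bar>)" by (rule cos_lat_antimono) (use tj ti in auto)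
    then show ?thesis by (simp add: lat_minus abs_if split: if_splits)
  qed
  have sin_le: "\<bar>sin (t j)\<bar> \<le> sin (t i)"
  proof -
    have "sin \<bar>t j\<bar> \<le> sin (t i)" using tj ti side_bound by (intro sin_monotone_2pi_le) auto
    moreover have "0 \<le> sin \<bar>t j\<bar>" using tj ti side_bound by (intro sin_ge_zero) auto
    ultimately show ?thesis by (auto simp: abs_if split: if_splits)
  qed
  \<comment> \<open>The point x is r times as far from the polar axis as the division point on the
    same meridian; r \<ge> 1 because the latitude of x is not larger in absolute value.\<close>
  define r where "r = cos (lat (t j)) / cos (lat (t i))"
  have r: "1 \<le> r" "cos (lat (t j)) = r * cos (lat (t i))" using cos_le by (simp_all add: r_def)
  have x: "x = (r * cos (t i)) *\<^sub>R f1 + (r * (c36 * sin (t i))) *\<^sub>R f2 + (s36 * sin (t j)) *\<^sub>R f3"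
    unfolding x_def frame_pt_def r(2) sin_lat
    using cos_lat_cos_lon [OF cos_ti] cos_lat_sin_lon [OF cos_ti] by (simp add: mult.assoc)
  have norm_x: "norm x = 1"
    unfolding x_def frame_pt_def norm_frame
    by (simp add: power_mult_distrib sin_squared_eq algebra_simps flip: distrib_left)
  have tri: "x \<in> sph_triangle f1 a b"
  proof -
    \<comment> \<open>The coefficients of x in the three corners: \<open>\<alpha>\<close> and
      \<open>\<beta>\<close> come from the components along f2 and f3, \<open>\<gamma>\<close> from
      the one along f1. The product \<open>\<gamma> * sin side\<close> is
      \<open>r * sin (side - t i)\<close>.\<close>
    define \<alpha> where "\<alpha> = (r * sin (t i) + sin (t j)) / (2 * sin side)"
    define \<beta> where "\<beta> = (r * sin (t i) - sin (t j)) / (2 * sin side)"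
    define \<gamma> where "\<gamma> = r * cos (t i) - (\<alpha> + \<beta>) * cos side"
    have ab: "(\<alpha> + \<beta>) * sin side = r * sin (t i)" "(\<alpha> - \<beta>) * sin side = sin (t j)"
      using sin_side_pos by (simp_all add: \<alpha>_def \<beta>_def field_simps)
    have "sin (t i) \<le> r * sin (t i)"
      using r sin_le by (simp add: mult_le_cancel_right1)
    then have nonneg: "0 \<le> \<alpha>" "0 \<le> \<beta>" using sin_le sin_side_pos by (auto simp: \<alpha>_def \<beta>_def abs_le_iff)
    have "0 \<le> \<gamma>"
    proof -
      have "0 \<le> sin (side - t i)" using ti side_bound by (intro sin_ge_zero) auto
      then have "0 \<le> r * (sin side * cos (t i) - cos side * sin (t i))" using r by (simp add: sin_diff)
      also have "\<dots> = r * cos (t i) * sin side - ((\<alpha> + \<beta>) * sin side) * cos side"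
        unfolding ab(1) by (simp add: algebra_simps)
      also have "\<dots> = \<gamma> * sin side" by (simp add: \<gamma>_def algebra_simps)
      finally show ?thesis using sin_side_pos by (simp add: zero_le_mult_iff)
    qed
    have decomp: "x = \<gamma> *\<^sub>R f1 + \<alpha> *\<^sub>R a + \<beta> *\<^sub>R b"
    proof -
      have "\<gamma> *\<^sub>R f1 + \<alpha> *\<^sub>R a + \<beta> *\<^sub>R b = (\<gamma> + (\<alpha> + \<beta>) * cos side) *\<^sub>R f1 +
          (((\<alpha> + \<beta>) * sin side) * c36) *\<^sub>R f2 + (((\<alpha> - \<beta>) * sin side) * s36) *\<^sub>R f3"
        by (simp add: a b algebra_simps)
      then show ?thesis unfolding x ab by (simp add: \<gamma>_def mult_ac)
    qed
    have "x \<noteq> 0" using norm_x by auto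
    with decomp have "\<gamma> + \<alpha> + \<beta> \<noteq> 0"
      using nonneg \<open>0 \<le> \<gamma>\<close> by (auto simp: add_nonneg_eq_0_iff)
    then have "0 < \<gamma> + \<alpha> + \<beta>" using nonneg \<open>0 \<le> \<gamma>\<close> by linarith
    then obtain k where "0 < k" "k *\<^sub>R x \<in> convex hull {f1, a, b}"
      using cone3_meets_hull [OF \<open>0 \<le> \<gamma>\<close> nonneg _ decomp] by blast
    then show ?thesis
      unfolding sph_triangle_def by (intro image_eqI [where x = "k *\<^sub>R x"]) (simp_all add: sgn_scaleR_unit norm_x)
  qed
  let ?p = "cos (t i) *\<^sub>R f1 + (sin (t i) * c36) *\<^sub>R f2 + (sin (t i) * s36) *\<^sub>R f3"
  have mer: "x \<in> meridian f3 ?p"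
    unfolding meridian_def
  proof (intro CollectI conjI exI)
    show "x = r *\<^sub>R ?p + (s36 * sin (t j) - r * (sin (t i) * s36)) *\<^sub>R f3"
      unfolding x by (simp add: algebra_simps)
  qed (use norm_x r in auto)
  have par: "x \<in> parallel f3 q"
    unfolding parallel_def using norm_x q by (simp add: x frame_simps sin_lat)
  \<comment> \<open>The parallel fixes the component along f3, the norm then fixes the distance from
    the polar axis, and this fixes the nonnegative factor s.\<close>
  have unique: "x' = x" if x': "x' \<in> meridian f3 ?p" "x' \<in> parallel f3 q" for x'
  proof -
    obtain s v where s: "s \<ge> 0" "x' = s *\<^sub>R ?p + v *\<^sub>R f3" and norm: "norm x' = 1"
      using x'(1) by (auto simp: meridian_def)
    have "x' \<bullet> f3 = sin (lat (t j))" using x'(2) q by (simp add: parallel_def)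
    then have v: "s * (sin (t i) * s36) + v = sin (lat (t j))"
      by (simp add: s(2) frame_simps)
    have eq: "x' = (s * cos (t i)) *\<^sub>R f1 + (s * (sin (t i) * c36)) *\<^sub>R f2 + (s * (sin (t i) * s36) + v) *\<^sub>R f3"
      unfolding s(2) by (simp add: algebra_simps)
    have "(s * cos (t i))\<^sup>2 + (s * (sin (t i) * c36))\<^sup>2 + (sin (lat (t j)))\<^sup>2 = 1"
      using norm unfolding eq v norm_frame .
    moreover have "(s * cos (lat (t i)))\<^sup>2 = (s * cos (t i))\<^sup>2 + (s * (sin (t i) * c36))\<^sup>2"
      by (simp only: power_mult_distrib cos_lat_sq) (simp only: algebra_simps)
    ultimately have "(s * cos (lat (t i)))\<^sup>2 = (cos (lat (t j)))\<^sup>2"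
      unfolding cos_squared_eq [of "lat (t j)"] by linarith
    then have "s * cos (lat (t i)) = cos (lat (t j))" using s(1) by (simp add: power2_eq_iff_nonneg)
    then have "s = r" by (simp add: r_def eq_divide_eq)
    then show ?thesis unfolding eq v x by (simp add: sin_lat mult_ac)
  qed
  have "kitrick_point n (f1, a, b) i j =
    (THE x. x \<in> sph_triangle f1 a b \<inter> meridian f3 (div_point n f1 a i) \<inter> parallel f3 q)"
    by (simp only: kitrick_point.simps Let_def N q_def)
  also have "\<dots> = x"
    unfolding div_a [OF i(2)]
  proof (rule the_equality)
    show "x \<in> sph_triangle f1 a b \<inter> meridian f3 ?p \<inter> parallel f3 q" using tri mer par by (intro IntI)
  qed (use unique in \<open>elim IntE\<close>)
  finally show ?thesis by (simp only: x_def t_def of_int_of_nat_eq)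
qed

end

section \<open>Coordinates of the vertices in the standard base triangle\<close>

definition axis2 :: "real^3" where "axis2 = (1 / sqrt (golden + 2)) *\<^sub>R vector [- golden, 0, 1]"

lemma sqrt_golden2: "sqrt (golden + 2) * sqrt (golden + 2) = golden + 2" "0 < sqrt (golden + 2)"
  using golden_bounds by simp_all

lemma c0_eq: "c0 = (1 / sqrt (golden + 2)) *\<^sub>R ctr"
  by (simp add: c0_def sgn_div_norm norm_eq_sqrt_inner gens_inner inverse_eq_divide)

text \<open>The geographic frame of the standard triangle: the apex \<open>c0\<close>, the pole
  \<open>root2\<close>, which is parallel to \<open>a0 - b0\<close>, and a third axis on the
  equator.\<close>

lemma axes_orthonormal:
  "c0 \<bullet> c0 = 1" "axis2 \<bullet> axis2 = 1" "root2 \<bullet> root2 = 1" "c0 \<bullet> axis2 = 0" "c0 \<bullet> root2 = 0" "axis2 \<bullet> root2 = 0"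
proof -
  have *: "1 / sqrt (golden + 2) * (1 / sqrt (golden + 2)) * (golden + 2) = 1"
    using sqrt_golden2 by (simp add: field_simps)
  show "c0 \<bullet> c0 = 1" using * by (simp add: c0_eq gens_inner)
  show "axis2 \<bullet> axis2 = 1" using * by (simp add: axis2_def inner_vector3 golden_mult add.commute)
  show "root2 \<bullet> root2 = 1" "c0 \<bullet> axis2 = 0" "c0 \<bullet> root2 = 0" "axis2 \<bullet> root2 = 0"
    by (simp_all add: root2_def c0_eq axis2_def ctr_def inner_vector3)
qed

lemma side_coordinates:
  "(golden + 1) / (sqrt 3 * sqrt (golden + 2)) = cos side"
  "golden / (sqrt 3 * sqrt (golden + 2)) = sin side * c36"
  "(golden - 1) / sqrt 3 = sin side * s36"
proof -
  have sin_sq: "(sin side)\<^sup>2 = (8 - 4 * golden) / (9 - 3 * golden)"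
    unfolding sin_squared_eq cos_side_sq using golden_bounds by (simp add: field_simps)
  have "((golden + 1) / (sqrt 3 * sqrt (golden + 2)))\<^sup>2 = (cos side)\<^sup>2"
    unfolding cos_side_sq power_divide power_mult_distrib using golden_bounds
    by (simp add: power2_eq_square frac_eq_eq) (simp add: algebra_simps golden_mult)
  then show "(golden + 1) / (sqrt 3 * sqrt (golden + 2)) = cos side"
    using golden_bounds cos_side_pos by (simp add: power2_eq_iff_nonneg)
  have "(golden / (sqrt 3 * sqrt (golden + 2)))\<^sup>2 = (sin side * c36)\<^sup>2"
    unfolding power_divide power_mult_distrib sin_sq c36_sq using golden_bounds
    by (simp add: power2_eq_square frac_eq_eq) (simp add: algebra_simps golden_mult)
  then show "golden / (sqrt 3 * sqrt (golden + 2)) = sin side * c36"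
    using golden_bounds sin_side_pos by (simp add: power2_eq_iff_nonneg)
  have "((golden - 1) / sqrt 3)\<^sup>2 = (sin side * s36)\<^sup>2"
  proof -
    define d where "d = 3 - golden"
    have "d \<noteq> 0" using golden_bounds by (simp add: d_def)
    moreover have "9 - 3 * golden = 3 * d" "8 - 4 * golden = 4 * (2 - golden)" by (simp_all add: d_def)
    ultimately have "(sin side * s36)\<^sup>2 = (2 - golden) / 3"
      unfolding power_mult_distrib sin_sq s36_sq d_def [symmetric] by simp
    moreover have "(golden - 1)\<^sup>2 = 2 - golden"
      by (simp add: power2_eq_square algebra_simps golden_mult)
    ultimately show ?thesis by (simp add: power_divide)
  qed
  then show "(golden - 1) / sqrt 3 = sin side * s36"
    using golden_bounds sin_side_pos by (simp add: power2_eq_iff_nonneg)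
qed

lemma a0_frame: "a0 = cos side *\<^sub>R c0 + (sin side * c36) *\<^sub>R axis2 + (sin side * s36) *\<^sub>R root2"
  and b0_frame: "b0 = cos side *\<^sub>R c0 + (sin side * c36) *\<^sub>R axis2 - (sin side * s36) *\<^sub>R root2"
proof -
  have c: "(1 / (sqrt 3 * sqrt (golden + 2))) * (1 / sqrt (golden + 2)) = 1 / (sqrt 3 * (golden + 2))"
    using sqrt_golden2 by simp
  have eq: "cos side *\<^sub>R c0 + (sin side * c36) *\<^sub>R axis2 =
     vector [0, 0, golden / sqrt 3]"
  proof -
    have "golden + 2 \<noteq> 0" using golden_bounds by linarith
    then have c2: "1 / (sqrt 3 * (golden + 2)) * (golden * (golden + 2)) = golden / sqrt 3" by simp
    have "cos side *\<^sub>R c0 + (sin side * c36) *\<^sub>R axis2 =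
       (1 / (sqrt 3 * sqrt (golden + 2)) * (1 / sqrt (golden + 2))) *\<^sub>R
         ((golden + 1) *\<^sub>R ctr + golden *\<^sub>R vector [- golden, 0, 1])"
      unfolding side_coordinates(1,2) [symmetric] c0_eq axis2_def by (simp add: scaleR_add_right)
    also have "(golden + 1) *\<^sub>R ctr + golden *\<^sub>R vector [- golden, 0, 1] = vector [0, 0, golden * (golden + 2)]"
      by (simp add: ctr_def vec_eq_iff forall_3 algebra_simps golden_mult)
    also have "(1 / (sqrt 3 * sqrt (golden + 2)) * (1 / sqrt (golden + 2))) *\<^sub>R vector [0, 0, golden * (golden + 2)] =
        (vector [0, 0, golden / sqrt 3] :: real^3)"
      unfolding c by (simp only: vec_eq_iff forall_3 vector_scaleR_component vector_3 real_scaleR_def c2 mult_zero_right simp_thms)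
    finally show ?thesis .
  qed
  show "a0 = cos side *\<^sub>R c0 + (sin side * c36) *\<^sub>R axis2 + (sin side * s36) *\<^sub>R root2"
    unfolding eq side_coordinates(3) [symmetric] a0_def root2_def vtx_def
    by (simp add: vec_eq_iff forall_3 field_simps)
  show "b0 = cos side *\<^sub>R c0 + (sin side * c36) *\<^sub>R axis2 - (sin side * s36) *\<^sub>R root2"
    unfolding eq side_coordinates(3) [symmetric] b0_def root2_def vtx'_def
    by (simp add: vec_eq_iff forall_3 field_simps)
qed

definition step :: "nat \<Rightarrow> real" where "step n = side / real n"
definition glat :: "nat \<Rightarrow> int \<Rightarrow> real" where "glat n j = lat (real_of_int j * step n)"
definition glon :: "nat \<Rightarrow> nat \<Rightarrow> real" where "glon n i = lon (real i * step n)"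
definition pt :: "real \<Rightarrow> real \<Rightarrow> real^3" where "pt = frame_pt c0 axis2 root2"
definition gp :: "nat \<Rightarrow> nat \<Rightarrow> int \<Rightarrow> real^3" where "gp n i j = pt (glon n i) (glat n j)"

text \<open>The image of the standard frame under w is again orthonormal, so
  \<open>kitrick_point_frame\<close> applies to it, and linearity pulls w out.\<close>

lemma kitrick_point_W:
  assumes w: "w \<in> W" and n: "0 < n" "i \<le> n" and j: "\<bar>j\<bar> \<le> int i"
  shows "kitrick_point n (w c0, w a0, w b0) i j = w (gp n i j)"
proof -
  note lin = linear_add linear_diff linear_cmul
  have "kitrick_point n (w c0, w a0, w b0) i j = frame_pt (w c0) (w axis2) (w root2)
      (lon (real i / real n * side)) (lat (real_of_int j / real n * side))"
    by (rule kitrick_point_frame)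
      (simp_all only: W_inner [OF w] axes_orthonormal a0_frame b0_frame lin W_linear [OF w] n j)
  also have "\<dots> = w (gp n i j)"
    by (simp add: gp_def pt_def frame_pt_def glon_def glat_def step_def lin W_linear [OF w])
  finally show ?thesis .
qed

lemma inner_pt: "pt l m \<bullet> pt l' m' = cos m * cos m' * cos (l - l') + sin m * sin m'"
proof -
  note * = axes_orthonormal
  have "axis2 \<bullet> c0 = 0" "root2 \<bullet> c0 = 0" "root2 \<bullet> axis2 = 0" using * by (simp_all add: inner_commute)
  then show ?thesis
    by (simp add: pt_def frame_pt_def inner_add_left inner_add_right * cos_diff algebra_simps)
qed

lemma norm_pt: "norm (pt l m) = 1"
  by (simp add: norm_eq_1 inner_pt flip: power2_eq_square)

lemma dist_unit:
  fixes x y :: "'a::real_inner"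
  assumes "norm x = 1" "norm y = 1"
  shows "dist x y = sqrt (2 - 2 * (x \<bullet> y))"
proof -
  have "x \<bullet> x = 1" "y \<bullet> y = 1" using assms by (simp_all add: norm_eq_1)
  then show ?thesis
    by (simp add: dist_norm norm_eq_sqrt_inner inner_diff_left inner_diff_right inner_commute [of y x])
qed

lemma s2_pt: "s2 (pt l m) = pt l (- m)"
proof -
  have "root2 \<bullet> pt l m = sin m"
    using axes_orthonormal by (simp add: pt_def frame_pt_def inner_add_right inner_commute)
  moreover have "(2 * sin m) *\<^sub>R root2 = sin m *\<^sub>R root2 + sin m *\<^sub>R root2"
    by (simp flip: scaleR_add_left)
  ultimately show ?thesis by (simp add: reflect_def pt_def frame_pt_def)
qed

context
  fixes n :: nat
  assumes n: "0 < n"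
begin

lemma step_pos: "0 < step n" and step_mult: "real n * step n = side" and step_le: "step n \<le> side"
proof -
  show "0 < step n" "real n * step n = side" using n side_bound by (simp_all add: step_def)
  show "step n \<le> side" using n side_bound by (simp add: step_def divide_le_eq)
qed

lemma mult_step_le: "real_of_int j \<le> real n \<Longrightarrow> real_of_int j * step n \<le> side"
  using step_mult mult_right_mono [of "real_of_int j" "real n" "step n"] step_pos by simp

lemma glat_minus: "glat n (- j) = - glat n j"
  by (simp add: glat_def lat_minus)

lemma glat_0: "glat n 0 = 0"
  by (simp add: glat_def)

lemma glat_increment:
  assumes "0 \<le> j" "j < int n"
  shows "step n / 2 \<le> glat n (j + 1) - glat n j" "glat n (j + 1) - glat n j \<le> s36 * step n"
proof -
  have *: "0 \<le> real_of_int j * step n" "0 \<le> step n" "real_of_int j * step n + step n \<le> side"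
    using assms step_pos mult_step_le [of "j + 1"] by (simp_all add: algebra_simps)
  show "step n / 2 \<le> glat n (j + 1) - glat n j" "glat n (j + 1) - glat n j \<le> s36 * step n"
    using lat_increment_bounds [OF *] by (simp_all add: glat_def algebra_simps)
qed

lemma glat_increment_antimono:
  assumes "0 \<le> j" "j \<le> k" "k < int n"
  shows "glat n (k + 1) - glat n k \<le> glat n (j + 1) - glat n j"
proof -
  have "0 \<le> real_of_int j * step n" "real_of_int j * step n \<le> real_of_int k * step n"
    "0 \<le> step n" "real_of_int k * step n + step n \<le> side"
    using assms step_pos mult_step_le [of "k + 1"] by (simp_all add: algebra_simps)
  from lat_increment_antimono [OF this] show ?thesis by (simp add: glat_def algebra_simps)
qed

lemma glon_increment:
  assumes "i < n"
  shows "c36 * step n \<le> glon n (i + 1) - glon n i" "glon n (i + 1) - glon n i \<le> 3 / (4 * c36) * step n"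
proof -
  have *: "0 \<le> real i * step n" "0 \<le> step n" "real i * step n + step n \<le> side"
    using assms step_pos mult_step_le [of "int i + 1"] by (simp_all add: algebra_simps)
  show "c36 * step n \<le> glon n (i + 1) - glon n i" "glon n (i + 1) - glon n i \<le> 3 / (4 * c36) * step n"
    using lon_increment_bounds [OF *] by (simp_all add: glon_def algebra_simps)
qed

lemma glon_increment_mono:
  assumes "i \<le> k" "k < n"
  shows "glon n (i + 1) - glon n i \<le> glon n (k + 1) - glon n k"
proof -
  have "0 \<le> real i * step n" "real i * step n \<le> real k * step n"
    "0 \<le> step n" "real k * step n + step n \<le> side"
    using assms step_pos mult_step_le [of "int k + 1"] by (simp_all add: algebra_simps)
  from lon_increment_mono [OF this] show ?thesis by (simp add: glon_def algebra_simps)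
qed

lemma glat_less:
  assumes "j < k" "- int n \<le> j" "k \<le> int n"
  shows "glat n j < glat n k"
proof -
  have "- side \<le> real_of_int j * step n" "real_of_int k * step n \<le> side"
    using mult_step_le [of "- j"] mult_step_le [of k] assms by simp_all
  moreover have "real_of_int j * step n < real_of_int k * step n" using assms step_pos by simp
  ultimately have "sin (real_of_int j * step n) < sin (real_of_int k * step n)"
    using side_bound by (intro sin_monotone_2pi) auto
  then have "s36 * sin (real_of_int j * step n) < s36 * sin (real_of_int k * step n)" by simp
  then show ?thesis
    unfolding glat_def lat_def
    by (subst arcsin_less_mono) (auto intro: less_imp_le s36_sin_bounds)
qed

lemma glon_less:
  assumes "i < k" "k \<le> n"
  shows "glon n i < glon n k"
proof -
  have "0 \<le> real i * step n" "real i * step n < real k * step n" "real k * step n \<le> side"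
    using assms step_pos mult_step_le [of "int k"] by simp_all
  then have "c36 * (real k * step n - real i * step n) \<le> lon (real k * step n) - lon (real i * step n)"
    using lon_increment_bounds(1) [of "real i * step n" "real k * step n - real i * step n"] by simp
  moreover have "0 < c36 * (real k * step n - real i * step n)"
    using \<open>real i * step n < real k * step n\<close> by simp
  ultimately show ?thesis by (simp add: glon_def)
qed

lemma glat_bounds: "- (pi / 2) < glat n j" "glat n j < pi / 2" "0 < cos (glat n j)"
  using lat_between [of "real_of_int j * step n"] by (simp_all add: glat_def)

lemma cos_glat_antimono:
  assumes "0 \<le> j" "j \<le> k" "k \<le> int n"
  shows "cos (glat n k) \<le> cos (glat n j)"
  unfolding glat_def using assms step_pos mult_step_le [of k] by (intro cos_lat_antimono) auto

lemma glon_bounds: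
  assumes "i \<le> n"
  shows "0 \<le> glon n i" "glon n i < pi / 2"
proof -
  show "0 \<le> glon n i" using glon_less [of 0 i] assms by (cases "i = 0") (auto simp: glon_def)
  show "glon n i < pi / 2" unfolding glon_def lon_def by (rule arctan_ubound)
qed

lemma gp_side: "i \<le> n \<Longrightarrow> gp n i (int i) = cos (real i * step n) *\<^sub>R c0 +
    sin (real i * step n) *\<^sub>R (c36 *\<^sub>R axis2 + s36 *\<^sub>R root2)"
proof -
  assume "i \<le> n"
  then have "0 < cos (real i * step n)" using mult_step_le [of "int i"] step_pos by (intro cos_pos_side) auto
  then show ?thesis
    by (simp add: gp_def pt_def frame_pt_def glat_def glon_def cos_lat_cos_lon cos_lat_sin_lon sin_lat scaleR_add_right mult.commute)
qed

lemma inner_gp_side: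
  assumes "i < n"
  shows "gp n i (int i) \<bullet> gp n (i + 1) (int i + 1) = cos (step n)"
proof -
  have sq: "c36 * c36 + s36 * s36 = 1" using s36_c36 by (simp add: power2_eq_square)
  note * = axes_orthonormal
  have comm: "axis2 \<bullet> c0 = 0" "root2 \<bullet> c0 = 0" "root2 \<bullet> axis2 = 0" using * by (simp_all add: inner_commute)
  define u where "u = c36 *\<^sub>R axis2 + s36 *\<^sub>R root2"
  have u: "u \<bullet> u = 1" "u \<bullet> c0 = 0" "c0 \<bullet> u = 0"
    by (simp_all add: u_def inner_add_left inner_add_right * comm sq)
  have eq: "gp n (i + 1) (int i + 1) = gp n (i + 1) (int (i + 1))" by (simp add: add.commute)
  have "i \<le> n" "i + 1 \<le> n" using assms by simp_all
  then have "gp n i (int i) \<bullet> gp n (i + 1) (int i + 1) =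
      cos (real (i + 1) * step n) * cos (real i * step n) + sin (real (i + 1) * step n) * sin (real i * step n)"
    unfolding eq gp_side [OF \<open>i \<le> n\<close>] gp_side [OF \<open>i + 1 \<le> n\<close>] u_def [symmetric]
    by (simp add: inner_add_left inner_add_right u *(1))
  also have "\<dots> = cos (real (i + 1) * step n - real i * step n)" by (simp only: cos_diff)
  finally show ?thesis by (simp add: algebra_simps)
qed

end

section \<open>Edge lengths\<close>

lemma cos_ge_quadratic: "1 - x\<^sup>2 / 2 \<le> cos (x::real)"
proof -
  have "\<bar>sin (x / 2)\<bar> \<le> \<bar>x / 2\<bar>" by (rule abs_sin_x_le_abs_x)
  then have "(sin (x / 2))\<^sup>2 \<le> (x / 2)\<^sup>2" by (simp only: abs_le_square_iff)
  moreover have "cos x = 1 - 2 * (sin (x / 2))\<^sup>2" using cos_double_sin [of "x / 2"] by simp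
  ultimately show ?thesis by (simp add: power_divide)
qed

lemma cos_le_quartic:
  assumes "\<bar>x::real\<bar> \<le> 2"
  shows "cos x \<le> 1 - x\<^sup>2 / 2 + x ^ 4 / 24"
proof -
  have "x\<^sup>2 \<le> 2\<^sup>2" using abs_le_square_iff [of x 2] assms by simp
  then have "x ^ 6 * x\<^sup>2 \<le> x ^ 6 * 4" by (intro mult_left_mono) (simp_all add: zero_le_even_power)
  moreover have "x ^ 6 * x\<^sup>2 = x ^ 8" "0 \<le> x ^ 6" by (simp_all add: zero_le_even_power flip: power_add)
  ultimately have "x ^ 8 / 40320 \<le> x ^ 6 / 720" by linarith
  then show ?thesis using cos_Maclaurin_8 [of x] by linarith
qed

definition edge_pairs :: "nat \<Rightarrow> ((real^3) \<times> (real^3)) set" where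
  "edge_pairs n = {(gp n i (j - 1), gp n i (j + 1)) |i j. kitrick_index n i (j - 1) \<and> kitrick_index n i (j + 1)} \<union>
     {(gp n i j, gp n (i + 1) (j + 1)) |i j. kitrick_index n i j \<and> i < n} \<union>
     {(gp n i j, gp n (i + 1) (j - 1)) |i j. kitrick_index n i j \<and> i < n}"

text \<open>By \<open>inner_pt\<close>, the inner product of two vertices on the meridians i and i +
  1 and on the parallels m and m + 1; it is the same whichever parallel belongs to which
  meridian.\<close>

definition diag_inner :: "nat \<Rightarrow> nat \<Rightarrow> int \<Rightarrow> real" where
  "diag_inner n i m = cos (glat n m) * cos (glat n (m + 1)) * cos (glon n (i + 1) - glon n i)
     + sin (glat n m) * sin (glat n (m + 1))"

context
  fixes n :: nat
  assumes n: "0 < n"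
begin

lemma glat_1_bounds: "step n / 2 \<le> glat n 1" "glat n 1 \<le> s36 * step n" "0 < glat n 1" "glat n 1 < pi / 4"
proof -
  show 1: "step n / 2 \<le> glat n 1" "glat n 1 \<le> s36 * step n"
    using glat_increment [OF n, of 0] n by (simp_all add: glat_0 [OF n])
  show "0 < glat n 1" using 1(1) step_pos [OF n] by linarith
  have "s36 \<le> 1" unfolding s36_def by (rule sin_le_one)
  then have "s36 * step n \<le> 1 * side" using step_le [OF n] step_pos [OF n] by (intro mult_mono) auto
  then show "glat n 1 < pi / 4" using 1(2) side_bound pi_gt3 by linarith
qed

text \<open>By concavity, two consecutive increments are together longest across the equator, where
  they give \<open>2 * glat n 1\<close>; each is at least half a step by the slope bound 1/2.
  Negative j are mirror images.\<close>

lemma glat_double_increment: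
  assumes "\<bar>j - 1\<bar> \<le> int n" "\<bar>j + 1\<bar> \<le> int n"
  shows "step n \<le> glat n (j + 1) - glat n (j - 1)" "glat n (j + 1) - glat n (j - 1) \<le> 2 * glat n 1"
proof -
  have *: "step n \<le> glat n (j + 1) - glat n (j - 1) \<and> glat n (j + 1) - glat n (j - 1) \<le> 2 * glat n 1"
    if "0 \<le> j" "j + 1 \<le> int n" for j
  proof (cases "j = 0")
    case True
    then show ?thesis using glat_1_bounds glat_minus [OF n, of 1] by simp
  next
    case False
    then show ?thesis
      using that glat_increment(1) [OF n, of j] glat_increment(1) [OF n, of "j - 1"]
        glat_increment_antimono [OF n, of 0 j] glat_increment_antimono [OF n, of 0 "j - 1"]
      by (simp add: glat_0 [OF n])
  qed
  show "step n \<le> glat n (j + 1) - glat n (j - 1)" "glat n (j + 1) - glat n (j - 1) \<le> 2 * glat n 1"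
  proof (atomize (full), cases "0 \<le> j")
    case True
    then show "step n \<le> glat n (j + 1) - glat n (j - 1) \<and> glat n (j + 1) - glat n (j - 1) \<le> 2 * glat n 1"
      using * assms by simp
  next
    case False
    have "glat n (j + 1) - glat n (j - 1) = glat n (- j + 1) - glat n (- j - 1)"
    proof -
      have "- j + 1 = - (j - 1)" "- j - 1 = - (j + 1)" by simp_all
      then show ?thesis by (simp only: glat_minus [OF n])
    qed
    then show "step n \<le> glat n (j + 1) - glat n (j - 1) \<and> glat n (j + 1) - glat n (j - 1) \<le> 2 * glat n 1"
      using * [of "- j"] False assms by simp
  qed
qed

lemma glon_cos_nonneg:
  assumes "i < n"
  shows "0 \<le> 1 - cos (glon n (i + 1) - glon n i)"
  by simp

text \<open>Separates the difference of latitudes from that of longitudes, the latter weighted by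
  the size of the parallels.\<close>

lemma diag_inner_eq:
  "diag_inner n i m = cos (glat n (m + 1) - glat n m)
     - cos (glat n m) * cos (glat n (m + 1)) * (1 - cos (glon n (i + 1) - glon n i))"
  unfolding diag_inner_def cos_diff [of "glat n (m + 1)" "glat n m"] by (simp only: algebra_simps)

text \<open>Between two meridians the shortest diagonal is the one on the equal side, because away
  from the equator both the increments of latitude and the parallels shrink. Its arc is exactly one
  step.\<close>

lemma diag_inner_le:
  assumes "0 \<le> m" "m \<le> int i" "i < n"
  shows "diag_inner n i m \<le> cos (step n)"
proof -
  have "diag_inner n i m \<le> diag_inner n i (int i)"
  proof -
    have "cos (glat n (m + 1) - glat n m) \<le> cos (glat n (int i + 1) - glat n (int i))"
    proof (rule cos_monotone_0_pi_le)
      show "0 \<le> glat n (int i + 1) - glat n (int i)"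
        using glat_increment(1) [OF n, of "int i"] assms step_pos [OF n] by simp
      show "glat n (int i + 1) - glat n (int i) \<le> glat n (m + 1) - glat n m"
        using assms by (intro glat_increment_antimono [OF n]) auto
      have "glat n (m + 1) - glat n m \<le> glat n 1"
        using glat_increment_antimono [OF n, of 0 m] assms by (simp add: glat_0 [OF n])
      then show "glat n (m + 1) - glat n m \<le> pi" using glat_1_bounds pi_gt_zero by linarith
    qed
    moreover have "cos (glat n (int i)) * cos (glat n (int i + 1)) \<le> cos (glat n m) * cos (glat n (m + 1))"
      using assms by (intro mult_mono cos_glat_antimono [OF n]) (auto simp: less_imp_le glat_bounds [OF n])
    then have "cos (glat n (int i)) * cos (glat n (int i + 1)) * (1 - cos (glon n (i + 1) - glon n i))
       \<le> cos (glat n m) * cos (glat n (m + 1)) * (1 - cos (glon n (i + 1) - glon n i))"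
      using glon_cos_nonneg [OF assms(3)] by (rule mult_right_mono)
    ultimately show ?thesis unfolding diag_inner_eq by linarith
  qed
  also have "diag_inner n i (int i) = gp n i (int i) \<bullet> gp n (i + 1) (int i + 1)"
    by (simp add: diag_inner_def gp_def inner_pt cos_diff mult.commute)
  also have "\<dots> = cos (step n)" by (rule inner_gp_side [OF n assms(3)])
  finally show ?thesis .
qed

text \<open>To first order in u the claim reads x \<le> 3/2 u, which explains the constant; the
  exact difference of the squares is \<open>u\<^sup>2 * (5 - 9 * u) / 4\<close>.\<close>

lemma cos_double_le_aux:
  fixes c x :: real
  assumes "0 \<le> c" "c\<^sup>2 = 1 - u" "0 \<le> u" "u \<le> 1 / 2" "x \<le> 3 / 2 * u"
  shows "2 * c\<^sup>2 - 1 \<le> c * (1 - x)"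
proof -
  have "(1 - 2 * u)\<^sup>2 \<le> (c * (1 - 3 / 2 * u))\<^sup>2"
  proof -
    have "(c * (1 - 3 / 2 * u))\<^sup>2 - (1 - 2 * u)\<^sup>2 = u\<^sup>2 * (5 - 9 * u) / 4"
      unfolding power_mult_distrib assms(2) by (simp add: power2_eq_square field_simps)
    moreover have "0 \<le> u\<^sup>2 * (5 - 9 * u) / 4" using assms by simp
    ultimately show ?thesis by linarith
  qed
  then have "1 - 2 * u \<le> c * (1 - 3 / 2 * u)"
    by (rule power2_le_imp_le) (use assms in \<open>intro mult_nonneg_nonneg; simp\<close>)
  also have "\<dots> \<le> c * (1 - x)" using assms by (intro mult_left_mono) auto
  finally show ?thesis by (simp add: assms(2))
qed

lemma step_bound: "step n < 66 / 100"
  using step_le [OF n] side_bound by linarith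

text \<open>The quartic bound for \<open>cos (2 * h)\<close> gives the factor 1 - h^2 / 3, and h^2 <
  0.4356 makes it larger than 0.854.\<close>

lemma sin_step_sq: "(step n)\<^sup>2 * (854 / 1000) \<le> (sin (step n))\<^sup>2"
proof -
  define h where "h = step n"
  have h: "0 < h" "h < 66 / 100" using step_pos [OF n] step_bound by (simp_all add: h_def)
  have "cos (2 * h) \<le> 1 - (2 * h)\<^sup>2 / 2 + (2 * h) ^ 4 / 24" using h by (intro cos_le_quartic) simp
  moreover have "cos (2 * h) = 1 - 2 * (sin h)\<^sup>2" by (rule cos_double_sin)
  ultimately have "h\<^sup>2 - h ^ 4 / 3 \<le> (sin h)\<^sup>2" by (simp add: power_mult_distrib)
  moreover have "h\<^sup>2 \<le> (66 / 100)\<^sup>2" using h by (intro power_mono) auto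
  then have "h\<^sup>2 * h\<^sup>2 \<le> h\<^sup>2 * (66 / 100)\<^sup>2" by (intro mult_left_mono) simp_all
  then have "h ^ 4 \<le> h\<^sup>2 * (4356 / 10000)" by (simp add: power2_eq_square eval_nat_numeral)
  ultimately show ?thesis unfolding h_def [symmetric] using zero_le_power2 [of h] by linarith
qed

text \<open>The diagonal is at most the hypotenuse of a right-angled triangle with legs
  \<open>glat n 1\<close> and \<open>\<delta>\<close>, whose cosine is
  \<open>c * cos \<delta>\<close>. This hypotenuse is at most \<open>2 * glat n 1\<close>, because
  \<open>\<delta>\<^sup>2 / 2\<close> is at most 0.43 h^2 while 3/2 u is at least 0.44 h^2.\<close>

lemma diag_inner_ge:
  assumes "0 \<le> m" "m \<le> int i" "i < n"
  shows "cos (2 * glat n 1) \<le> diag_inner n i m"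
proof -
  define \<delta> where "\<delta> = glon n (i + 1) - glon n i"
  define c where "c = cos (glat n 1)"
  define h where "h = step n"
  have c: "0 < c" "c \<le> 1" by (simp_all add: c_def glat_bounds [OF n])
  have \<delta>: "0 \<le> \<delta>" "\<delta> \<le> 3 / (4 * c36) * h"
    using glon_increment [OF n assms(3)] mult_nonneg_nonneg [OF trig_const_nonneg(2) less_imp_le [OF step_pos [OF n]]]
    unfolding \<delta>_def h_def by linarith+
  have "\<delta>\<^sup>2 \<le> (3 / (4 * c36) * h)\<^sup>2" using \<delta> by (intro power_mono)
  also have "(3 / (4 * c36) * h)\<^sup>2 = 9 / (4 * (golden + 1)) * h\<^sup>2"
  proof -
    have "(3 / (4 * c36) * h)\<^sup>2 = 9 / (16 * c36\<^sup>2) * h\<^sup>2" by (simp add: power_mult_distrib power_divide)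
    moreover have "16 * c36\<^sup>2 = 4 * (golden + 1)" by (simp add: c36_sq)
    ultimately show ?thesis by (simp only:)
  qed
  also have "\<dots> \<le> 860 / 1000 * h\<^sup>2"
    using golden_bounds by (intro mult_right_mono) (simp_all add: divide_le_eq)
  finally have \<delta>_sq: "\<delta>\<^sup>2 / 2 \<le> 430 / 1000 * h\<^sup>2" by simp
  define u where "u = (sin (glat n 1))\<^sup>2"
  have u: "u = s36\<^sup>2 * (sin h)\<^sup>2" by (simp add: u_def glat_def sin_lat power_mult_distrib h_def)
  have "34 / 100 * (h\<^sup>2 * (854 / 1000)) \<le> s36\<^sup>2 * (sin h)\<^sup>2"
    using sin_step_sq golden_bounds unfolding h_def s36_sq by (intro mult_mono) auto
  moreover have "345 / 1000 * (h\<^sup>2 * (854 / 1000)) \<le> s36\<^sup>2 * (sin h)\<^sup>2"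
    using sin_step_sq golden_bounds unfolding h_def s36_sq by (intro mult_mono) auto
  ultimately have "\<delta>\<^sup>2 / 2 \<le> 3 / 2 * u"
    using \<delta>_sq zero_le_power2 [of h] unfolding u by linarith
  then have \<delta>u: "1 - cos \<delta> \<le> 3 / 2 * u" using cos_ge_quadratic [of \<delta>] by linarith
  have "u \<le> 1 / 2"
  proof -
    have "(sin h)\<^sup>2 \<le> 1" by (simp add: sin_squared_eq)
    then have "u \<le> s36\<^sup>2 * 1" unfolding u by (intro mult_left_mono) auto
    then show ?thesis using golden_bounds unfolding s36_sq by simp
  qed
  then have "2 * c\<^sup>2 - 1 \<le> c * (1 - (1 - cos \<delta>))"
    using c \<delta>u by (intro cos_double_le_aux [of c u]) (simp_all add: u_def c_def cos_squared_eq)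
  then have "cos (2 * glat n 1) \<le> c * cos \<delta>" by (simp add: cos_double_cos c_def)
  also have "c * cos \<delta> = c - c * (1 - cos \<delta>)" by (simp add: algebra_simps)
  also have "\<dots> \<le> diag_inner n i m"
  proof -
    have "glat n (m + 1) - glat n m \<le> glat n 1"
      using glat_increment_antimono [OF n, of 0 m] assms by (simp add: glat_0 [OF n])
    moreover have "0 \<le> glat n (m + 1) - glat n m"
      using glat_increment(1) [OF n, of m] assms step_pos [OF n] by simp
    ultimately have "c \<le> cos (glat n (m + 1) - glat n m)"
      unfolding c_def using glat_1_bounds pi_gt_zero by (intro cos_monotone_0_pi_le) auto
    moreover have "cos (glat n m) * cos (glat n (m + 1)) \<le> 1 * c"
      unfolding c_def using assms
      by (intro mult_mono cos_glat_antimono [OF n]) (auto simp: less_imp_le glat_bounds [OF n])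
    then have "cos (glat n m) * cos (glat n (m + 1)) * (1 - cos \<delta>) \<le> 1 * c * (1 - cos \<delta>)"
      by (intro mult_right_mono) simp_all
    ultimately show ?thesis unfolding diag_inner_eq \<delta>_def by simp
  qed
  finally show ?thesis .
qed

text \<open>Here m is the smaller of the absolute values of j and k: reflection in the equator and
  the symmetry of \<open>diag_inner\<close> reduce all cases to the northern half.\<close>

lemma gp_diag_inner:
  assumes "\<bar>j\<bar> \<le> int i" "k = j + 1 \<or> k = j - 1"
  obtains m where "0 \<le> m" "m \<le> int i" "gp n i j \<bullet> gp n (i + 1) k = diag_inner n i m"
proof -
  have cos: "cos (glon n i - glon n (i + 1)) = cos (glon n (i + 1) - glon n i)"
    by (metis cos_minus minus_diff_eq)
  have eq: "gp n i j \<bullet> gp n (i + 1) k =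
     cos (glat n j) * cos (glat n k) * cos (glon n (i + 1) - glon n i) + sin (glat n j) * sin (glat n k)" for k
    by (simp only: gp_def inner_pt cos)
  define m where "m = (if 0 \<le> j then min j k else min (- j) (- k))"
  consider "0 \<le> j" "k = j + 1" | "0 < j" "k = j - 1" | "j = 0" "k = - 1" | "j < 0" "k = j + 1" | "j < 0" "k = j - 1"
    using assms(2) by linarith
  then show thesis
  proof cases
    case 1
    then show thesis using assms by (intro that [of j]) (simp_all add: eq diag_inner_def del: One_nat_def)
  next
    case 2
    then show thesis using assms by (intro that [of k]) (simp_all add: eq diag_inner_def mult.commute del: One_nat_def)
  next
    case 3
    then show thesis using glat_minus [OF n, of 1] eq [of k]
      by (intro that [of 0]) (simp_all add: diag_inner_def glat_0 [OF n] del: One_nat_def)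
  next
    case 4
    then show thesis using assms glat_minus [OF n, of k] glat_minus [OF n, of j]
      by (intro that [of "- k"]) (simp_all add: eq diag_inner_def mult.commute del: One_nat_def)
  next
    case 5
    then show thesis using assms glat_minus [OF n, of k] glat_minus [OF n, of j]
      by (intro that [of "- j"]) (simp_all add: eq diag_inner_def mult.commute del: One_nat_def)
  qed
qed

lemma gp_vertical_inner: "gp n i j \<bullet> gp n i k = cos (glat n k - glat n j)"
  by (simp add: gp_def inner_pt cos_diff mult.commute)

lemma norm_gp: "norm (gp n i j) = 1"
  by (simp add: gp_def norm_pt)

lemma edge_pairs_inner:
  assumes "(p, q) \<in> edge_pairs n"
  shows "cos (2 * glat n 1) \<le> p \<bullet> q" "p \<bullet> q \<le> cos (step n)" "norm p = 1" "norm q = 1"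
proof -
  have "cos (2 * glat n 1) \<le> p \<bullet> q \<and> p \<bullet> q \<le> cos (step n) \<and> norm p = 1 \<and> norm q = 1"
    using assms unfolding edge_pairs_def
  proof (elim UnE)
    assume "(p, q) \<in> {(gp n i (j - 1), gp n i (j + 1)) |i j. kitrick_index n i (j - 1) \<and> kitrick_index n i (j + 1)}"
    then obtain i j where ij: "kitrick_index n i (j - 1)" "kitrick_index n i (j + 1)" "p = gp n i (j - 1)" "q = gp n i (j + 1)"
      by blast
    define x where "x = glat n (j + 1) - glat n (j - 1)"
    have x: "step n \<le> x" "x \<le> 2 * glat n 1"
      using glat_double_increment [of j] ij(1,2) by (auto simp: kitrick_index_def x_def)
    have "cos (2 * glat n 1) \<le> cos x" "cos x \<le> cos (step n)"
      using x glat_1_bounds step_pos [OF n] by (auto intro!: cos_monotone_0_pi_le)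
    then show ?thesis by (simp add: ij(3,4) gp_vertical_inner x_def norm_gp)
  next
    assume "(p, q) \<in> {(gp n i j, gp n (i + 1) (j + 1)) |i j. kitrick_index n i j \<and> i < n}"
    then obtain i j where ij: "\<bar>j\<bar> \<le> int i" "i < n" "p = gp n i j" "q = gp n (i + 1) (j + 1)"
      by (auto simp: kitrick_index_def)
    then show ?thesis
      using gp_diag_inner [OF ij(1), of "j + 1"] diag_inner_le [OF _ _ ij(2)] diag_inner_ge [OF _ _ ij(2)]
      by (metis norm_gp)
  next
    assume "(p, q) \<in> {(gp n i j, gp n (i + 1) (j - 1)) |i j. kitrick_index n i j \<and> i < n}"
    then obtain i j where ij: "\<bar>j\<bar> \<le> int i" "i < n" "p = gp n i j" "q = gp n (i + 1) (j - 1)"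
      by (auto simp: kitrick_index_def)
    then show ?thesis
      using gp_diag_inner [OF ij(1), of "j - 1"] diag_inner_le [OF _ _ ij(2)] diag_inner_ge [OF _ _ ij(2)]
      by (metis norm_gp)
  qed
  then show "cos (2 * glat n 1) \<le> p \<bullet> q" "p \<bullet> q \<le> cos (step n)" "norm p = 1" "norm q = 1" by auto
qed

lemma dist_unit_cos:
  assumes "norm x = 1" "norm y = 1" "x \<bullet> y = cos (2 * t)" "0 \<le> t" "t \<le> pi"
  shows "dist x y = 2 * sin t"
proof -
  have "2 - 2 * (x \<bullet> y) = (2 * sin t)\<^sup>2" unfolding assms(3) cos_double_sin by (simp add: power_mult_distrib)
  then have "dist x y = sqrt ((2 * sin t)\<^sup>2)" by (simp only: dist_unit [OF assms(1,2)])
  then show ?thesis using sin_ge_zero [OF assms(4,5)] by (simp only: real_sqrt_abs)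
qed

lemma apex_lengths:
  "dist (gp n 0 0) (gp n 1 1) = 2 * sin (step n / 2)"
  "dist (gp n 0 0) (gp n 1 (- 1)) = 2 * sin (step n / 2)"
  "dist (gp n 1 1) (gp n 1 (- 1)) = 2 * s36 * sin (step n)"
proof -
  have h: "0 \<le> step n / 2" "step n / 2 \<le> pi" using step_pos [OF n] step_bound pi_gt3 by linarith+
  have "gp n 0 0 \<bullet> gp n 1 1 = cos (step n)" using inner_gp_side [OF n, of 0] n by simp
  then show "dist (gp n 0 0) (gp n 1 1) = 2 * sin (step n / 2)"
    using h by (intro dist_unit_cos) (simp_all add: norm_gp)
  moreover have "gp n 0 0 \<bullet> gp n 1 (- 1) = gp n 0 0 \<bullet> gp n 1 1"
    using glat_minus [OF n, of 1] by (simp add: gp_def inner_pt glat_0 [OF n])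
  then have "dist (gp n 0 0) (gp n 1 (- 1)) = dist (gp n 0 0) (gp n 1 1)"
    by (simp add: dist_unit norm_gp)
  ultimately show "dist (gp n 0 0) (gp n 1 (- 1)) = 2 * sin (step n / 2)" by simp
  have "gp n 1 1 \<bullet> gp n 1 (- 1) = cos (2 * glat n 1)"
  proof -
    have "glat n (- 1) - glat n 1 = - (2 * glat n 1)" using glat_minus [OF n, of 1] by simp
    then show ?thesis by (simp only: gp_vertical_inner cos_minus)
  qed
  then have "dist (gp n 1 1) (gp n 1 (- 1)) = 2 * sin (glat n 1)"
    using glat_1_bounds pi_gt_zero by (intro dist_unit_cos) (simp_all add: norm_gp)
  then show "dist (gp n 1 1) (gp n 1 (- 1)) = 2 * s36 * sin (step n)" by (simp add: glat_def sin_lat)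
qed

lemma edge_pairs_dist:
  assumes "(p, q) \<in> edge_pairs n"
  shows "dist (gp n 0 0) (gp n 1 1) \<le> dist p q" "dist p q \<le> dist (gp n 1 1) (gp n 1 (- 1))"
proof -
  note e = edge_pairs_inner [OF assms]
  have 1: "gp n 0 0 \<bullet> gp n 1 1 = cos (step n)" using inner_gp_side [OF n, of 0] n by simp
  have "glat n (- 1) - glat n 1 = - (2 * glat n 1)" using glat_minus [OF n, of 1] by simp
  then have 2: "gp n 1 1 \<bullet> gp n 1 (- 1) = cos (2 * glat n 1)" by (simp only: gp_vertical_inner cos_minus)
  show "dist (gp n 0 0) (gp n 1 1) \<le> dist p q" "dist p q \<le> dist (gp n 1 1) (gp n 1 (- 1))"
    using e by (simp_all add: dist_unit norm_gp 1 2 del: One_nat_def)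
qed

end

section \<open>Supporting planes of the faces\<close>

text \<open>The vertices on the i-th and the (i + 1)-th meridian, in zigzag order; three consecutive ones form a face.\<close>

definition zz :: "nat \<Rightarrow> nat \<Rightarrow> int \<Rightarrow> real^3" where
  "zz n i j = gp n (if even (j - int i) then i else i + 1) j"

text \<open>Indexed by the middle vertex \<open>zz n i j\<close>, which is alone on its meridian;
  the j with \<bar>j\<bar> \<le> i give the 2 i + 1 triangles of the strip.\<close>

definition face_vertices :: "nat \<Rightarrow> nat \<Rightarrow> int \<Rightarrow> (real^3) set" where
  "face_vertices n i j = {zz n i (j - 1), zz n i j, zz n i (j + 1)}"

definition face :: "nat \<Rightarrow> nat \<Rightarrow> int \<Rightarrow> (real^3) set" where
  "face n i j = convex hull face_vertices n i j"

lemma zz_even: "even (j - int i) \<Longrightarrow> zz n i j = gp n i j"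
  and zz_odd: "odd (j - int i) \<Longrightarrow> zz n i j = gp n (i + 1) j"
  by (simp_all add: zz_def)

lemma zz_neighbours:
  "even (j - int i) \<Longrightarrow> zz n i (j - 1) = gp n (i + 1) (j - 1)" "even (j - int i) \<Longrightarrow> zz n i (j + 1) = gp n (i + 1) (j + 1)"
  "odd (j - int i) \<Longrightarrow> zz n i (j - 1) = gp n i (j - 1)" "odd (j - int i) \<Longrightarrow> zz n i (j + 1) = gp n i (j + 1)"
  by (simp_all add: zz_def)

lemma odd_bound: "odd (j - int i) \<Longrightarrow> \<bar>j\<bar> \<le> int i \<Longrightarrow> \<bar>j - 1\<bar> \<le> int i \<and> \<bar>j + 1\<bar> \<le> int i"
  by presburger

lemma face_edges:
  assumes "i < n" "\<bar>j\<bar> \<le> int i"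
  shows "(zz n i j, zz n i (j + 1)) \<in> edge_pairs n \<or> (zz n i (j + 1), zz n i j) \<in> edge_pairs n"
    "(zz n i j, zz n i (j - 1)) \<in> edge_pairs n \<or> (zz n i (j - 1), zz n i j) \<in> edge_pairs n"
    "(zz n i (j - 1), zz n i (j + 1)) \<in> edge_pairs n"
proof -
  have "((zz n i j, zz n i (j + 1)) \<in> edge_pairs n \<or> (zz n i (j + 1), zz n i j) \<in> edge_pairs n) \<and>
    ((zz n i j, zz n i (j - 1)) \<in> edge_pairs n \<or> (zz n i (j - 1), zz n i j) \<in> edge_pairs n) \<and>
    (zz n i (j - 1), zz n i (j + 1)) \<in> edge_pairs n"
  proof (cases "even (j - int i)")
    case True
    have "kitrick_index n i j" "kitrick_index n (i + 1) (j - 1)" "kitrick_index n (i + 1) (j + 1)"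
      using assms True by (auto simp: kitrick_index_def)
    then show ?thesis using assms(1)
      unfolding zz_even [OF True] zz_neighbours(1,2) [OF True] edge_pairs_def by blast
  next
    case False
    have *: "kitrick_index n (i + 1) j" "kitrick_index n i (j - 1)" "kitrick_index n i (j + 1)"
      using assms False odd_bound [OF False assms(2)] by (auto simp: kitrick_index_def)
    have "(gp n i (j - 1), gp n (i + 1) (j - 1 + 1)) \<in> edge_pairs n"
      using * assms(1) unfolding edge_pairs_def by blast
    moreover have "(gp n i (j + 1), gp n (i + 1) (j + 1 - 1)) \<in> edge_pairs n"
      using * assms(1) unfolding edge_pairs_def by blast
    moreover have "(gp n i (j - 1), gp n i (j + 1)) \<in> edge_pairs n"
      using * unfolding edge_pairs_def by blast
    ultimately show ?thesis
      unfolding zz_odd [OF False] zz_neighbours(3,4) [OF False] by simp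
  qed
  then show "(zz n i j, zz n i (j + 1)) \<in> edge_pairs n \<or> (zz n i (j + 1), zz n i j) \<in> edge_pairs n"
    "(zz n i j, zz n i (j - 1)) \<in> edge_pairs n \<or> (zz n i (j - 1), zz n i j) \<in> edge_pairs n"
    "(zz n i (j - 1), zz n i (j + 1)) \<in> edge_pairs n" by auto
qed

text \<open>The weights are, up to a common factor, the barycentric coordinates of the circumcentre, which lies
  inside the triangle since the triangle is acute.\<close>

lemma circumnormal:
  fixes p q r :: "'a::real_inner"
  assumes unit: "norm p = 1" "norm q = 1" "norm r = 1"
    and bounds: "\<And>x. x \<in> {q \<bullet> r, r \<bullet> p, p \<bullet> q} \<Longrightarrow> m \<le> x \<and> x \<le> M" and "0 < m" "M < 1" "1 - m < 2 * (1 - M)"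
  obtains \<nu> d a b c where "0 < a" "0 < b" "0 < c" "\<nu> = a *\<^sub>R p + b *\<^sub>R q + c *\<^sub>R r"
    "0 < d" "\<nu> \<bullet> p = d" "\<nu> \<bullet> q = d" "\<nu> \<bullet> r = d"
proof -
  define A B C where "A = q \<bullet> r" and "B = r \<bullet> p" and "C = p \<bullet> q"
  have ABC: "m \<le> A" "A \<le> M" "m \<le> B" "B \<le> M" "m \<le> C" "C \<le> M"
    using bounds by (auto simp: A_def B_def C_def)
  have inner: "q \<bullet> r = A" "r \<bullet> q = A" "r \<bullet> p = B" "p \<bullet> r = B" "p \<bullet> q = C" "q \<bullet> p = C"
    by (simp_all add: A_def B_def C_def inner_commute)
  have one: "p \<bullet> p = 1" "q \<bullet> q = 1" "r \<bullet> r = 1" using unit by (simp_all add: norm_eq_1)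
  \<comment> \<open>The row sums of the adjugate of the Gram matrix, of which \<open>d\<close> below
    is the determinant. Positivity of the second factors is where the squared edge lengths must
    agree up to a factor less than 2.\<close>
  define a b c where "a = (1 - A) * (1 + A - B - C)" and "b = (1 - B) * (1 + B - C - A)" and "c = (1 - C) * (1 + C - A - B)"
  have "0 < 1 - x" if "x \<le> M" for x using that assms(6) by linarith
  moreover have "0 < 1 + x - y - z" if "m \<le> x" "y \<le> M" "z \<le> M" for x y z
    using that assms(7) by argo
  ultimately have "0 < 1 - A" "0 < 1 + A - B - C" "0 < 1 - B" "0 < 1 + B - C - A" "0 < 1 - C" "0 < 1 + C - A - B"
    using ABC by blast+
  then have pos: "0 < a" "0 < b" "0 < c" by (simp_all add: a_def b_def c_def)
  define \<nu> where "\<nu> = a *\<^sub>R p + b *\<^sub>R q + c *\<^sub>R r"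
  define d where "d = 1 + 2 * A * B * C - A\<^sup>2 - B\<^sup>2 - C\<^sup>2"
  have d: "\<nu> \<bullet> p = d" "\<nu> \<bullet> q = d" "\<nu> \<bullet> r = d"
    by (simp_all add: \<nu>_def inner_add_left inner one a_def b_def c_def d_def power2_eq_square algebra_simps)
  moreover have "0 < d"
  proof -
    have "\<nu> \<bullet> p = a + b * C + c * B" by (simp add: \<nu>_def inner_add_left inner one)
    moreover have "0 < a + b * C + c * B" using pos ABC \<open>0 < m\<close> by (intro add_pos_pos mult_pos_pos) auto
    ultimately show ?thesis using d(1) by simp
  qed
  ultimately show thesis using that [OF pos \<nu>_def] by blast
qed

lemma cos_less_abs:
  assumes "\<bar>x\<bar> < \<bar>y\<bar>" "\<bar>y\<bar> \<le> pi"
  shows "cos y < cos x"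
  using cos_monotone_0_pi [of "\<bar>x\<bar>" "\<bar>y\<bar>"] assms by simp

text \<open>Serves the one comparison in \<open>local_delaunay\<close> where the longitude steps
  vary the wrong way: \<open>\<delta>\<close> and \<open>\<delta>'\<close> are successive steps and
  t is the offset of the centre of the circle. The geometry yields the opposite inequality there,
  which refutes the assumption on t.\<close>

lemma strip_estimate:
  fixes h t \<delta> \<delta>' :: real
  assumes h: "0 < h" "h < 66 / 100"
    and \<delta>: "c36 * h \<le> \<delta>" "\<delta> \<le> 3 / (4 * c36) * h" and \<delta>': "c36 * h \<le> \<delta>'"
    and t: "0 < t" "2 * t \<le> \<delta> - \<delta>'"
  shows "s36\<^sup>2 * h\<^sup>2 / 2 < (1 - cos \<delta> - sin \<delta> * tan t) * (4 * c36\<^sup>2 / 3)"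
proof -
  have c: "8090 / 10000 < c36" "c36 < 80902 / 100000" unfolding c36_eq using golden_bounds by simp_all
  have K: "3 / (4 * c36) \<le> 9271 / 10000" using c by (simp add: divide_le_eq)
  have "3 / (4 * c36) * h \<le> 9271 / 10000 * h" using K h by (intro mult_right_mono) auto
  then have \<delta>_le: "\<delta> \<le> 9271 / 10000 * h" using \<delta> by linarith
  have ch: "8090 / 10000 * h \<le> c36 * h" using c h by (intro mult_right_mono) auto
  then have \<delta>_ge: "8090 / 10000 * h \<le> \<delta>" "8090 / 10000 * h \<le> \<delta>'" using \<delta> \<delta>' by linarith+
  \<comment> \<open>0.1181 is the difference of the bounds 0.9271 and 0.8090 for the slope of
    \<open>lon\<close>.\<close>
  have t_le: "2 * t \<le> 1181 / 10000 * h" using t \<delta>_le \<delta>_ge by linarith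
  have tan: "0 \<le> tan t" "tan t \<le> 1181 / 10000 * h"
  proof -
    have "t < 1 / 2" using t_le h by linarith
    then have "t\<^sup>2 \<le> (1 / 2)\<^sup>2" using t by (intro power_mono) auto
    then have cos: "1 / 2 \<le> cos t" using cos_ge_quadratic [of t] by (simp add: power2_eq_square)
    moreover have "sin t \<le> t" using t by (intro sin_x_le_x) simp
    moreover have "0 \<le> sin t" using t \<open>t < 1 / 2\<close> pi_gt3 by (intro sin_ge_zero) auto
    ultimately show "0 \<le> tan t" by (simp add: tan_def)
    have "sin t \<le> 2 * t * cos t"
      using \<open>sin t \<le> t\<close> mult_left_mono [OF cos, of "2 * t"] t by linarith
    then have "tan t \<le> 2 * t" using cos by (simp add: tan_def divide_le_eq)
    then show "tan t \<le> 1181 / 10000 * h" using t_le by linarith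
  qed
  have "0 < \<delta>" "\<delta> < 1" using \<delta>_ge \<delta>_le h by linarith+
  have "sin \<delta> * tan t \<le> (9271 / 10000 * h) * (1181 / 10000 * h)"
  proof (rule mult_mono)
    have "sin \<delta> \<le> \<delta>" using \<open>0 < \<delta>\<close> by (intro sin_x_le_x) simp
    then show "sin \<delta> \<le> 9271 / 10000 * h" using \<delta>_le by linarith
  qed (use tan h in auto)
  also have "\<dots> = 10949051 / 100000000 * h\<^sup>2" by (simp add: power2_eq_square)
  finally have 1: "sin \<delta> * tan t \<le> 1095 / 10000 * h\<^sup>2" using zero_le_power2 [of h] by linarith
  define y where "y = 8090 / 10000 * h"
  have y: "0 < y" "y \<le> \<delta>" "y \<le> 1" using h \<delta>_ge by (simp_all add: y_def)
  have "cos \<delta> \<le> cos y" using y \<open>\<delta> < 1\<close> pi_gt3 by (intro cos_monotone_0_pi_le) auto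
  also have "cos y \<le> 1 - y\<^sup>2 / 2 + y ^ 4 / 24" using y by (intro cos_le_quartic) simp
  finally have 2: "y\<^sup>2 / 2 - y ^ 4 / 24 \<le> 1 - cos \<delta>" by linarith
  have "y\<^sup>2 \<le> 286 / 1000"
  proof -
    have "y \<le> 534 / 1000" using h by (simp add: y_def)
    then have "y\<^sup>2 \<le> (534 / 1000)\<^sup>2" using y by (intro power_mono) auto
    then show ?thesis by (simp add: power2_eq_square)
  qed
  then have "y\<^sup>2 * y\<^sup>2 \<le> y\<^sup>2 * (286 / 1000)" by (intro mult_left_mono) simp_all
  then have "y ^ 4 \<le> y\<^sup>2 * (286 / 1000)" by (simp flip: power_add)
  then have "488 / 1000 * y\<^sup>2 \<le> 1 - cos \<delta>" using 2 zero_le_power2 [of y] by linarith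
  moreover have "y\<^sup>2 = 65448100 / 100000000 * h\<^sup>2" by (simp add: y_def power2_eq_square)
  ultimately have "3193 / 10000 * h\<^sup>2 \<le> 1 - cos \<delta>" using zero_le_power2 [of h] by linarith
  \<comment> \<open>The margin of the estimate: 0.2098 * 0.8726 is about 0.183, while s36^2 / 2 is
    at most 0.1728.\<close>
  then have 3: "2098 / 10000 * h\<^sup>2 \<le> 1 - cos \<delta> - sin \<delta> * tan t" using 1 by linarith
  have "4 * c36\<^sup>2 / 3 = (golden + 1) / 3" by (simp add: c36_sq)
  then have 4: "8726 / 10000 \<le> 4 * c36\<^sup>2 / 3" using golden_bounds by simp
  have "0 < h\<^sup>2" using h by simp
  have "s36\<^sup>2 / 2 \<le> 1728 / 10000" unfolding s36_sq using golden_bounds by simp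
  then have "s36\<^sup>2 / 2 * h\<^sup>2 \<le> 1728 / 10000 * h\<^sup>2" by (intro mult_right_mono) auto
  also have "\<dots> < (2098 / 10000 * h\<^sup>2) * (8726 / 10000)" using \<open>0 < h\<^sup>2\<close> by simp
  also have "\<dots> \<le> (1 - cos \<delta> - sin \<delta> * tan t) * (4 * c36\<^sup>2 / 3)"
  proof (rule mult_mono [OF 3 4])
    show "0 \<le> 1 - cos \<delta> - sin \<delta> * tan t" using 3 \<open>0 < h\<^sup>2\<close> by linarith
  qed simp
  finally show ?thesis by simp
qed

lemma inner_pt_general:
  "v \<bullet> pt l m = cos m * ((v \<bullet> c0) * cos l + (v \<bullet> axis2) * sin l) + (v \<bullet> root2) * sin m"
  by (simp add: pt_def frame_pt_def inner_add_right algebra_simps)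

lemma pt_inner_axes: "pt l m \<bullet> c0 = cos m * cos l" "pt l m \<bullet> axis2 = cos m * sin l" "pt l m \<bullet> root2 = sin m"
  using axes_orthonormal by (simp_all add: pt_def frame_pt_def inner_add_left inner_add_right inner_commute)

text \<open>On a circle of the sphere, the points of one meridian are an arc of latitudes, whose midpoint is p.\<close>

lemma meridian_circle:
  assumes eq: "C * cos y + D * sin y = d" "C * cos x + D * sin x = d"
    and xy: "- (pi / 2) < x" "x < y" "y < pi / 2" and C: "0 < C"
  shows "\<lbrakk>x < z; z < y\<rbrakk> \<Longrightarrow> d < C * cos z + D * sin z"
    and "\<lbrakk>- (pi / 2) < z; z < pi / 2; z < x \<or> y < z\<rbrakk> \<Longrightarrow> C * cos z + D * sin z < d"
    and "cos ((x + y) / 2) * D = C * sin ((x + y) / 2)"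
    and "cos ((x + y) / 2) * d = C * cos ((y - x) / 2)"
proof -
  define p b where "p = (x + y) / 2" and "b = (y - x) / 2"
  have y: "y = p + b" and x: "x = p - b" by (simp_all add: p_def b_def field_simps)
  have b: "0 < b" "b < pi / 2" using xy by (simp_all add: b_def)
  have p: "0 < cos p" using xy by (intro cos_gt_zero_pi) (simp_all add: p_def)
  \<comment> \<open>Subtracting the two equations eliminates d and gives tan p = D / C.\<close>
  have "2 * (sin b * (D * cos p) - sin b * (C * sin p)) = (C * cos y + D * sin y) - (C * cos x + D * sin x)"
    unfolding y x cos_add cos_diff sin_add sin_diff by (simp add: algebra_simps)
  then have "sin b * (C * sin p) = sin b * (D * cos p)" using eq by argo
  moreover have "sin b \<noteq> 0" using sin_gt_zero [of b] b by simp
  ultimately have D: "cos p * D = C * sin p" by simp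
  then show "cos ((x + y) / 2) * D = C * sin ((x + y) / 2)" by (simp only: p_def)
  \<comment> \<open>Along the meridian the functional is a multiple of a cosine centred at p, so
    comparing it with d means comparing distances from p.\<close>
  have val: "cos p * (C * cos z + D * sin z) = C * cos (z - p)" for z
  proof -
    have "cos p * (C * cos z + D * sin z) = C * cos z * cos p + (cos p * D) * sin z" by (simp add: algebra_simps)
    then show ?thesis unfolding D by (simp add: cos_diff algebra_simps)
  qed
  have d: "cos p * d = C * cos b" using val [of y] eq(1) by (simp add: y)
  then show "cos ((x + y) / 2) * d = C * cos ((y - x) / 2)" by (simp only: p_def b_def)
  show "d < C * cos z + D * sin z" if "x < z" "z < y"
  proof -
    have "\<bar>z - p\<bar> < \<bar>b\<bar>" using that b by (simp add: p_def b_def abs_if field_simps)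
    then have "cos b < cos (z - p)" using b by (intro cos_less_abs) auto
    then have "cos p * d < cos p * (C * cos z + D * sin z)" unfolding d val using C by simp
    then show ?thesis using p by simp
  qed
  show "C * cos z + D * sin z < d" if "- (pi / 2) < z" "z < pi / 2" "z < x \<or> y < z"
  proof -
    have "\<bar>b\<bar> < \<bar>z - p\<bar>" using that b by (auto simp: p_def b_def abs_if field_simps)
    moreover have "\<bar>z - p\<bar> \<le> pi" using that(1,2) xy by (simp add: p_def abs_if field_simps)
    ultimately have "cos (z - p) < cos b" by (intro cos_less_abs)
    then have "cos p * (C * cos z + D * sin z) < cos p * d" unfolding d val using C by simp
    then show ?thesis using p by simp
  qed
qed

lemma glat_abs_le:
  assumes "0 < n" "\<bar>j\<bar> \<le> int n"
  shows "\<bar>glat n j\<bar> \<le> lat side"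
proof -
  have j: "- int n \<le> j" "j \<le> int n" using assms(2) by auto
  have "glat n (int n) = lat side" using step_mult [OF assms(1)] by (simp add: glat_def)
  moreover have "glat n j \<le> glat n (int n)"
    using glat_less [OF assms(1), of j "int n"] j by (cases "j = int n") auto
  moreover have "glat n (- int n) \<le> glat n j"
    using glat_less [OF assms(1), of "- int n" j] j by (cases "j = - int n") auto
  ultimately show ?thesis using glat_minus [OF assms(1), of "int n"] by (simp add: abs_le_iff)
qed

lemma cos_ge_abs:
  assumes "\<bar>x\<bar> \<le> \<bar>y\<bar>" "\<bar>y\<bar> \<le> pi"
  shows "cos y \<le> cos x"
  using cos_monotone_0_pi_le [of "\<bar>x\<bar>" "\<bar>y\<bar>"] assms by simp

text \<open>The plane through the three vertices cuts the sphere in a circle that meets each meridian and each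
  parallel in an arc. The nearer a meridian is to the centre of the circle, the larger is its arc; so only
  the arcs of the two meridians and of the three parallels of the face need to be considered.\<close>

lemma local_delaunay:
  fixes n i :: nat and j :: int and \<nu> :: "real^3" and d a b c :: real
  assumes ij: "i < n" "\<bar>j\<bar> \<le> int i"
    and abc: "0 < a" "0 < b" "0 < c"
    and nu: "\<nu> = a *\<^sub>R zz n i (j - 1) + b *\<^sub>R zz n i j + c *\<^sub>R zz n i (j + 1)"
    and nu_d: "\<nu> \<bullet> zz n i (j - 1) = d" "\<nu> \<bullet> zz n i j = d" "\<nu> \<bullet> zz n i (j + 1) = d"
    and kl: "kitrick_index n k l"
  shows "\<nu> \<bullet> gp n k l < d \<or> gp n k l \<in> face_vertices n i j"
proof -
  have n: "0 < n" using ij by simp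
  \<comment> \<open>The coordinates of \<nu> in the frame. On the meridian k the functional is
    \<open>C k * cos m + D * sin m\<close> in the latitude m, where the coefficient
    \<open>C k\<close> alone depends on the meridian.\<close>
  define X where "X = \<nu> \<bullet> c0"
  define Y where "Y = \<nu> \<bullet> axis2"
  define D where "D = \<nu> \<bullet> root2"
  define C where "C k = X * cos (glon n k) + Y * sin (glon n k)" for k
  \<comment> \<open>\<open>out\<close> is the meridian of the middle vertex, \<open>inn\<close> that
    of the two others.\<close>
  define out where "out = (if even (j - int i) then i else i + 1)"
  define inn where "inn = (if even (j - int i) then i + 1 else i)"
  have val: "\<nu> \<bullet> gp n k l = cos (glat n l) * C k + D * sin (glat n l)" for k l
    by (simp add: gp_def inner_pt_general C_def X_def Y_def D_def)
  have zz: "zz n i j = gp n out j" "zz n i (j - 1) = gp n inn (j - 1)" "zz n i (j + 1) = gp n inn (j + 1)"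
    by (simp_all add: zz_def out_def inn_def)
  have cols: "out \<in> {i, i + 1}" "inn \<in> {i, i + 1}" "out \<noteq> inn" "out \<le> n" "inn \<le> n"
    using ij by (auto simp: out_def inn_def)
  have eqs: "cos (glat n (j - 1)) * C inn + D * sin (glat n (j - 1)) = d"
    "cos (glat n j) * C out + D * sin (glat n j) = d"
    "cos (glat n (j + 1)) * C inn + D * sin (glat n (j + 1)) = d"
    using nu_d unfolding zz val by simp_all
  have cos_pos: "0 < cos (glat n l)" for l by (rule glat_bounds [OF n])
  have lon: "0 \<le> glon n k" "glon n k < pi / 2" if "k \<le> n" for k using glon_bounds [OF n that] by auto
  have l12: "glon n i < glon n (i + 1)" using ij by (intro glon_less [OF n]) auto
  have XY: "X = a * (cos (glat n (j - 1)) * cos (glon n inn)) + b * (cos (glat n j) * cos (glon n out)) +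
        c * (cos (glat n (j + 1)) * cos (glon n inn))"
      "Y = a * (cos (glat n (j - 1)) * sin (glon n inn)) + b * (cos (glat n j) * sin (glon n out)) +
        c * (cos (glat n (j + 1)) * sin (glon n inn))"
    by (simp_all add: X_def Y_def nu zz gp_def inner_add_left pt_inner_axes)
  have cos_lon: "0 < cos (glon n k)" if "k \<le> n" for k
    using lon [OF that] by (intro cos_gt_zero_pi) auto
  have "0 < X"
    unfolding XY by (intro add_pos_pos mult_pos_pos abc cos_pos cos_lon cols(4,5))
  \<comment> \<open>The longitude of \<nu>. As \<open>C k = R * cos (glon n k - s)\<close>,
    meridians nearer to s have larger coefficients.\<close>
  define s where "s = arctan (Y / X)"
  define R where "R = X / cos s"
  have s: "- (pi / 2) < s" "s < pi / 2" "0 < cos s"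
    unfolding s_def using arctan_bounded by (simp_all add: cos_gt_zero_pi)
  have R: "0 < R" "X = R * cos s" using \<open>0 < X\<close> s(3) by (simp_all add: R_def)
  have "tan s = Y / X" by (simp add: s_def tan_arctan)
  then have Y: "Y = R * sin s" using s(3) \<open>0 < X\<close> by (simp add: R_def tan_def field_simps)
  have C: "C k = R * cos (glon n k - s)" for k
    by (simp add: C_def R(2) Y cos_diff algebra_simps)
  have diff: "R * sin (s - t) = a * (cos (glat n (j - 1)) * sin (glon n inn - t)) + b * (cos (glat n j) * sin (glon n out - t)) +
        c * (cos (glat n (j + 1)) * sin (glon n inn - t))" for t
  proof -
    have "R * sin (s - t) = Y * cos t - X * sin t" by (simp add: R(2) Y sin_diff algebra_simps)
    then show ?thesis unfolding XY by (simp add: sin_diff algebra_simps)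
  qed
  have l12_pi: "0 < glon n (i + 1) - glon n i" "glon n (i + 1) - glon n i < pi"
    using l12 lon [of i] lon [of "i + 1"] ij pi_gt_zero by (auto simp: field_simps)
  then have sin12: "0 < sin (glon n (i + 1) - glon n i)" by (rule sin_gt_zero)
  then have sin21: "sin (glon n i - glon n (i + 1)) < 0" by (metis minus_diff_eq neg_less_0_iff_less sin_minus)
  \<comment> \<open>A positive combination of points on two meridians less than pi apart lies
    strictly between them.\<close>
  have s_between: "glon n i < s" "s < glon n (i + 1)"
  proof -
    have "0 < R * sin (s - glon n i)"
    proof (cases "inn = i")
      case True
      then have "out = i + 1" using cols by auto
      then show ?thesis unfolding diff True using sin12 abc cos_pos by simp
    next
      case False
      then have "inn = i + 1" "out = i" using cols by auto
      then show ?thesis unfolding diff using sin12 abc cos_pos by (simp add: add_pos_pos)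
    qed
    then have pos: "0 < sin (s - glon n i)" using R by (simp add: zero_less_mult_iff)
    have "0 \<le> - sin (s - glon n i)" if "s \<le> glon n i"
      unfolding sin_minus [symmetric] using that s lon [of i] ij by (intro sin_ge_zero) auto
    then show "glon n i < s" using pos by linarith
  next
    have "R * sin (s - glon n (i + 1)) < 0"
    proof (cases "inn = i")
      case True
      then have "out = i + 1" using cols by auto
      then have "R * sin (s - glon n (i + 1)) =
          (a * cos (glat n (j - 1)) + c * cos (glat n (j + 1))) * sin (glon n i - glon n (i + 1))"
        unfolding diff True by (simp add: algebra_simps)
      moreover have "0 < a * cos (glat n (j - 1)) + c * cos (glat n (j + 1))" using abc cos_pos by (simp add: add_pos_pos)
      ultimately show ?thesis using sin21 by (simp add: mult_pos_neg)
    next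
      case False
      then have *: "inn = i + 1" "out = i" using cols by auto
      have "R * sin (s - glon n (i + 1)) = (b * cos (glat n j)) * sin (glon n i - glon n (i + 1))"
        unfolding diff * by simp
      moreover have "0 < b * cos (glat n j)" using abc cos_pos by simp
      ultimately show ?thesis using sin21 by (simp add: mult_pos_neg)
    qed
    then have "sin (s - glon n (i + 1)) < 0" using R by (simp add: mult_less_0_iff)
    moreover have "0 \<le> sin (s - glon n (i + 1))" if "glon n (i + 1) \<le> s"
      using that s lon [of "i + 1"] ij by (intro sin_ge_zero) auto
    ultimately show "s < glon n (i + 1)" by linarith
  qed
  have abs_pi: "\<bar>glon n k - s\<bar> \<le> pi" if "k \<le> n" for k using lon [OF that] s by (simp add: abs_le_iff field_simps)
  have C_less: "C k < C k'" if "\<bar>glon n k' - s\<bar> < \<bar>glon n k - s\<bar>" "k \<le> n" for k k'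
    unfolding C using cos_less_abs [OF that(1) abs_pi [OF that(2)]] R by simp
  have C_inn: "0 < C inn"
  proof -
    have "\<bar>glon n inn - s\<bar> < pi / 2" using cols s_between lon [of i] lon [of "i + 1"] ij by (auto simp: abs_less_iff)
    then have "- (pi / 2) < glon n inn - s" "glon n inn - s < pi / 2" by linarith+
    then have "0 < cos (glon n inn - s)" by (rule cos_gt_zero_pi)
    then show ?thesis unfolding C using R(1) by simp
  qed
  have j1: "- int n \<le> j - 1" "j + 1 \<le> int n" using ij by auto
  have lats: "- (pi / 2) < glat n (j - 1)" "glat n (j - 1) < glat n (j + 1)" "glat n (j + 1) < pi / 2"
    using glat_bounds [OF n] glat_less [OF n, of "j - 1" "j + 1"] j1 by auto
  have eqs': "C inn * cos (glat n (j + 1)) + D * sin (glat n (j + 1)) = d"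
    "C inn * cos (glat n (j - 1)) + D * sin (glat n (j - 1)) = d"
    using eqs by (simp_all add: mult.commute)
  note circle = meridian_circle [OF eqs' lats C_inn]
  \<comment> \<open>At the latitude of the middle vertex the meridian \<open>inn\<close> is inside
    the circle, whereas \<open>out\<close> meets the circle there.\<close>
  have C_out_inn: "C out < C inn"
  proof -
    have "d < C inn * cos (glat n j) + D * sin (glat n j)"
      using j1 by (intro circle(1) glat_less [OF n]) auto
    then have "cos (glat n j) * C out < cos (glat n j) * C inn" using eqs(2) by (simp add: mult.commute)
    then show ?thesis using cos_pos [of j] by simp
  qed
  have closer: "\<bar>glon n inn - s\<bar> < \<bar>glon n out - s\<bar>"
  proof (rule ccontr)
    assume "\<not> ?thesis"
    then have "cos (glon n inn - s) \<le> cos (glon n out - s)"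
      using abs_pi [OF cols(5)] by (intro cos_ge_abs) auto
    then have "C inn \<le> C out" unfolding C using R by simp
    then show False using C_out_inn by simp
  qed
  have l_bounds: "\<bar>l\<bar> \<le> int k" "k \<le> n" "even (l - int k)" using kl by (auto simp: kitrick_index_def)
  have outside: "C inn * cos (glat n l) + D * sin (glat n l) < d" if "l < j - 1 \<or> j + 1 < l"
    using that l_bounds j1 glat_bounds [OF n, of l] by (intro circle(2)) (auto intro!: glat_less [OF n])
  have le: "cos (glat n l) * C k + D * sin (glat n l) < d" if "C k < C inn" "l \<le> j - 1 \<or> j + 1 \<le> l"
  proof -
    have "C inn * cos (glat n l) + D * sin (glat n l) \<le> d"
      using that(2) outside eqs' by (cases "l = j - 1 \<or> l = j + 1") auto
    moreover have "cos (glat n l) * C k < cos (glat n l) * C inn" using that(1) cos_pos by simp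
    ultimately show ?thesis by (simp add: mult.commute)
  qed
  \<comment> \<open>The critical case: the middle vertex on the meridian i + 1 competes with the
    meridian i - 1, and convexity of \<open>lon\<close> does not help, as the steps of longitude
    increase towards the east.\<close>
  have strip: "glon n (i + 1) - s < s - glon n (i - 1)" if odd: "odd (j - int i)" and i: "1 \<le> i"
  proof (rule ccontr)
    assume not: "\<not> ?thesis"
    have io: "inn = i" "out = i + 1" using odd by (simp_all add: inn_def out_def)
    define \<delta> where "\<delta> = glon n (i + 1) - glon n i"
    define t where "t = s - glon n i"
    define h where "h = step n"
    define p where "p = (glat n (j - 1) + glat n (j + 1)) / 2"
    define q where "q = (glat n (j + 1) - glat n (j - 1)) / 2"
    have t: "0 < t" using s_between by (simp add: t_def)
    have est: "s36\<^sup>2 * h\<^sup>2 / 2 < (1 - cos \<delta> - sin \<delta> * tan t) * (4 * c36\<^sup>2 / 3)"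
    proof (rule strip_estimate)
      show "0 < h" "h < 66 / 100" using step_pos [OF n] step_bound [OF n] by (simp_all add: h_def)
      show "c36 * h \<le> \<delta>" "\<delta> \<le> 3 / (4 * c36) * h" using glon_increment [OF n ij(1)] by (simp_all add: \<delta>_def h_def)
      show "c36 * h \<le> glon n i - glon n (i - 1)" using glon_increment(1) [OF n, of "i - 1"] ij i by (simp add: h_def)
      show "2 * t \<le> \<delta> - (glon n i - glon n (i - 1))" using not by (simp add: t_def \<delta>_def)
    qed (rule t)
    have Ce: "C inn = R * cos t" using cos_minus [of t] by (simp add: C io t_def)
    have "cos t \<noteq> 0" using Ce C_inn by auto
    then have Co: "C out = C inn * (cos \<delta> + sin \<delta> * tan t)"
    proof -
      have "C out = R * cos (\<delta> - t)" by (simp add: C io \<delta>_def t_def)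
      then show ?thesis using \<open>cos t \<noteq> 0\<close> by (simp add: Ce cos_diff tan_def algebra_simps)
    qed
    have p: "cos p * D = C inn * sin p" "cos p * d = C inn * cos q"
      using circle(3,4) by (simp_all only: p_def q_def)
    \<comment> \<open>The middle vertex lies on the circle; multiplying its equation by
      \<open>cos p\<close> eliminates d and D.\<close>
    have "C inn * (cos p * cos (glat n j) * (cos \<delta> + sin \<delta> * tan t) + sin p * sin (glat n j)) = C inn * cos q"
    proof -
      have "cos p * d = cos p * (cos (glat n j) * C out + D * sin (glat n j))" by (simp only: eqs(2))
      also have "\<dots> = cos p * cos (glat n j) * C out + (cos p * D) * sin (glat n j)" by (simp add: algebra_simps)
      finally show ?thesis unfolding p Co by (simp add: algebra_simps)
    qed
    then have "cos p * cos (glat n j) * (cos \<delta> + sin \<delta> * tan t) + sin p * sin (glat n j) = cos q" using C_inn by simp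
    then have "cos p * cos (glat n j) * (1 - cos \<delta> - sin \<delta> * tan t) = cos (p - glat n j) - cos q"
      by (simp add: cos_diff algebra_simps)
    also have "\<dots> \<le> 1 - cos q" by simp
    also have "\<dots> \<le> q\<^sup>2 / 2" using cos_ge_quadratic [of q] by linarith
    also have "\<dots> \<le> s36\<^sup>2 * h\<^sup>2 / 2"
    proof -
      have "\<bar>j - 1\<bar> \<le> int n" "\<bar>j + 1\<bar> \<le> int n" using j1 ij by linarith+
      then have "q \<le> glat n 1" using glat_double_increment(2) [OF n, of j] by (simp add: q_def)
      then have "q \<le> s36 * h" using glat_1_bounds(2) [OF n] by (simp add: h_def)
      moreover have "0 \<le> q" using lats by (simp add: q_def)
      ultimately have "q\<^sup>2 \<le> (s36 * h)\<^sup>2" by (rule power_mono)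
      then show ?thesis by (simp add: power_mult_distrib)
    qed
    finally have upper: "cos p * cos (glat n j) * (1 - cos \<delta> - sin \<delta> * tan t) \<le> s36\<^sup>2 * h\<^sup>2 / 2" .
    have "4 * c36\<^sup>2 / 3 = cos (lat side) * cos (lat side)"
      by (simp add: cos_lat_side power2_eq_square)
    also have "\<dots> \<le> cos p * cos (glat n j)"
    proof -
      have side: "\<bar>lat side\<bar> \<le> pi" using lat_between [of side] pi_gt_zero by (simp add: abs_le_iff)
      have b: "\<bar>glat n (j - 1)\<bar> \<le> lat side" "\<bar>glat n (j + 1)\<bar> \<le> lat side" "\<bar>glat n j\<bar> \<le> lat side"
        using ij j1 by (auto intro!: glat_abs_le [OF n])
      then have "\<bar>p\<bar> \<le> \<bar>lat side\<bar>" "\<bar>glat n j\<bar> \<le> \<bar>lat side\<bar>" by (simp_all add: p_def abs_le_iff)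
      then have "cos (lat side) \<le> cos p" "cos (lat side) \<le> cos (glat n j)"
        using side by (simp_all add: cos_ge_abs)
      then show ?thesis by (intro mult_mono) (auto intro: order_trans [OF trig_const_nonneg(3)])
    qed
    finally have lower: "4 * c36\<^sup>2 / 3 \<le> cos p * cos (glat n j)" .
    have "0 < 1 - cos \<delta> - sin \<delta> * tan t"
    proof -
      have "0 \<le> s36\<^sup>2 * h\<^sup>2 / 2" "0 < 4 * c36\<^sup>2 / 3" by simp_all
      then have "0 < (1 - cos \<delta> - sin \<delta> * tan t) * (4 * c36\<^sup>2 / 3)" using est by linarith
      then show ?thesis using \<open>0 < 4 * c36\<^sup>2 / 3\<close> by (simp only: zero_less_mult_pos2)
    qed
    then have "(1 - cos \<delta> - sin \<delta> * tan t) * (4 * c36\<^sup>2 / 3) \<le> (1 - cos \<delta> - sin \<delta> * tan t) * (cos p * cos (glat n j))"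
      using lower by (intro mult_left_mono) auto
    then show False using est upper by (simp add: mult.commute)
  qed
  have less: "glon n k < glon n k'" if "k < k'" "k' \<le> n" for k k' by (rule glon_less [OF n that])
  have less_eq: "glon n k \<le> glon n k'" if "k \<le> k'" "k' \<le> n" for k k'
    using less [of k k'] that by (cases "k = k'") auto
  have s12: "\<bar>glon n i - s\<bar> = s - glon n i" "\<bar>glon n (i + 1) - s\<bar> = glon n (i + 1) - s"
    using s_between by simp_all
  have far_out: "C k < C out" if k: "k \<noteq> out" "even (int k - int out)"
  proof (rule C_less [OF _ l_bounds(2)], cases "out = i")
    case True
    then have "inn = i + 1" using cols by auto
    have "k < i \<or> i + 2 \<le> k" using k True by presburger
    then consider "k < i" | "i + 2 \<le> k" by blast
    then show "\<bar>glon n out - s\<bar> < \<bar>glon n k - s\<bar>"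
    proof cases
      case 1
      then have "glon n k < glon n i" using ij by (intro less) auto
      then show ?thesis unfolding True using s12 s_between by linarith
    next
      case 2
      then have "glon n (i + 1) - glon n i \<le> glon n (i + 1 + 1) - glon n (i + 1)"
        using l_bounds(2) by (intro glon_increment_mono [OF n]) auto
      moreover have "glon n (i + 1 + 1) \<le> glon n k" using 2 l_bounds(2) by (intro less_eq) auto
      ultimately show ?thesis unfolding True using s12 s_between by linarith
    qed
  next
    case False
    then have out: "out = i + 1" "inn = i" using cols by auto
    then have odd: "odd (j - int i)" by (auto simp: out_def split: if_splits)
    have "k + 1 \<le> i \<or> i + 1 < k" using k out(1) by presburger
    then consider "k + 1 \<le> i" | "i + 1 < k" by blast
    then show "\<bar>glon n out - s\<bar> < \<bar>glon n k - s\<bar>"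
    proof cases
      case 1
      then have "glon n k \<le> glon n (i - 1)" using ij by (intro less_eq) auto
      moreover have "glon n (i + 1) - s < s - glon n (i - 1)" using strip [OF odd] 1 by simp
      ultimately show ?thesis unfolding out using s12 s_between by linarith
    next
      case 2
      then have "glon n (i + 1) < glon n k" using l_bounds(2) by (intro less)
      then show ?thesis unfolding out using s12 s_between by linarith
    qed
  qed
  have far_inn: "C k < C inn" if k: "k \<noteq> inn" "odd (int k - int out)"
  proof (rule C_less [OF _ l_bounds(2)])
    have "k \<noteq> i" "k \<noteq> i + 1" using k cols by auto
    then consider "k < i" | "i + 1 < k" by linarith
    then show "\<bar>glon n inn - s\<bar> < \<bar>glon n k - s\<bar>"
    proof cases
      case 1
      then have "glon n k < glon n i" using ij by (intro less) auto
      then show ?thesis using cols closer s12 s_between by auto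
    next
      case 2
      then have "glon n (i + 1) < glon n k" using l_bounds(2) by (intro less) auto
      then show ?thesis using cols closer s12 s_between by auto
    qed
  qed
  \<comment> \<open>Parity decides which comparison applies: vertices at latitude j lie on meridians
    of the parity of \<open>out\<close> and compete with the middle vertex; all others are at the
    ends of the arc on \<open>inn\<close> or beyond them.\<close>
  have par: "even (j - int out)" by (simp add: out_def)
  show ?thesis
  proof (cases "even (int k - int out)")
    case True
    then have "even (l - j)" using par l_bounds(3) by presburger
    show ?thesis
    proof (cases "l = j")
      case l: True
      show ?thesis
      proof (cases "k = out")
        case True
        then show ?thesis using l zz by (simp add: face_vertices_def)
      next
        case False
        then have "cos (glat n j) * C k < cos (glat n j) * C out" using far_out True cos_pos by simp
        then show ?thesis using eqs(2) unfolding val l by linarith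
      qed
    next
      case False
      then have "l \<le> j - 1 \<or> j + 1 \<le> l" by linarith
      moreover have "C k < C inn" using far_out True C_out_inn by (cases "k = out") (auto intro: less_trans)
      ultimately show ?thesis using le unfolding val by blast
    qed
  next
    case False
    then have odd: "odd (l - j)" using par l_bounds(3) by presburger
    then have l: "l \<le> j - 1 \<or> j + 1 \<le> l" by (cases "l = j") auto
    show ?thesis
    proof (cases "k = inn")
      case True
      show ?thesis
      proof (cases "l = j - 1 \<or> l = j + 1")
        case l': True
        then show ?thesis using True zz by (auto simp: face_vertices_def)
      next
        case False
        then show ?thesis using l outside True unfolding val by (auto simp: mult.commute)
      qed
    next
      case k: False
      then show ?thesis using le [OF far_inn [OF k False] l] unfolding val by blast
    qed
  qed
qed

section \<open>The faces cover the sphere\<close>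

lemma pt_components:
  "pt l m $ 1 = cos m * (cos l - golden * sin l) / sqrt (golden + 2)"
  "pt l m $ 2 = sin m"
  "pt l m $ 3 = cos m * (golden * cos l + sin l) / sqrt (golden + 2)"
  by (simp_all add: pt_def frame_pt_def c0_eq axis2_def ctr_def root2_def algebra_simps diff_divide_distrib add_divide_distrib)

lemma c36_sqrt: "c36 * sqrt (golden + 2) = (golden + 1) * s36"
proof -
  have "(c36 * sqrt (golden + 2))\<^sup>2 = ((golden + 1) * s36)\<^sup>2"
    using golden_bounds by (simp add: power_mult_distrib c36_sq s36_sq) (simp add: power2_eq_square algebra_simps golden_mult)
  then show ?thesis using golden_bounds by (simp add: power2_eq_iff_nonneg)
qed

lemma hgt_pt: "hgt (pt l m) = sqrt (golden + 2) * (cos m * sin l) - (golden + 1) * sin m"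
proof -
  have "pt l m $ 3 - golden * pt l m $ 1 = (golden + 2) / sqrt (golden + 2) * (cos m * sin l)"
    unfolding pt_components by (simp add: algebra_simps golden_mult add_divide_distrib diff_divide_distrib)
  also have "(golden + 2) / sqrt (golden + 2) = sqrt (golden + 2)" using golden_bounds by (simp add: real_div_sqrt)
  finally show ?thesis by (simp add: hgt_def pt_components)
qed

lemma sin_lon_side: "cos (lat side) * sin (lon side) = golden / (sqrt 3 * sqrt (golden + 2))"
  and cos_lon_side: "cos (lat side) * cos (lon side) = (golden + 1) / (sqrt 3 * sqrt (golden + 2))"
  using cos_lat_sin_lon [OF cos_side_pos] cos_lat_cos_lon [OF cos_side_pos] side_coordinates
  by (simp_all add: mult.commute)

text \<open>The right side is, up to positive factors, the first coordinate of points of longitude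
  l. It vanishes at the longitude of the base, which lies on the mirror of
  \<open>root1\<close>.\<close>

lemma lon_side_sin: "sin (lon side - l) * (cos (lat side) * (sqrt 3 * sqrt (golden + 2))) = golden * (cos l - golden * sin l)"
proof -
  have "sin (lon side - l) * cos (lat side) = (cos (lat side) * sin (lon side)) * cos l - (cos (lat side) * cos (lon side)) * sin l"
    by (simp add: sin_diff algebra_simps)
  also have "\<dots> = (golden * cos l - (golden + 1) * sin l) / (sqrt 3 * sqrt (golden + 2))"
    unfolding sin_lon_side cos_lon_side by (simp add: diff_divide_distrib)
  finally have *: "sin (lon side - l) * cos (lat side) = (golden * cos l - (golden + 1) * sin l) / (sqrt 3 * sqrt (golden + 2))" .
  have "sqrt 3 * sqrt (golden + 2) \<noteq> 0" using golden_bounds by simp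
  then have "sin (lon side - l) * cos (lat side) * (sqrt 3 * sqrt (golden + 2)) = golden * cos l - (golden + 1) * sin l"
    unfolding * by simp
  then show ?thesis by (simp add: algebra_simps golden_mult)
qed

context
  fixes n :: nat
  assumes n: "0 < n"
begin

lemma glon_n: "glon n n = lon side"
  using step_mult [OF n] by (simp add: glon_def)

lemma gp_first_component:
  assumes "k \<le> n"
  shows "0 \<le> gp n k l $ 1" "k < n \<Longrightarrow> 0 < gp n k l $ 1"
proof -
  have pos: "0 < cos (lat side) * (sqrt 3 * sqrt (golden + 2))" "0 < sqrt (golden + 2)" "0 < cos (glat n l)"
    using golden_bounds glat_bounds [OF n] by simp_all
  have le: "glon n k \<le> lon side" using glon_less [OF n, of k n] assms glon_n by (cases "k = n") auto
  have lon: "lon side - glon n k < pi" "0 \<le> lon side - glon n k"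
    using glon_bounds [OF n assms] glon_bounds [OF n order_refl] le glon_n pi_gt_zero by auto
  then have "0 \<le> sin (lon side - glon n k)" by (intro sin_ge_zero) auto
  then have "0 \<le> golden * (cos (glon n k) - golden * sin (glon n k))"
    using pos(1) unfolding lon_side_sin [symmetric] by simp
  then have "0 \<le> cos (glon n k) - golden * sin (glon n k)" using golden_pos(1) by (simp only: zero_le_mult_iff) linarith
  then show "0 \<le> gp n k l $ 1" using pos by (simp add: gp_def pt_components)
  assume "k < n"
  then have "0 < sin (lon side - glon n k)"
    using lon glon_less [OF n, of k n] glon_n by (intro sin_gt_zero) auto
  then have "0 < golden * (cos (glon n k) - golden * sin (glon n k))"
    using pos(1) unfolding lon_side_sin [symmetric] by simp
  then have "0 < cos (glon n k) - golden * sin (glon n k)" using golden_pos(1) by (simp only: zero_less_mult_iff) linarith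
  then show "0 < gp n k l $ 1" using pos by (simp add: gp_def pt_components)
qed

text \<open>For \<open>l = int k\<close> the point is on the equal side, which lies on the mirror of
  \<open>root3\<close>, so the value is 0; moving down the meridian from there makes it
  positive.\<close>

lemma hgt_gp:
  assumes "\<bar>l\<bar> \<le> int k" "k \<le> n"
  shows "0 \<le> hgt (gp n k l)" "l < int k \<Longrightarrow> 0 < hgt (gp n k l)"
proof -
  define t where "t = real k * step n"
  have t: "0 \<le> t" "t \<le> side" using assms step_pos [OF n] mult_step_le [OF n, of "int k"] by (simp_all add: t_def)
  have lat_t: "lat t = glat n (int k)" by (simp add: glat_def t_def)
  have "cos (glat n (int k)) * sin (glon n k) = c36 * sin t"
    unfolding lat_t [symmetric] glon_def t_def [symmetric] using t by (intro cos_lat_sin_lon cos_pos_side) auto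
  then have eq: "sqrt (golden + 2) * (cos (glat n (int k)) * sin (glon n k)) = (golden + 1) * sin (glat n (int k))"
    using c36_sqrt by (simp add: lat_t [symmetric] sin_lat mult_ac)
  have "cos (glat n (int k)) \<le> cos (glat n \<bar>l\<bar>)" using assms by (intro cos_glat_antimono [OF n]) auto
  also have "cos (glat n \<bar>l\<bar>) = cos (glat n l)" using glat_minus [OF n, of l] by (cases "0 \<le> l") auto
  finally have "cos (glat n (int k)) * sin (glon n k) \<le> cos (glat n l) * sin (glon n k)"
    using glon_bounds [OF n assms(2)] pi_gt_zero by (intro mult_right_mono sin_ge_zero) auto
  then have "sqrt (golden + 2) * (cos (glat n (int k)) * sin (glon n k)) \<le> sqrt (golden + 2) * (cos (glat n l) * sin (glon n k))"
    using golden_bounds by (intro mult_left_mono) auto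
  then have ge: "(golden + 1) * (sin (glat n (int k)) - sin (glat n l)) \<le> hgt (gp n k l)"
    unfolding eq gp_def hgt_pt by (simp add: algebra_simps)
  have mono: "sin (glat n l) < sin (glat n (int k))" if "l < int k"
    using that assms glat_less [OF n, of l "int k"] glat_bounds [OF n, of l] glat_bounds [OF n, of "int k"]
    by (intro sin_monotone_2pi) auto
  show "0 < hgt (gp n k l)" if "l < int k"
  proof -
    have "0 < (golden + 1) * (sin (glat n (int k)) - sin (glat n l))"
      using mono [OF that] golden_bounds by (intro mult_pos_pos) auto
    then show ?thesis using ge by linarith
  qed
  moreover have "0 \<le> hgt (gp n k l)" if "l = int k" using ge that by simp
  ultimately show "0 \<le> hgt (gp n k l)" using assms by fastforce
qed

lemma s2_gp: "s2 (gp n k l) = gp n k (- l)"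
  by (simp add: gp_def s2_pt glat_minus [OF n])

lemma gp_second_component: "0 \<le> l \<Longrightarrow> l \<le> int n \<Longrightarrow> 0 \<le> gp n k l $ 2"
  using glat_less [OF n, of 0 l] glat_bounds [OF n, of l] glat_0 [OF n]
  by (cases "l = 0") (auto simp: gp_def pt_components intro!: sin_ge_zero)

lemma gp_in_chamber:
  assumes "0 \<le> l" "l \<le> int k" "k \<le> n"
  shows "gp n k l \<in> chamber"
  using assms gp_first_component [of k l] hgt_gp [of l k] gp_second_component [of l k]
  by (simp add: chamber_def)

end

section \<open>Orientation and signed triple products\<close>

lemma axes_cross: "cross3 c0 axis2 = - root2" "cross3 axis2 root2 = - c0" "cross3 root2 c0 = - axis2"
proof -
  define k where "k = 1 / sqrt (golden + 2)"
  have k: "k * k * (golden + 2) = 1" using sqrt_golden2 by (simp add: k_def)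
  have c: "c0 = vector [k, 0, k * golden]" "axis2 = vector [- k * golden, 0, k]"
    by (simp_all add: c0_eq axis2_def ctr_def k_def vec_eq_iff forall_3)
  have "k * k + k * golden * (k * golden) = 1" using k by (simp add: algebra_simps golden_mult)
  then show "cross3 c0 axis2 = - root2" unfolding c root2_def
    by (simp add: cross3_vector vec_eq_iff forall_3 algebra_simps)
  show "cross3 axis2 root2 = - c0" "cross3 root2 c0 = - axis2"
    unfolding c root2_def by (simp_all add: cross3_vector vec_eq_iff forall_3)
qed

text \<open>The negative of the usual triple product: the frame \<open>c0\<close>,
  \<open>axis2\<close>, \<open>root2\<close> is left-handed, and with this sign
  \<open>tri c0 axis2 root2\<close> is 1.\<close>

definition tri :: "real^3 \<Rightarrow> real^3 \<Rightarrow> real^3 \<Rightarrow> real" where "tri p q r = p \<bullet> cross3 r q"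

lemma tri_cyclic: "tri p q r = tri q r p" and tri_swap: "tri p q r = - tri p r q"
  by (simp_all add: tri_def cross3_def inner_vec_def sum_3 algebra_simps)

lemma linear_tri: "linear (tri p q)"
  by (intro linearI) (simp_all add: tri_def cross_add_left cross_mult_left inner_add_right)

text \<open>Cramer's rule; the signs of the coefficients tell whether the ray through y meets the
  triangle.\<close>

lemma tri_expansion: "tri p q r *\<^sub>R y = tri y q r *\<^sub>R p + tri p y r *\<^sub>R q + tri p q y *\<^sub>R r"
  by (simp add: tri_def cross3_def inner_vec_def sum_3 vec_eq_iff forall_3) (simp add: algebra_simps)

text \<open>Vanishes on the meridian of longitude l and is positive to the east of it.\<close>

definition east :: "real \<Rightarrow> real^3 \<Rightarrow> real" where
  "east l y = (y \<bullet> axis2) * cos l - (y \<bullet> c0) * sin l"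

lemma linear_east: "linear (east l)"
  by (intro linearI) (simp_all add: east_def inner_add_left algebra_simps)

lemma east_pt: "east l (pt l' m) = cos m * sin (l' - l)"
  by (simp add: east_def pt_inner_axes sin_diff algebra_simps)

lemma tri_same_meridian: "tri y (pt l m) (pt l m') = - sin (m' - m) * east l y"
proof -
  have sw: "cross3 axis2 c0 = root2" "cross3 root2 axis2 = c0" "cross3 c0 root2 = axis2"
    using axes_cross cross_skew [of c0 axis2] cross_skew [of axis2 root2] cross_skew [of root2 c0] by simp_all
  have cross: "cross3 (pt l m') (pt l m) = sin (m' - m) *\<^sub>R (sin l *\<^sub>R c0 - cos l *\<^sub>R axis2)"
    unfolding pt_def frame_pt_def
    by (simp add: cross_add_left cross_add_right cross_mult_left cross_mult_right sw axes_cross cross_refl sin_diff algebra_simps)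
  show ?thesis unfolding tri_def cross by (simp add: east_def inner_diff_right algebra_simps)
qed

text \<open>A discrete intermediate value theorem; it locates a ray between two meridians and then
  between two edges.\<close>

lemma sign_change:
  fixes f :: "nat \<Rightarrow> real"
  assumes "0 \<le> f 0" "f N \<le> 0" "0 < N"
  shows "\<exists>m<N. 0 \<le> f m \<and> f (Suc m) \<le> 0"
  using assms
proof (induction N)
  case (Suc N)
  then show ?case by (cases "0 \<le> f N") (use less_Suc_eq in \<open>auto simp: less_eq_real_def not_le\<close>)
qed simp

text \<open>By \<open>chamber_le\<close>, signs at the generators extend to the whole chamber, which
  therefore lies between the meridian of the apex and that of the base.\<close>

lemma gens_east:
  "0 \<le> east 0 ctr" "0 \<le> east 0 vtx" "0 \<le> east 0 mid"
  "east (lon side) ctr \<le> 0" "east (lon side) vtx \<le> 0" "east (lon side) mid \<le> 0"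
proof -
  have lon: "0 \<le> sin (lon side)"
    using cos_lat_sin_lon [OF cos_side_pos] sin_side_pos cos_lat_pos [of side]
    by (metis c36_pos less_imp_le mult_pos_pos zero_less_mult_pos)
  have ctr: "ctr = sqrt (golden + 2) *\<^sub>R c0" using sqrt_golden2 by (simp add: c0_eq)
  have vtx: "vtx = sqrt 3 *\<^sub>R a0" "vtx' = sqrt 3 *\<^sub>R b0" by (simp_all add: a0_def b0_def)
  have east_lin: "east l (x + y) = east l x + east l y" "east l (k *\<^sub>R x) = k * east l x" for l x y k
    using linear_add [OF linear_east] linear_cmul [OF linear_east] by simp_all
  have c0: "east l c0 = - sin l" for l
    using axes_orthonormal by (simp add: east_def inner_commute)
  have ab: "a0 = pt (lon side) (lat side)" "b0 = pt (lon side) (- lat side)"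
    by (simp_all add: a0_frame b0_frame pt_def frame_pt_def cos_lat_sin_lon cos_lat_cos_lon cos_side_pos sin_lat mult.commute)
  have vals: "east l a0 = cos (lat side) * sin (lon side - l)" "east l b0 = cos (lat side) * sin (lon side - l)" for l
    by (simp_all add: ab east_pt)
  show "0 \<le> east 0 ctr" "east (lon side) ctr \<le> 0" using lon golden_bounds by (simp_all add: ctr east_lin c0)
  show 0: "0 \<le> east 0 vtx" "east (lon side) vtx \<le> 0" using lon by (simp_all add: vtx east_lin vals)
  have "0 \<le> east 0 vtx'" "east (lon side) vtx' \<le> 0" using lon by (simp_all add: vtx east_lin vals)
  then show "0 \<le> east 0 mid" "east (lon side) mid \<le> 0"
    using 0 by (simp_all add: mid_eq east_lin add_nonneg_nonneg add_nonpos_nonpos mult_nonneg_nonpos less_imp_le [OF golden_pos(1)]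
      divide_le_0_iff)
qed

text \<open>In the same way these signs place the chamber between the planes of the two equal
  sides.\<close>

lemma gens_tri:
  "tri c0 (c36 *\<^sub>R axis2 + s36 *\<^sub>R root2) ctr \<le> 0" "tri c0 (c36 *\<^sub>R axis2 + s36 *\<^sub>R root2) vtx \<le> 0"
  "tri c0 (c36 *\<^sub>R axis2 + s36 *\<^sub>R root2) mid \<le> 0"
  "0 \<le> tri c0 (c36 *\<^sub>R axis2 - s36 *\<^sub>R root2) ctr" "0 \<le> tri c0 (c36 *\<^sub>R axis2 - s36 *\<^sub>R root2) vtx"
  "0 \<le> tri c0 (c36 *\<^sub>R axis2 - s36 *\<^sub>R root2) mid"
proof -
  have sw: "cross3 axis2 c0 = root2" "cross3 root2 axis2 = c0" "cross3 c0 root2 = axis2"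
    using axes_cross cross_skew [of c0 axis2] cross_skew [of axis2 root2] cross_skew [of root2 c0] by simp_all
  have val: "tri c0 (c36 *\<^sub>R axis2 + t *\<^sub>R root2) y = c36 * (y \<bullet> root2) - t * (y \<bullet> axis2)" for t y
  proof -
    have "cross3 (c36 *\<^sub>R axis2 + t *\<^sub>R root2) c0 = c36 *\<^sub>R root2 - t *\<^sub>R axis2"
      by (simp add: cross_add_left cross_mult_left sw axes_cross)
    moreover have "tri c0 (c36 *\<^sub>R axis2 + t *\<^sub>R root2) y = y \<bullet> cross3 (c36 *\<^sub>R axis2 + t *\<^sub>R root2) c0"
      by (metis tri_def tri_cyclic)
    ultimately show ?thesis by (simp add: inner_diff_right)
  qed
  have ctr: "ctr = sqrt (golden + 2) *\<^sub>R c0" using sqrt_golden2 by (simp add: c0_eq)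
  have vtx: "vtx = sqrt 3 *\<^sub>R a0" "vtx' = sqrt 3 *\<^sub>R b0" by (simp_all add: a0_def b0_def)
  note orth = axes_orthonormal
  have comm: "axis2 \<bullet> c0 = 0" "root2 \<bullet> c0 = 0" "root2 \<bullet> axis2 = 0" using orth by (simp_all add: inner_commute)
  have vals: "a0 \<bullet> root2 = sin side * s36" "a0 \<bullet> axis2 = sin side * c36" "b0 \<bullet> root2 = - sin side * s36" "b0 \<bullet> axis2 = sin side * c36"
    by (simp_all add: a0_frame b0_frame inner_add_left inner_diff_left orth comm)
  have mid: "mid \<bullet> root2 = 0" "0 \<le> mid \<bullet> axis2"
    using sin_side_pos by (simp_all add: mid_eq inner_add_left vtx vals less_imp_le [OF golden_pos(1)])
  have minus: "c36 *\<^sub>R axis2 - s36 *\<^sub>R root2 = c36 *\<^sub>R axis2 + (- s36) *\<^sub>R root2" by simp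
  show "tri c0 (c36 *\<^sub>R axis2 + s36 *\<^sub>R root2) ctr \<le> 0" "tri c0 (c36 *\<^sub>R axis2 + s36 *\<^sub>R root2) vtx \<le> 0"
    "tri c0 (c36 *\<^sub>R axis2 + s36 *\<^sub>R root2) mid \<le> 0"
    "0 \<le> tri c0 (c36 *\<^sub>R axis2 - s36 *\<^sub>R root2) ctr" "0 \<le> tri c0 (c36 *\<^sub>R axis2 - s36 *\<^sub>R root2) vtx"
    "0 \<le> tri c0 (c36 *\<^sub>R axis2 - s36 *\<^sub>R root2) mid"
    unfolding minus val using mid sin_side_pos by (simp_all add: ctr vtx vals orth)
qed

lemma tri_frame_arc: "tri (cos t *\<^sub>R c0 + sin t *\<^sub>R u) (cos t' *\<^sub>R c0 + sin t' *\<^sub>R u) y = sin (t' - t) * tri c0 u y"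
  by (simp add: tri_def cross_add_left cross_add_right cross_mult_left cross_mult_right cross_refl inner_add_left inner_add_right
      dot_cross_self sin_diff algebra_simps)
    (simp add: cross3_def inner_vec_def sum_3 algebra_simps)

context
  fixes n :: nat
  assumes n: "0 < n"
begin

lemma gp_lower_side: "i \<le> n \<Longrightarrow> gp n i (- int i) = cos (real i * step n) *\<^sub>R c0 +
    sin (real i * step n) *\<^sub>R (c36 *\<^sub>R axis2 - s36 *\<^sub>R root2)"
proof -
  assume i: "i \<le> n"
  have "s2 c0 = c0" "s2 axis2 = axis2" "s2 root2 = - root2"
    using axes_orthonormal by (simp_all add: reflect_def inner_commute) (simp add: scaleR_2)
  moreover have "linear s2" by (rule W_linear [OF s2_in_W])
  ultimately have "s2 (gp n i (int i)) = cos (real i * step n) *\<^sub>R c0 +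
    sin (real i * step n) *\<^sub>R (c36 *\<^sub>R axis2 - s36 *\<^sub>R root2)"
    unfolding gp_side [OF n i] by (simp add: linear_add linear_cmul scaleR_diff_right)
  then show ?thesis by (simp add: s2_gp [OF n])
qed

text \<open>A change of sign of \<open>east\<close> finds the strip between two meridians that
  contains y; within it, a change of sign across successive zigzag edges finds the triangle.\<close>

lemma chamber_covered:
  assumes y: "y \<in> chamber" "y \<noteq> 0"
  shows "\<exists>i j. i < n \<and> \<bar>j\<bar> \<le> int i \<and> (\<exists>t>0. t *\<^sub>R y \<in> face n i j)"
proof -
  have lin0: "linear (\<lambda>y::real^3. 0::real)" by (rule linear_zero)
  have "0 \<le> east (glon n 0) y"
    using chamber_le(1) [OF lin0 linear_east [of 0] _ _ _ y(1)] gens_east by (simp add: glon_def)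
  moreover have "east (glon n n) y \<le> 0"
    using chamber_le(1) [OF linear_east [of "lon side"] lin0 _ _ _ y(1)] gens_east by (simp add: glon_n [OF n])
  ultimately obtain i where i: "i < n" "0 \<le> east (glon n i) y" "east (glon n (i + 1)) y \<le> 0"
    using sign_change [of "\<lambda>i. east (glon n i) y" n] n by auto
  \<comment> \<open>The edge between \<open>zz n i j\<close> and \<open>zz n i (j + 1)\<close>,
    always directed from the meridian i to the meridian i + 1; thus \<open>E j\<close> is
    nonnegative when y is to the north of the edge, for both parities.\<close>
  define left where "left j = (if even (j - int i) then zz n i j else zz n i (j + 1))" for j
  define right where "right j = (if even (j - int i) then zz n i (j + 1) else zz n i j)" for j
  define E where "E j = tri (left j) (right j) y" for j
  have zz_i: "zz n i (int i) = gp n i (int i)" "zz n i (int i + 1) = gp n (i + 1) (int (i + 1))"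
    "zz n i (- int i) = gp n i (- int i)"
    by (simp_all add: zz_def algebra_simps)
  have "- int i - 1 = - int (i + 1)" by simp
  then have zz_low: "zz n i (- int i - 1) = gp n (i + 1) (- int (i + 1))"
    by (simp only:) (simp add: zz_def)
  have step: "0 \<le> sin (step n)" using step_pos [OF n] step_bound [OF n] pi_gt3 by (intro sin_ge_zero) auto
  have diff: "real (i + 1) * step n - real i * step n = step n" "real i * step n - real (i + 1) * step n = - step n"
    by (simp_all add: algebra_simps)
  have "E (int i) \<le> 0"
  proof -
    have "tri c0 (c36 *\<^sub>R axis2 + s36 *\<^sub>R root2) y \<le> 0"
      using chamber_le(1) [OF linear_tri lin0 _ _ _ y(1)] gens_tri by blast
    moreover have "E (int i) = sin (step n) * tri c0 (c36 *\<^sub>R axis2 + s36 *\<^sub>R root2) y"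
    proof -
      have *: "left (int i) = gp n i (int i)" "right (int i) = gp n (i + 1) (int (i + 1))"
        by (simp_all add: left_def right_def zz_i)
      show ?thesis unfolding E_def * using i(1)
        by (subst gp_side [OF n], simp, subst gp_side [OF n], simp) (simp only: tri_frame_arc diff)
    qed
    ultimately show ?thesis using step by (simp add: mult_nonneg_nonpos)
  qed
  moreover have "0 \<le> E (- int i - 1)"
  proof -
    have "0 \<le> tri c0 (c36 *\<^sub>R axis2 - s36 *\<^sub>R root2) y"
      using chamber_le(1) [OF lin0 linear_tri _ _ _ y(1)] gens_tri by blast
    moreover have "E (- int i - 1) = sin (step n) * tri c0 (c36 *\<^sub>R axis2 - s36 *\<^sub>R root2) y"
    proof -
      have *: "left (- int i - 1) = gp n i (- int i)" "right (- int i - 1) = gp n (i + 1) (- int (i + 1))"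
        by (simp_all add: left_def right_def zz_i zz_low)
      show ?thesis unfolding E_def * using i(1)
        by (subst gp_lower_side, simp, subst gp_lower_side, simp) (simp only: tri_frame_arc diff)
    qed
    ultimately show ?thesis using step by simp
  qed
  \<comment> \<open>The edges run from j = - i - 1 on the lower side to j = i on the upper side and
    enclose 2 i + 1 triangles.\<close>
  ultimately obtain m where m: "m < 2 * i + 1" "0 \<le> E (int m - int i - 1)" "E (int (Suc m) - int i - 1) \<le> 0"
    using sign_change [of "\<lambda>m. E (int m - int i - 1)" "2 * i + 1"] by (auto simp: algebra_simps)
  define j where "j = int m - int i"
  have j: "\<bar>j\<bar> \<le> int i" "0 \<le> E (j - 1)" "E j \<le> 0" using m by (auto simp: j_def algebra_simps)
  let ?p = "zz n i j" and ?q = "zz n i (j - 1)" and ?r = "zz n i (j + 1)"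
  have j1: "- int n \<le> j - 1" "j + 1 \<le> int n" using j(1) i(1) by auto
  have sin_pos: "0 < sin (glat n (j + 1) - glat n (j - 1))"
    using glat_less [OF n, of "j - 1" "j + 1"] j1 glat_bounds [OF n, of "j + 1"] glat_bounds [OF n, of "j - 1"]
    by (intro sin_gt_zero) auto
  have sin_lon: "0 < sin (glon n (i + 1) - glon n i)"
    using glon_less [OF n, of i "i + 1"] i(1) glon_bounds [OF n, of "i + 1"] glon_bounds [OF n, of i]
    by (intro sin_gt_zero) auto
  \<comment> \<open>The coefficients are those of \<open>tri_expansion\<close>; each of the three is
    nonnegative by one of the sign conditions on y.\<close>
  have "\<exists>a b c k. 0 \<le> a \<and> 0 \<le> b \<and> 0 \<le> c \<and> 0 < k \<and> k *\<^sub>R y = a *\<^sub>R ?q + b *\<^sub>R ?p + c *\<^sub>R ?r"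
  proof (cases "even (j - int i)")
    case True
    note z = zz_even [OF True] zz_neighbours(1,2) [OF True]
    have E: "E j = tri ?p ?r y" "E (j - 1) = tri ?p ?q y" using True by (simp_all add: E_def left_def right_def)
    have T: "tri x ?q ?r = - sin (glat n (j + 1) - glat n (j - 1)) * east (glon n (i + 1)) x" for x
      unfolding z gp_def by (rule tri_same_meridian)
    have "tri ?p ?q ?r = sin (glat n (j + 1) - glat n (j - 1)) * (cos (glat n j) * sin (glon n (i + 1) - glon n i))"
      unfolding T unfolding z gp_def east_pt by (metis minus_diff_eq minus_mult_minus mult_minus_right sin_minus)
    then have k: "0 < tri ?p ?q ?r" using sin_pos sin_lon glat_bounds [OF n, of j] by simp
    have "0 \<le> tri y ?q ?r" unfolding T using sin_pos i(3) by (simp add: mult_nonneg_nonpos)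
    moreover have "0 \<le> tri ?p y ?r" using j(3) E(1) tri_swap [of ?p y ?r] by simp
    moreover have "0 \<le> tri ?p ?q y" using j(2) E(2) by simp
    moreover have "tri ?p ?q ?r *\<^sub>R y = tri ?p y ?r *\<^sub>R ?q + tri y ?q ?r *\<^sub>R ?p + tri ?p ?q y *\<^sub>R ?r"
      using tri_expansion [of ?p ?q ?r y] by (simp add: add_ac)
    ultimately show ?thesis using k by blast
  next
    case False
    note z = zz_odd [OF False] zz_neighbours(3,4) [OF False]
    have E: "E j = tri ?r ?p y" "E (j - 1) = tri ?q ?p y" using False by (simp_all add: E_def left_def right_def)
    have T: "tri x ?r ?q = sin (glat n (j + 1) - glat n (j - 1)) * east (glon n i) x" for x
      unfolding z gp_def using tri_same_meridian [of x "glon n i" "glat n (j + 1)" "glat n (j - 1)"]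
      by (metis minus_diff_eq minus_minus sin_minus)
    have "tri ?p ?r ?q = sin (glat n (j + 1) - glat n (j - 1)) * (cos (glat n j) * sin (glon n (i + 1) - glon n i))"
      unfolding T unfolding z gp_def east_pt ..
    then have k: "0 < tri ?p ?r ?q" using sin_pos sin_lon glat_bounds [OF n, of j] by simp
    have "0 \<le> tri y ?r ?q" unfolding T using sin_pos i(2) by simp
    moreover have "0 \<le> tri ?p y ?q" using j(2) E(2) tri_cyclic [of ?q ?p y] by simp
    moreover have "0 \<le> tri ?p ?r y"
      using j(3) E(1) tri_cyclic [of ?r ?p y] tri_swap [of ?p y ?r] by simp
    moreover have "tri ?p ?r ?q *\<^sub>R y = tri ?p ?r y *\<^sub>R ?q + tri y ?r ?q *\<^sub>R ?p + tri ?p y ?q *\<^sub>R ?r"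
      using tri_expansion [of ?p ?r ?q y] by (simp add: add_ac)
    ultimately show ?thesis using k by blast
  qed
  then obtain a b c k where abck: "0 \<le> a" "0 \<le> b" "0 \<le> c" "0 < k" "k *\<^sub>R y = a *\<^sub>R ?q + b *\<^sub>R ?p + c *\<^sub>R ?r"
    by blast
  have "\<not> (a = 0 \<and> b = 0 \<and> c = 0)" using abck(4,5) y(2) by auto
  then have "0 < a + b + c" using abck by linarith
  then obtain t where "0 < t" "t *\<^sub>R k *\<^sub>R y \<in> convex hull {?q, ?p, ?r}"
    using cone3_meets_hull [OF abck(1-3) _ abck(5)] by blast
  then have "0 < t * k" "(t * k) *\<^sub>R y \<in> face n i j" using abck(4) by (simp_all add: face_def face_vertices_def)
  then show ?thesis using i(1) j(1) by blast
qed

end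

section \<open>The hull of the vertices\<close>

lemma finite_W: "finite W"
proof (rule inj_on_finite)
  show "inj_on (\<lambda>w. (w ctr, w vtx, w vtx')) W"
  proof (rule inj_onI)
    fix w u assume wu: "w \<in> W" "u \<in> W" "(w ctr, w vtx, w vtx') = (u ctr, u vtx, u vtx')"
    then have "w mid = u mid"
      by (simp only: mid_eq linear_cmul linear_add W_linear prod.inject)
    then show "w = u" using wu by (intro W_eqI) simp_all
  qed
  show "(\<lambda>w. (w ctr, w vtx, w vtx')) ` W \<subseteq> centres12 \<times> vertices20 \<times> vertices20"
    using W_centres12 W_vertices20 ctr_in_centres12 vtx_in_vertices20 by blast
  show "finite (centres12 \<times> vertices20 \<times> vertices20)"
    by (intro finite_cartesian_product finite_centres12 finite_vertices20)
qed

lemma W_transitive_centres: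
  assumes "c \<in> centres12"
  shows "\<exists>w\<in>W. w ctr = c"
proof -
  have step: "\<exists>w\<in>W. w ctr = reflect \<alpha> c" if c: "\<exists>w\<in>W. w ctr = c" and \<alpha>: "\<alpha> \<in> {root1, root2, root3}" for c \<alpha>
  proof -
    obtain w where w: "w \<in> W" "w ctr = c" using c by blast
    show ?thesis by (rule bexI [OF _ W_step [OF w(1) \<alpha>]]) (simp add: w(2))
  qed
  have s: "\<exists>w\<in>W. w ctr = s1 c" "\<exists>w\<in>W. w ctr = s2 c" "\<exists>w\<in>W. w ctr = s3 c" if "\<exists>w\<in>W. w ctr = c" for c
    by (rule step [OF that]; simp)+
  have "\<exists>w\<in>W. w ctr = vector [1, 0, golden]" using W_id by (auto simp: ctr_def)
  \<comment> \<open>A walk through the orbit of \<open>ctr\<close>, by reflections, that visits all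
    twelve centres.\<close>
  note 1 = this
  note 2 = s(1) [OF 1, unfolded s1_vector]
  note 3 = s(3) [OF 2, unfolded s3_centres12]
  note 4 = s(2) [OF 3, unfolded s2_vector minus_zero]
  note 5 = s(3) [OF 4, unfolded s3_centres12]
  note 6 = s(1) [OF 5, unfolded s1_vector]
  note 7 = s(2) [OF 5, unfolded s2_vector]
  note 8 = s(1) [OF 7, unfolded s1_vector]
  note 9 = s(3) [OF 8, unfolded s3_centres12]
  note 10 = s(2) [OF 9, unfolded s2_vector]
  note 11 = s(3) [OF 10, unfolded s3_centres12]
  note 12 = s(1) [OF 11, unfolded s1_vector]
  show ?thesis using assms 1 2 3 4 5 6 7 8 9 10 11 12 unfolding centres12_def
    by (elim insertE emptyE) (simp_all only:)
qed

lemma gp_0: "gp n 0 0 = c0"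
  by (simp add: gp_def glon_def glat_def pt_def frame_pt_def)

lemma kitrick_vertices_eq:
  assumes "0 < n"
  shows "kitrick_vertices n = {w (gp n k l) |w k l. w \<in> W \<and> kitrick_index n k l}"
proof -
  have pt: "kitrick_point n (w c0, w a0, w b0) k l = w (gp n k l)" if "w \<in> W" "kitrick_index n k l" for w k l
    using kitrick_point_W [OF that(1) assms] that(2) by (simp add: kitrick_index_def)
  show ?thesis
  proof (intro subset_antisym subsetI)
    fix v assume "v \<in> kitrick_vertices n"
    then obtain w k l where w: "w \<in> W" "kitrick_index n k l" "v = kitrick_point n (w c0, w a0, w b0) k l"
      unfolding kitrick_vertices_def base_triangles_eq by blast
    then show "v \<in> {w (gp n k l) |w k l. w \<in> W \<and> kitrick_index n k l}" unfolding w(3) pt [OF w(1,2)] by blast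
  next
    fix v assume "v \<in> {w (gp n k l) |w k l. w \<in> W \<and> kitrick_index n k l}"
    then obtain w k l where w: "w \<in> W" "kitrick_index n k l" "v = w (gp n k l)" by blast
    then show "v \<in> kitrick_vertices n"
      unfolding w(3) pt [OF w(1,2), symmetric] kitrick_vertices_def base_triangles_eq by blast
  qed
qed

lemma kitrick_edges_eq:
  assumes n: "0 < n"
  shows "kitrick_edges n = {closed_segment (w p) (w q) |w p q. w \<in> W \<and> (p, q) \<in> edge_pairs n}" (is "_ = ?R")
proof -
  have pt: "kitrick_point n (w c0, w a0, w b0) k l = w (gp n k l)" if "w \<in> W" "kitrick_index n k l" for w k l
    using kitrick_point_W [OF that(1) n] that(2) by (simp add: kitrick_index_def)
  have up: "kitrick_index n (i + 1) (j + 1)" "kitrick_index n (i + 1) (j - 1)" if "kitrick_index n i j" "i < n" for i j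
    using that by (auto simp: kitrick_index_def)
  show ?thesis
  proof (intro subset_antisym subsetI)
    fix S assume "S \<in> kitrick_edges n"
    then show "S \<in> ?R"
      unfolding kitrick_edges_def base_triangles_eq
    proof (elim UnE)
      assume "S \<in> {closed_segment (kitrick_point n T i (j - 1)) (kitrick_point n T i (j + 1)) |T i j.
        T \<in> (\<lambda>w. (w c0, w a0, w b0)) ` W \<and> kitrick_index n i (j - 1) \<and> kitrick_index n i (j + 1)}"
      then obtain w i j where w: "w \<in> W" and ij: "kitrick_index n i (j - 1)" "kitrick_index n i (j + 1)"
        and S: "S = closed_segment (kitrick_point n (w c0, w a0, w b0) i (j - 1)) (kitrick_point n (w c0, w a0, w b0) i (j + 1))"
        by blast
      have "(gp n i (j - 1), gp n i (j + 1)) \<in> edge_pairs n" using ij unfolding edge_pairs_def by blast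
      then show ?thesis using w unfolding S pt [OF w ij(1)] pt [OF w ij(2)] by blast
    next
      assume "S \<in> {closed_segment (kitrick_point n T i j) (kitrick_point n T (i + 1) (j + 1)) |T i j.
        T \<in> (\<lambda>w. (w c0, w a0, w b0)) ` W \<and> kitrick_index n i j \<and> i < n}"
      then obtain w i j where w: "w \<in> W" and ij: "kitrick_index n i j" "i < n"
        and S: "S = closed_segment (kitrick_point n (w c0, w a0, w b0) i j) (kitrick_point n (w c0, w a0, w b0) (i + 1) (j + 1))"
        by blast
      have "(gp n i j, gp n (i + 1) (j + 1)) \<in> edge_pairs n" using ij unfolding edge_pairs_def by blast
      then show ?thesis using w unfolding S pt [OF w ij(1)] pt [OF w up(1) [OF ij]] by blast
    next
      assume "S \<in> {closed_segment (kitrick_point n T i j) (kitrick_point n T (i + 1) (j - 1)) |T i j.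
        T \<in> (\<lambda>w. (w c0, w a0, w b0)) ` W \<and> kitrick_index n i j \<and> i < n}"
      then obtain w i j where w: "w \<in> W" and ij: "kitrick_index n i j" "i < n"
        and S: "S = closed_segment (kitrick_point n (w c0, w a0, w b0) i j) (kitrick_point n (w c0, w a0, w b0) (i + 1) (j - 1))"
        by blast
      have "(gp n i j, gp n (i + 1) (j - 1)) \<in> edge_pairs n" using ij unfolding edge_pairs_def by blast
      then show ?thesis using w unfolding S pt [OF w ij(1)] pt [OF w up(2) [OF ij]] by blast
    qed
  next
    fix S assume "S \<in> ?R"
    then obtain w p q where w: "w \<in> W" and S: "S = closed_segment (w p) (w q)" and "(p, q) \<in> edge_pairs n" by blast
    then show "S \<in> kitrick_edges n"
      unfolding edge_pairs_def
    proof (elim UnE)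
      assume "(p, q) \<in> {(gp n i (j - 1), gp n i (j + 1)) |i j. kitrick_index n i (j - 1) \<and> kitrick_index n i (j + 1)}"
      then obtain i j where ij: "kitrick_index n i (j - 1)" "kitrick_index n i (j + 1)" "p = gp n i (j - 1)" "q = gp n i (j + 1)"
        by blast
      have "S = closed_segment (kitrick_point n (w c0, w a0, w b0) i (j - 1)) (kitrick_point n (w c0, w a0, w b0) i (j + 1))"
        by (simp only: S ij(3,4) pt [OF w ij(1)] pt [OF w ij(2)])
      then show ?thesis unfolding kitrick_edges_def base_triangles_eq using w ij(1,2) by blast
    next
      assume "(p, q) \<in> {(gp n i j, gp n (i + 1) (j + 1)) |i j. kitrick_index n i j \<and> i < n}"
      then obtain i j where ij: "kitrick_index n i j" "i < n" "p = gp n i j" "q = gp n (i + 1) (j + 1)" by blast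
      have "S = closed_segment (kitrick_point n (w c0, w a0, w b0) i j) (kitrick_point n (w c0, w a0, w b0) (i + 1) (j + 1))"
        by (simp only: S ij(3,4) pt [OF w ij(1)] pt [OF w up(1) [OF ij(1,2)]])
      then show ?thesis unfolding kitrick_edges_def base_triangles_eq using w ij(1,2) by blast
    next
      assume "(p, q) \<in> {(gp n i j, gp n (i + 1) (j - 1)) |i j. kitrick_index n i j \<and> i < n}"
      then obtain i j where ij: "kitrick_index n i j" "i < n" "p = gp n i j" "q = gp n (i + 1) (j - 1)" by blast
      have "S = closed_segment (kitrick_point n (w c0, w a0, w b0) i j) (kitrick_point n (w c0, w a0, w b0) (i + 1) (j - 1))"
        by (simp only: S ij(3,4) pt [OF w ij(1)] pt [OF w up(2) [OF ij(1,2)]])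
      then show ?thesis unfolding kitrick_edges_def base_triangles_eq using w ij(1,2) by blast
    qed
  qed
qed

lemma zz_index:
  assumes "i < n" "\<bar>j\<bar> \<le> int i"
  shows "kitrick_index n (if even (j - int i) then i else i + 1) j"
    "kitrick_index n (if even (j - int i) then i + 1 else i) (j - 1)"
    "kitrick_index n (if even (j - int i) then i + 1 else i) (j + 1)"
  using assms odd_bound [of j i] by (auto simp: kitrick_index_def)

lemma W_face: "w \<in> W \<Longrightarrow> w ` face n i j = convex hull {w (zz n i (j - 1)), w (zz n i j), w (zz n i (j + 1))}"
  by (simp add: face_def face_vertices_def orth_hull W_orth)

text \<open>The two families of triangles are told apart by the parity of j - i, that is, by whether
  the middle vertex is on the western or the eastern meridian.\<close>

lemma kitrick_faces_eq:
  assumes n: "0 < n"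
  shows "kitrick_faces n = {w ` face n i j |w i j. w \<in> W \<and> i < n \<and> \<bar>j\<bar> \<le> int i}" (is "_ = ?R")
proof -
  have pt: "kitrick_point n (w c0, w a0, w b0) k l = w (gp n k l)" if "w \<in> W" "kitrick_index n k l" for w k l
    using kitrick_point_W [OF that(1) n] that(2) by (simp add: kitrick_index_def)
  have up: "kitrick_index n (i + 1) (j + 1)" "kitrick_index n (i + 1) (j - 1)" if "kitrick_index n i j" "i < n" for i j
    using that by (auto simp: kitrick_index_def)
  have even_face: "w ` face n i j = convex hull {kitrick_point n (w c0, w a0, w b0) i j,
      kitrick_point n (w c0, w a0, w b0) (i + 1) (j - 1), kitrick_point n (w c0, w a0, w b0) (i + 1) (j + 1)}"
    if w: "w \<in> W" and ij: "kitrick_index n i j" "i < n" for w i j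
  proof -
    have "even (j - int i)" using ij by (simp add: kitrick_index_def)
    note z = zz_even [OF this] zz_neighbours(1,2) [OF this]
    show ?thesis
      unfolding W_face [OF w] z pt [OF w ij(1)] pt [OF w up(1) [OF ij]] pt [OF w up(2) [OF ij]]
      by (simp only: insert_commute)
  qed
  have odd_face: "w ` face n i j = convex hull {kitrick_point n (w c0, w a0, w b0) i (j - 1),
      kitrick_point n (w c0, w a0, w b0) i (j + 1), kitrick_point n (w c0, w a0, w b0) (i + 1) j}"
    if w: "w \<in> W" and ij: "kitrick_index n i (j - 1)" "kitrick_index n i (j + 1)" "i < n" for w i j
  proof -
    have odd: "odd (j - int i)" using ij(1) unfolding kitrick_index_def by presburger
    have mid: "kitrick_index n (i + 1) j" using up(1) [OF ij(1,3)] by simp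
    note z = zz_odd [OF odd] zz_neighbours(3,4) [OF odd]
    show ?thesis
      unfolding W_face [OF w] z pt [OF w ij(1)] pt [OF w ij(2)] pt [OF w mid]
      by (simp only: insert_commute)
  qed
  show ?thesis
  proof (intro subset_antisym subsetI)
    fix F assume "F \<in> kitrick_faces n"
    then show "F \<in> ?R"
      unfolding kitrick_faces_def base_triangles_eq
    proof (elim UnE)
      assume "F \<in> {convex hull {kitrick_point n T i j, kitrick_point n T (i + 1) (j - 1), kitrick_point n T (i + 1) (j + 1)} |T i j.
        T \<in> (\<lambda>w. (w c0, w a0, w b0)) ` W \<and> kitrick_index n i j \<and> i < n}"
      then obtain w i j where w: "w \<in> W" and ij: "kitrick_index n i j" "i < n"
        and F: "F = convex hull {kitrick_point n (w c0, w a0, w b0) i j,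
          kitrick_point n (w c0, w a0, w b0) (i + 1) (j - 1), kitrick_point n (w c0, w a0, w b0) (i + 1) (j + 1)}"
        by blast
      have "\<bar>j\<bar> \<le> int i" using ij by (simp add: kitrick_index_def)
      then show ?thesis unfolding F even_face [OF w ij, symmetric] using w ij(2) by blast
    next
      assume "F \<in> {convex hull {kitrick_point n T i (j - 1), kitrick_point n T i (j + 1), kitrick_point n T (i + 1) j} |T i j.
        T \<in> (\<lambda>w. (w c0, w a0, w b0)) ` W \<and> kitrick_index n i (j - 1) \<and> kitrick_index n i (j + 1) \<and> i < n}"
      then obtain w i j where w: "w \<in> W" and ij: "kitrick_index n i (j - 1)" "kitrick_index n i (j + 1)" "i < n"
        and F: "F = convex hull {kitrick_point n (w c0, w a0, w b0) i (j - 1),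
          kitrick_point n (w c0, w a0, w b0) i (j + 1), kitrick_point n (w c0, w a0, w b0) (i + 1) j}"
        by blast
      have "\<bar>j\<bar> \<le> int i" using ij unfolding kitrick_index_def by linarith
      then show ?thesis unfolding F odd_face [OF w ij, symmetric] using w ij(3) by blast
    qed
  next
    fix F assume "F \<in> ?R"
    then obtain w i j where w: "w \<in> W" and ij: "i < n" "\<bar>j\<bar> \<le> int i" and F: "F = w ` face n i j" by blast
    show "F \<in> kitrick_faces n"
    proof (cases "even (j - int i)")
      case True
      then have "kitrick_index n i j" using ij by (simp add: kitrick_index_def)
      then show ?thesis unfolding kitrick_faces_def base_triangles_eq F
        using even_face [OF w _ ij(1)] w ij(1) by blast
    next
      case False
      then have "kitrick_index n i (j - 1)" "kitrick_index n i (j + 1)"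
        using ij odd_bound [OF False ij(2)] by (auto simp: kitrick_index_def)
      then show ?thesis unfolding kitrick_faces_def base_triangles_eq F
        using odd_face [OF w _ _ ij(1)] w ij(1) by blast
    qed
  qed
qed

text \<open>A line meets a sphere in at most two points.\<close>

lemma affine_independent_unit:
  fixes p q r :: "'a::euclidean_space"
  assumes unit: "norm p = 1" "norm q = 1" "norm r = 1" and ne: "p \<noteq> q" "p \<noteq> r" "q \<noteq> r"
  shows "\<not> affine_dependent {p, q, r}"
proof
  assume "affine_dependent {p, q, r}"
  then have "collinear {p, q, r}" by (simp add: collinear_3_eq_affine_dependent)
  then have "p \<in> closed_segment q r \<or> q \<in> closed_segment r p \<or> r \<in> closed_segment p q"
    by (simp add: collinear_between_cases between_mem_segment)
  moreover have "x \<in> {y, z}" if "x \<in> closed_segment y z" "norm x = 1" "norm y = 1" "norm z = 1" for x y z :: 'a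
  proof (rule unit_in_convex_hull_unit)
    show "x \<in> convex hull {y, z}" using that(1) by (simp only: segment_convex_hull)
  qed (use that in auto)
  ultimately show False using unit ne by blast
qed

context
  fixes n i :: nat and j :: int
  assumes ij: "i < n" "\<bar>j\<bar> \<le> int i"
begin

lemma n_pos: "0 < n"
  using ij by simp

lemma norm_zz: "norm (zz n i k) = 1"
  by (simp add: zz_def norm_gp [OF n_pos])

lemma zz_distinct: "zz n i (j - 1) \<noteq> zz n i j" "zz n i (j - 1) \<noteq> zz n i (j + 1)" "zz n i j \<noteq> zz n i (j + 1)"
proof -
  have comp: "zz n i k $ 2 = sin (glat n k)" for k by (simp add: zz_def gp_def pt_components)
  have less: "sin (glat n k) < sin (glat n l)" if "k < l" "- int n \<le> k" "l \<le> int n" for k l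
    using glat_less [OF n_pos that] glat_bounds [OF n_pos, of k] glat_bounds [OF n_pos, of l]
    by (intro sin_monotone_2pi) auto
  have j: "- int n \<le> j - 1" "j + 1 \<le> int n" using ij by auto
  have "sin (glat n (j - 1)) < sin (glat n j)" "sin (glat n j) < sin (glat n (j + 1))"
    using j by (auto intro!: less)
  then have "zz n i (j - 1) $ 2 < zz n i j $ 2" "zz n i j $ 2 < zz n i (j + 1) $ 2" by (simp_all only: comp)
  then show "zz n i (j - 1) \<noteq> zz n i j" "zz n i (j - 1) \<noteq> zz n i (j + 1)" "zz n i j \<noteq> zz n i (j + 1)" by auto
qed

lemma face_independent: "\<not> affine_dependent {zz n i (j - 1), zz n i j, zz n i (j + 1)}"
  by (rule affine_independent_unit) (simp_all only: norm_zz zz_distinct not_False_eq_True)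

lemma aff_dim_face: "aff_dim (face n i j) = 2"
proof -
  have "card {zz n i (j - 1), zz n i j, zz n i (j + 1)} = 3" using zz_distinct by simp
  then show ?thesis
    using aff_dim_affine_independent [OF face_independent]
    by (simp add: face_def face_vertices_def aff_dim_convex_hull)
qed

lemma zz_bounds:
  assumes k: "k \<in> {j - 1, j, j + 1}"
  shows "0 \<le> zz n i k $ 1" "0 \<le> hgt (zz n i k)" "0 \<le> hgt (s2 (zz n i k))"
    "zz n i k = gp n i k \<Longrightarrow> 0 < zz n i k $ 1"
    "\<exists>c \<in> {i, i + 1}. zz n i k = gp n c k \<and> kitrick_index n c k"
proof -
  obtain c where c: "c \<in> {i, i + 1}" "zz n i k = gp n c k" "kitrick_index n c k"
  proof (cases "k = j")
    case True
    then show ?thesis using zz_index(1) [OF ij] by (intro that) (auto simp: zz_def)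
  next
    case False
    then have "even (k - int i) \<longleftrightarrow> odd (j - int i)" using k by auto
    then show ?thesis using zz_index(2,3) [OF ij] k False
      by (intro that [of "if even (j - int i) then i + 1 else i"]) (auto simp: zz_def)
  qed
  then have b: "\<bar>k\<bar> \<le> int c" "c \<le> n" by (auto simp: kitrick_index_def)
  show "0 \<le> zz n i k $ 1" unfolding c(2) using gp_first_component(1) [OF n_pos b(2)] .
  show "0 \<le> hgt (zz n i k)" unfolding c(2) using hgt_gp(1) [OF n_pos b] .
  show "0 \<le> hgt (s2 (zz n i k))" unfolding c(2) s2_gp [OF n_pos] using hgt_gp(1) [OF n_pos _ b(2), of "- k"] b(1) by simp
  show "zz n i k = gp n i k \<Longrightarrow> 0 < zz n i k $ 1" using gp_first_component(2) [OF n_pos _ ij(1)] ij(1) by simp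
  show "\<exists>c \<in> {i, i + 1}. zz n i k = gp n c k \<and> kitrick_index n c k" using c by blast
qed

lemma linear_hgt: "linear hgt"
  by (intro linearI) (simp_all add: hgt_def algebra_simps)

text \<open>For each of these functionals some vertex of the face is strictly on the positive side.
  The mirror of \<open>root2\<close> cannot be included, since faces may cross the equator; hence
  the exceptions for \<open>s2\<close> in the equality cases.\<close>

lemma positive_combination_interior:
  assumes abc: "0 < a" "0 < b" "0 < c"
    and nu: "\<nu> = a *\<^sub>R zz n i (j - 1) + b *\<^sub>R zz n i j + c *\<^sub>R zz n i (j + 1)"
  shows "0 < \<nu> $ 1" "0 < hgt \<nu>" "0 < hgt (s2 \<nu>)"
proof -
  let ?q = "zz n i (j - 1)" and ?p = "zz n i j" and ?r = "zz n i (j + 1)"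
  have nonneg: "0 \<le> ?q $ 1" "0 \<le> ?p $ 1" "0 \<le> ?r $ 1" "0 \<le> hgt ?q" "0 \<le> hgt ?p" "0 \<le> hgt ?r"
    "0 \<le> hgt (s2 ?q)" "0 \<le> hgt (s2 ?p)" "0 \<le> hgt (s2 ?r)"
    using zz_bounds by auto
  have sum_pos: "0 < a * x + b * y + c * z"
    if "0 \<le> x" "0 \<le> y" "0 \<le> z" "0 < x \<or> 0 < y \<or> 0 < z" for x y z
  proof -
    have "0 \<le> a * x" "0 \<le> b * y" "0 \<le> c * z" "0 < a * x \<or> 0 < b * y \<or> 0 < c * z"
      using that abc by auto
    then show ?thesis by linarith
  qed
  have "0 < ?q $ 1 \<or> 0 < ?p $ 1 \<or> 0 < ?r $ 1"
  proof (cases "even (j - int i)")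
    case True
    then show ?thesis using zz_bounds(4) [of j] zz_even [OF True] by simp
  next
    case False
    then show ?thesis using zz_bounds(4) [of "j - 1"] zz_neighbours(3) [OF False] by simp
  qed
  then show "0 < \<nu> $ 1" using sum_pos [OF nonneg(1-3)] by (simp add: nu)
  obtain c1 c2 where c: "?q = gp n c1 (j - 1)" "kitrick_index n c1 (j - 1)" "?r = gp n c2 (j + 1)" "kitrick_index n c2 (j + 1)"
    "c1 = c2"
    using zz_index(2,3) [OF ij]
    by (intro that [of "if even (j - int i) then i + 1 else i" "if even (j - int i) then i + 1 else i"])
      (auto simp: zz_def)
  have "0 < hgt ?q"
    unfolding c(1) using c(2,4,5) by (intro hgt_gp(2) [OF n_pos]) (auto simp: kitrick_index_def)
  then have "0 < a * hgt ?q + b * hgt ?p + c * hgt ?r" using sum_pos [OF nonneg(4-6)] by blast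
  then show "0 < hgt \<nu>" by (simp add: nu linear_add linear_cmul linear_hgt)
  have "0 < hgt (s2 ?r)"
    unfolding c(3) s2_gp [OF n_pos] using c(2,4,5) by (intro hgt_gp(2) [OF n_pos]) (auto simp: kitrick_index_def)
  then have "0 < a * hgt (s2 ?q) + b * hgt (s2 ?p) + c * hgt (s2 ?r)" using sum_pos [OF nonneg(7-9)] by blast
  then show "0 < hgt (s2 \<nu>)" by (simp add: nu linear_add linear_cmul linear_hgt W_linear [OF s2_in_W])
qed

lemma edge_bounds:
  assumes "(p, q) \<in> edge_pairs n \<or> (q, p) \<in> edge_pairs n"
  shows "cos (2 * glat n 1) \<le> p \<bullet> q \<and> p \<bullet> q \<le> cos (step n)"
  using assms edge_pairs_inner [OF n_pos, of p q] edge_pairs_inner [OF n_pos, of q p] by (auto simp: inner_commute)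

text \<open>The squared chords have the ratio \<open>4 * s36\<^sup>2 * (cos t)\<^sup>2\<close>, and
  4 sin^2 36 = 3 - golden is less than 2. This is the acuteness required by
  \<open>circumnormal\<close>.\<close>

lemma acute_bounds: "0 < cos (2 * glat n 1)" "cos (step n) < 1" "1 - cos (2 * glat n 1) < 2 * (1 - cos (step n))"
proof -
  show "0 < cos (2 * glat n 1)" using glat_1_bounds [OF n_pos] by (intro cos_gt_zero_pi) auto
  define t where "t = step n / 2"
  have t: "0 < t" "t < pi" using step_pos [OF n_pos] step_bound [OF n_pos] pi_gt3 by (simp_all add: t_def)
  then have "0 < sin t" by (rule sin_gt_zero)
  then have pos: "0 < (sin t)\<^sup>2" by simp
  have "cos (step n) = cos (2 * t)" by (simp add: t_def)
  then have c: "1 - cos (step n) = 2 * (sin t)\<^sup>2" by (simp add: cos_double_sin)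
  then show "cos (step n) < 1" using pos by linarith
  have "sin (step n) = 2 * sin t * cos t" using sin_double [of t] by (simp add: t_def)
  then have "(sin (glat n 1))\<^sup>2 = s36\<^sup>2 * (4 * (sin t)\<^sup>2 * (cos t)\<^sup>2)"
    by (simp add: glat_def sin_lat power_mult_distrib)
  then have "1 - cos (2 * glat n 1) = (2 * (sin t)\<^sup>2) * (4 * s36\<^sup>2 * (cos t)\<^sup>2)" by (simp add: cos_double_sin)
  also have "\<dots> < (2 * (sin t)\<^sup>2) * 2"
  proof (rule mult_strict_left_mono)
    have "4 * s36\<^sup>2 * (cos t)\<^sup>2 \<le> 4 * s36\<^sup>2 * 1" by (intro mult_left_mono) (simp_all add: cos_squared_eq)
    moreover have "4 * s36\<^sup>2 < 2" unfolding s36_sq using golden_bounds by simp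
    ultimately show "4 * s36\<^sup>2 * (cos t)\<^sup>2 < 2" by linarith
  qed (use pos in simp)
  finally show "1 - cos (2 * glat n 1) < 2 * (1 - cos (step n))" unfolding c by linarith
qed

lemma face_support:
  obtains \<nu> d where "0 < d" "\<And>v. v \<in> kitrick_vertices n \<Longrightarrow> \<nu> \<bullet> v \<le> d"
    "kitrick_vertices n \<inter> {v. \<nu> \<bullet> v = d} = face_vertices n i j"
proof -
  let ?q = "zz n i (j - 1)" and ?p = "zz n i j" and ?r = "zz n i (j + 1)"
  obtain \<nu> d a b c where nu: "0 < a" "0 < b" "0 < c" "\<nu> = a *\<^sub>R ?q + b *\<^sub>R ?p + c *\<^sub>R ?r" "0 < d"
    "\<nu> \<bullet> ?q = d" "\<nu> \<bullet> ?p = d" "\<nu> \<bullet> ?r = d"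
  proof (rule circumnormal [of ?q ?p ?r "cos (2 * glat n 1)" "cos (step n)"])
    fix x assume "x \<in> {?p \<bullet> ?r, ?r \<bullet> ?q, ?q \<bullet> ?p}"
    then show "cos (2 * glat n 1) \<le> x \<and> x \<le> cos (step n)"
      using edge_bounds [of ?p ?r] edge_bounds [of ?r ?q] edge_bounds [of ?q ?p] face_edges [OF ij] by auto
  qed (use norm_zz acute_bounds in auto)
  note interior = positive_combination_interior [OF nu(1-4)]
  \<comment> \<open>\<open>\<sigma>\<close> folds the normal vector into the northern half and
    thereby into the chamber.\<close>
  obtain \<sigma> where \<sigma>: "\<sigma> = (\<lambda>x. x) \<or> \<sigma> = s2" "0 \<le> \<sigma> \<nu> $ 2"
  proof -
    have "s2 \<nu> $ 2 = - \<nu> $ 2" by (simp add: reflect_def root2_def inner_vec_def sum_3)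
    then show ?thesis using that [of "\<lambda>x. x"] that [of s2] by (cases "0 \<le> \<nu> $ 2") auto
  qed
  have \<sigma>W: "\<sigma> \<in> W" "\<And>x. \<sigma> (\<sigma> x) = x" using \<sigma>(1) W_id s2_in_W by (auto simp: reflect_reflect)
  have "s2 \<nu> $ 1 = \<nu> $ 1" by (simp add: reflect_def root2_def inner_vec_def sum_3)
  then have \<sigma>\<nu>: "0 < \<sigma> \<nu> $ 1" "0 < hgt (\<sigma> \<nu>)" "\<sigma> \<nu> \<in> chamber"
    using \<sigma> interior by (auto simp: chamber_def)
  have s2_grid: "\<nu> \<bullet> gp n k l \<le> d" "\<nu> \<bullet> gp n k l = d \<Longrightarrow> gp n k l \<in> face_vertices n i j" if "kitrick_index n k l" for k l
    using local_delaunay [OF ij nu(1-4) nu(6-8) that] nu(6-8) by (auto simp: face_vertices_def)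
  have idx: "kitrick_index n k (- l)" if "kitrick_index n k l" for k l
    using that by (auto simp: kitrick_index_def)
  have main: "\<nu> \<bullet> w (gp n k l) \<le> d \<and> (\<nu> \<bullet> w (gp n k l) = d \<longrightarrow> w (gp n k l) \<in> face_vertices n i j)"
    if w: "w \<in> W" and kl: "kitrick_index n k l" "0 \<le> l" for w k l
  proof -
    have "gp n k l \<in> chamber" using kl by (intro gp_in_chamber [OF n_pos]) (auto simp: kitrick_index_def)
    define u where "u = (\<lambda>x. \<sigma> (w x))"
    have u: "u \<in> W" unfolding u_def by (rule W_compose [OF \<sigma>W(1) w])
    have eq: "\<nu> \<bullet> w x = \<sigma> \<nu> \<bullet> u x" for x using W_inner [OF \<sigma>W(1), of \<nu> "w x"] by (simp add: u_def)
    have le: "\<sigma> \<nu> \<bullet> u (gp n k l) \<le> \<sigma> \<nu> \<bullet> gp n k l"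
      by (rule W_inner_le [OF u \<open>gp n k l \<in> chamber\<close> \<sigma>\<nu>(3)])
    have \<sigma>gp: "\<sigma> (gp n k l) = gp n k l \<or> \<sigma> (gp n k l) = gp n k (- l)"
      using \<sigma>(1) s2_gp [OF n_pos] by auto
    have "\<sigma> \<nu> \<bullet> gp n k l = \<nu> \<bullet> \<sigma> (gp n k l)"
      using W_inner [OF \<sigma>W(1), of \<nu> "\<sigma> (gp n k l)"] by (simp add: \<sigma>W(2))
    also have "\<dots> \<le> d" using \<sigma>gp s2_grid(1) [OF kl(1)] s2_grid(1) [OF idx [OF kl(1)]] by auto
    finally have le': "\<sigma> \<nu> \<bullet> gp n k l \<le> d" .
    have "w (gp n k l) \<in> face_vertices n i j" if "\<nu> \<bullet> w (gp n k l) = d"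
    proof -
      \<comment> \<open>Equality in the dominance inequality leaves the identity and
        \<open>s2\<close>, so the vertex is one of the same base triangle.\<close>
      have "\<sigma> \<nu> \<bullet> u (gp n k l) = \<sigma> \<nu> \<bullet> gp n k l" using that le le' unfolding eq by linarith
      then have "u (gp n k l) = gp n k l \<or> u (gp n k l) = s2 (gp n k l)"
        using W_inner_eq [OF u \<open>gp n k l \<in> chamber\<close> \<sigma>\<nu>(3) _ \<sigma>\<nu>(1,2)] by blast
      then have "\<sigma> (w (gp n k l)) = gp n k l \<or> \<sigma> (w (gp n k l)) = gp n k (- l)"
        using s2_gp [OF n_pos] by (simp add: u_def)
      then have "w (gp n k l) = gp n k l \<or> w (gp n k l) = gp n k (- l)"
        using \<sigma>(1) s2_gp [OF n_pos] by (metis \<sigma>W(2) minus_minus)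
      then show ?thesis using that s2_grid(2) [OF kl(1)] s2_grid(2) [OF idx [OF kl(1)]] by auto
    qed
    then show ?thesis using le le' eq by simp
  qed
  have bound: "\<nu> \<bullet> v \<le> d \<and> (\<nu> \<bullet> v = d \<longrightarrow> v \<in> face_vertices n i j)" if v: "v \<in> kitrick_vertices n" for v
  proof -
    obtain w k l where w: "w \<in> W" "kitrick_index n k l" "v = w (gp n k l)"
      using v unfolding kitrick_vertices_eq [OF n_pos] by blast
    show ?thesis
    proof (cases "0 \<le> l")
      case True
      then show ?thesis using main [OF w(1,2)] w(3) by simp
    next
      case False
      have "v = w (s2 (gp n k (- l)))" by (simp add: w(3) s2_gp [OF n_pos])
      then show ?thesis using main [OF W_compose [OF w(1) s2_in_W] idx [OF w(2)]] False by simp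
    qed
  qed
  have "v \<in> kitrick_vertices n" if v: "v \<in> face_vertices n i j" for v
  proof -
    obtain k where k: "k \<in> {j - 1, j, j + 1}" "v = zz n i k" using v by (auto simp: face_vertices_def)
    then obtain c where "zz n i k = gp n c k" "kitrick_index n c k" using zz_bounds(5) by blast
    then show ?thesis unfolding kitrick_vertices_eq [OF n_pos] k(2) using W_id by fastforce
  qed
  moreover have "\<nu> \<bullet> v = d" if "v \<in> face_vertices n i j" for v
    using that nu(6-8) by (auto simp: face_vertices_def)
  ultimately have "kitrick_vertices n \<inter> {v. \<nu> \<bullet> v = d} = face_vertices n i j" using bound by blast
  then show thesis using that [of d \<nu>] nu(5) bound by blast
qed

end

section \<open>The convex hull of the vertices, its facets and its edges\<close>

definition kitrick_hull :: "nat \<Rightarrow> (real^3) set" where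
  "kitrick_hull n = convex hull (kitrick_vertices n)"

context
  fixes n :: nat
  assumes n: "0 < n"
begin

lemma finite_kitrick_vertices: "finite (kitrick_vertices n)"
proof (rule finite_subset)
  show "kitrick_vertices n \<subseteq> (\<lambda>(w, k, l). w (gp n k l)) ` (W \<times> {..n} \<times> {- int n..int n})"
  proof
    fix v assume "v \<in> kitrick_vertices n"
    then obtain w k l where w: "w \<in> W" "kitrick_index n k l" "v = w (gp n k l)"
      unfolding kitrick_vertices_eq [OF n] by blast
    then have "(w, k, l) \<in> W \<times> {..n} \<times> {- int n..int n}" by (auto simp: kitrick_index_def)
    then show "v \<in> (\<lambda>(w, k, l). w (gp n k l)) ` (W \<times> {..n} \<times> {- int n..int n})"
      by (intro image_eqI [of _ _ "(w, k, l)"]) (simp_all add: w(3))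
  qed
  show "finite ((\<lambda>(w, k, l). w (gp n k l)) ` (W \<times> {..n} \<times> {- int n..int n}))"
    by (intro finite_imageI finite_cartesian_product finite_W) auto
qed

lemma kitrick_vertices_sphere: "kitrick_vertices n \<subseteq> sphere 0 1"
  unfolding kitrick_vertices_eq [OF n] using W_norm norm_gp [OF n] by auto

lemma W_kitrick_vertices: "w \<in> W \<Longrightarrow> w ` kitrick_vertices n = kitrick_vertices n"
proof (rule W_image_eq)
  fix w v assume w: "w \<in> W" and v: "v \<in> kitrick_vertices n"
  obtain u k l where u: "u \<in> W" "kitrick_index n k l" "v = u (gp n k l)"
    using v unfolding kitrick_vertices_eq [OF n] by blast
  show "w v \<in> kitrick_vertices n"
    unfolding kitrick_vertices_eq [OF n] u(3)
    by (intro CollectI exI [of _ "\<lambda>x. w (u x)"] exI [of _ k] exI [of _ l]) (simp add: W_compose [OF w u(1)] u(2))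
qed

lemma W_kitrick_hull: "w \<in> W \<Longrightarrow> w ` kitrick_hull n = kitrick_hull n"
  by (simp add: kitrick_hull_def orth_hull W_orth W_kitrick_vertices)

lemma face_facet:
  assumes ij: "i < n" "\<bar>j\<bar> \<le> int i"
  shows "face n i j facet_of kitrick_hull n"
proof -
  obtain \<nu> d where nu: "0 < d" "\<And>v. v \<in> kitrick_vertices n \<Longrightarrow> \<nu> \<bullet> v \<le> d"
    "kitrick_vertices n \<inter> {v. \<nu> \<bullet> v = d} = face_vertices n i j"
    using face_support [OF ij] by metis
  have face: "face n i j face_of kitrick_hull n"
    using convex_hull_Int_supporting_hyperplane [OF finite_kitrick_vertices nu(2)]
    unfolding face_def kitrick_hull_def nu(3) by metis
  have plane: "face n i j \<subseteq> {v. \<nu> \<bullet> v = d}"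
    using convex_hull_Int_supporting_hyperplane(2) [OF finite_kitrick_vertices nu(2)]
    unfolding face_def nu(3) by blast
  have "face n i j \<noteq> kitrick_hull n"
  proof
    assume eq: "face n i j = kitrick_hull n"
    \<comment> \<open>The face is proper, because the antipodal vertices \<open>c0\<close> and
      \<open>- c0\<close> cannot both lie on a plane \<open>\<nu> \<bullet> v = d\<close> with d >
      0.\<close>
    obtain w where w: "w \<in> W" "w ctr = vector [- 1, 0, - golden]"
      using W_transitive_centres [of "vector [- 1, 0, - golden]"] by (auto simp: centres12_def)
    have "w ctr = - ctr" unfolding w(2) by (simp add: ctr_def vec_eq_iff forall_3)
    then have "w c0 = - c0" unfolding W_c0 [OF w(1)] by (simp add: c0_def sgn_minus)
    moreover have "kitrick_index n 0 0" by (simp add: kitrick_index_def)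
    then have mem: "v c0 \<in> kitrick_vertices n" if "v \<in> W" for v
      unfolding kitrick_vertices_eq [OF n] gp_0 [of n, symmetric]
      by (intro CollectI exI [of _ v] exI [of _ 0]) (simp add: that \<open>kitrick_index n 0 0\<close>)
    have "c0 \<in> kitrick_hull n" "w c0 \<in> kitrick_hull n"
      using mem [OF W_id] mem [OF w(1)] by (simp_all add: kitrick_hull_def hull_inc)
    ultimately have "\<nu> \<bullet> c0 = d" "\<nu> \<bullet> (- c0) = d" using plane unfolding eq by auto
    then show False using nu(1) by simp
  qed
  moreover have "convex (kitrick_hull n)" by (simp add: kitrick_hull_def)
  ultimately have "aff_dim (face n i j) < aff_dim (kitrick_hull n)"
    using face by (intro face_of_aff_dim_lt)
  moreover have "aff_dim (kitrick_hull n) \<le> 3" using aff_dim_le_DIM [of "kitrick_hull n"] by simp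
  moreover have "face n i j \<noteq> {}" by (simp add: face_def face_vertices_def)
  ultimately show ?thesis using face by (simp add: facet_of_def aff_dim_face [OF ij])
qed

lemma kitrick_faces_cases:
  assumes "F \<in> kitrick_faces n"
  obtains w i j where "w \<in> W" "i < n" "\<bar>j\<bar> \<le> int i" "F = w ` face n i j"
  using assms unfolding kitrick_faces_eq [OF n] by blast

lemma kitrick_face_facet: "F \<in> kitrick_faces n \<Longrightarrow> F facet_of kitrick_hull n"
proof (elim kitrick_faces_cases)
  fix w i j assume w: "w \<in> W" "i < n" "\<bar>j\<bar> \<le> int i" "F = w ` face n i j"
  then have "w ` face n i j facet_of w ` kitrick_hull n"
    by (simp add: facet_of_orth_image W_orth face_facet)
  then show ?thesis by (simp add: w(4) W_kitrick_hull [OF w(1)])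
qed

lemma kitrick_faces_cover:
  fixes x :: "real^3"
  assumes "x \<noteq> 0"
  shows "\<exists>F\<in>kitrick_faces n. \<exists>t>0. t *\<^sub>R x \<in> F"
proof -
  obtain w where w: "w \<in> W" "w x \<in> chamber" using W_cover by blast
  have "w x \<noteq> 0" using W_norm [OF w(1), of x] assms by auto
  then obtain i j t where ij: "i < n" "\<bar>j\<bar> \<le> int i" and t: "0 < t" "t *\<^sub>R w x \<in> face n i j"
    using chamber_covered [OF n w(2)] by blast
  obtain u where u: "u \<in> W" "\<And>x. u (w x) = x" using W_inverse [OF w(1)] by metis
  have "t *\<^sub>R x = u (t *\<^sub>R w x)" by (simp add: linear_cmul W_linear u)
  then have "t *\<^sub>R x \<in> u ` face n i j" using t(2) by blast
  moreover have "u ` face n i j \<in> kitrick_faces n" unfolding kitrick_faces_eq [OF n] using u(1) ij by blast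
  ultimately show ?thesis using t(1) by blast
qed

lemma convex_kitrick_hull: "convex (kitrick_hull n)"
  by (simp add: kitrick_hull_def)

lemma facet_of_kitrick_hull: "F facet_of kitrick_hull n \<longleftrightarrow> F \<in> kitrick_faces n"
  by (rule facet_of_cover [OF convex_kitrick_hull kitrick_face_facet kitrick_faces_cover])

lemma aff_dim_kitrick_hull: "aff_dim (kitrick_hull n) = 3"
  using aff_dim_cover [OF convex_kitrick_hull kitrick_face_facet kitrick_faces_cover] by simp

lemma kitrick_face_triangle:
  assumes "F \<in> kitrick_faces n"
  obtains p q r where "F = convex hull {p, q, r}" "\<not> affine_dependent {p, q, r}" "p \<noteq> q" "p \<noteq> r" "q \<noteq> r"
    "closed_segment p q \<in> kitrick_edges n" "closed_segment p r \<in> kitrick_edges n" "closed_segment q r \<in> kitrick_edges n"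
proof -
  obtain w i j where w: "w \<in> W" and ij: "i < n" "\<bar>j\<bar> \<le> int i" and F: "F = w ` face n i j"
    using assms kitrick_faces_cases by blast
  let ?q = "zz n i (j - 1)" and ?p = "zz n i j" and ?r = "zz n i (j + 1)"
  have "inj w" by (rule orth_inj [OF W_orth [OF w]])
  then have ne: "w ?q \<noteq> w ?p" "w ?q \<noteq> w ?r" "w ?p \<noteq> w ?r" using zz_distinct [OF ij] by (simp_all add: inj_eq)
  have edge: "closed_segment (w x) (w y) \<in> kitrick_edges n" if "(x, y) \<in> edge_pairs n \<or> (y, x) \<in> edge_pairs n" for x y
  proof -
    have "closed_segment (w x) (w y) \<in> kitrick_edges n" if "(x, y) \<in> edge_pairs n" for x y
      unfolding kitrick_edges_eq [OF n] using that w by blast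
    then show ?thesis using that by (metis closed_segment_commute)
  qed
  show thesis
  proof (rule that [of "w ?q" "w ?p" "w ?r"])
    show "F = convex hull {w ?q, w ?p, w ?r}" unfolding F by (rule W_face [OF w])
    show "\<not> affine_dependent {w ?q, w ?p, w ?r}"
      by (rule affine_independent_unit) (simp_all only: W_norm [OF w] norm_zz [OF ij] ne not_False_eq_True)
    show "closed_segment (w ?q) (w ?p) \<in> kitrick_edges n" "closed_segment (w ?q) (w ?r) \<in> kitrick_edges n"
      "closed_segment (w ?p) (w ?r) \<in> kitrick_edges n"
      using face_edges [OF ij] by (auto intro!: edge)
  qed (fact ne)+
qed

lemma kitrick_face_simplex: "F \<in> kitrick_faces n \<Longrightarrow> 2 simplex F"
  by (elim kitrick_face_triangle) (simp add: triangle_simplex)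

text \<open>A proper face of a polyhedron lies in a facet; here the facets are triangles with known
  edges.\<close>

lemma edge_of_kitrick_hull:
  assumes "E edge_of kitrick_hull n"
  shows "E \<in> kitrick_edges n"
proof -
  have E: "E face_of kitrick_hull n" "aff_dim E = 1" using assms by (auto simp: edge_of_def)
  have "polyhedron (kitrick_hull n)"
    unfolding kitrick_hull_def using finite_kitrick_vertices by (intro polytope_imp_polyhedron polytope_convex_hull)
  moreover have "E \<noteq> {}" "E \<noteq> kitrick_hull n" using E(2) aff_dim_kitrick_hull by auto
  ultimately obtain F where F: "F facet_of kitrick_hull n" "E \<subseteq> F"
    using face_of_polyhedron_subset_facet E(1) by metis
  have "F \<subseteq> kitrick_hull n" using F(1) by (rule facet_of_imp_subset)
  then have "E face_of F" by (rule face_of_subset [OF E(1) F(2)])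
  then have edge: "E edge_of F" using E(2) by (simp add: edge_of_def)
  obtain p q r where pqr: "F = convex hull {p, q, r}" "\<not> affine_dependent {p, q, r}"
    "closed_segment p q \<in> kitrick_edges n" "closed_segment p r \<in> kitrick_edges n" "closed_segment q r \<in> kitrick_edges n"
    using F(1) unfolding facet_of_kitrick_hull by (elim kitrick_face_triangle) blast
  have "E \<in> {closed_segment p q, closed_segment p r, closed_segment q r}"
    using edge_of_triangle [OF pqr(2)] edge unfolding pqr(1) by blast
  then show ?thesis using pqr(3-5) by auto
qed

lemma kitrick_hull_has_edge: "\<exists>E. E edge_of kitrick_hull n"
proof -
  have "face n 0 0 facet_of kitrick_hull n" using n by (intro face_facet) auto
  then have "face n 0 0 \<in> kitrick_faces n" by (simp add: facet_of_kitrick_hull)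
  then obtain p q r where pqr: "face n 0 0 = convex hull {p, q, r}" "\<not> affine_dependent {p, q, r}" "p \<noteq> q"
    by (elim kitrick_face_triangle) blast
  have "closed_segment p q edge_of face n 0 0" unfolding pqr(1) by (rule segment_edge_of_triangle [OF pqr(2,3)])
  then have "closed_segment p q edge_of kitrick_hull n"
    using facet_of_imp_face_of [OF \<open>face n 0 0 facet_of kitrick_hull n\<close>] face_of_trans by (auto simp: edge_of_def)
  then show ?thesis ..
qed

lemma finite_edge_pairs: "finite (edge_pairs n)"
proof -
  let ?G = "(\<lambda>(k, l). gp n k l) ` ({..n} \<times> {- int n..int n})"
  have mem: "gp n k l \<in> ?G" if "kitrick_index n k l" for k l
    using that by (intro image_eqI [of _ _ "(k, l)"]) (auto simp: kitrick_index_def)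
  have up: "kitrick_index n (i + 1) (j + 1)" "kitrick_index n (i + 1) (j - 1)" if "kitrick_index n i j" "i < n" for i j
    using that by (auto simp: kitrick_index_def)
  have "edge_pairs n \<subseteq> ?G \<times> ?G"
    unfolding edge_pairs_def using mem up by blast
  moreover have "finite (?G \<times> ?G)" by (intro finite_cartesian_product finite_imageI) auto
  ultimately show ?thesis by (rule finite_subset)
qed

lemma kitrick_edge_diameter:
  assumes "E \<in> kitrick_edges n"
  obtains p q where "(p, q) \<in> edge_pairs n" "diameter E = dist p q"
proof -
  obtain w p q where w: "w \<in> W" "(p, q) \<in> edge_pairs n" "E = closed_segment (w p) (w q)"
    using assms unfolding kitrick_edges_eq [OF n] by blast
  have "dist (w p) (w q) = dist p q"
    using W_norm [OF w(1), of "p - q"] by (simp add: dist_norm linear_diff [OF W_linear [OF w(1)]])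
  then show thesis using that [OF w(2)] by (simp add: w(3) diameter_closed_segment)
qed

lemma diameter_kitrick_edges: "diameter ` kitrick_edges n = (\<lambda>(p, q). dist p q) ` edge_pairs n"
proof (intro subset_antisym subsetI)
  fix x assume "x \<in> diameter ` kitrick_edges n"
  then show "x \<in> (\<lambda>(p, q). dist p q) ` edge_pairs n" by (auto elim!: kitrick_edge_diameter)
next
  fix x assume "x \<in> (\<lambda>(p, q). dist p q) ` edge_pairs n"
  then obtain p q where pq: "(p, q) \<in> edge_pairs n" "x = dist p q" by auto
  have "closed_segment p q \<in> kitrick_edges n" unfolding kitrick_edges_eq [OF n]
    by (intro CollectI exI [of _ "\<lambda>x. x"] exI [of _ p] exI [of _ q]) (simp add: W_id pq(1))
  then show "x \<in> diameter ` kitrick_edges n" by (intro image_eqI) (simp_all add: pq(2) diameter_closed_segment)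
qed

lemma apex_edge_pairs: "(gp n 0 0, gp n 1 1) \<in> edge_pairs n" "(gp n 0 0, gp n 1 (- 1)) \<in> edge_pairs n"
  "(gp n 1 (- 1), gp n 1 1) \<in> edge_pairs n"
proof -
  have "kitrick_index n 0 0" "kitrick_index n 1 (0 - 1)" "kitrick_index n 1 (0 + 1)" using n by (auto simp: kitrick_index_def)
  then have "(gp n 0 0, gp n (0 + 1) (0 + 1)) \<in> edge_pairs n" "(gp n 0 0, gp n (0 + 1) (0 - 1)) \<in> edge_pairs n"
    "(gp n 1 (0 - 1), gp n 1 (0 + 1)) \<in> edge_pairs n"
    unfolding edge_pairs_def using n by blast+
  then show "(gp n 0 0, gp n 1 1) \<in> edge_pairs n" "(gp n 0 0, gp n 1 (- 1)) \<in> edge_pairs n"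
    "(gp n 1 (- 1), gp n 1 1) \<in> edge_pairs n" by simp_all
qed

lemma Max_Min_kitrick_edges:
  "Max (diameter ` kitrick_edges n) = 2 * s36 * sin (step n)"
  "Min (diameter ` kitrick_edges n) = 2 * sin (step n / 2)"
proof -
  have fin: "finite (diameter ` kitrick_edges n)" unfolding diameter_kitrick_edges using finite_edge_pairs by simp
  show "Max (diameter ` kitrick_edges n) = 2 * s36 * sin (step n)"
  proof (rule Max_eqI [OF fin])
    show "x \<le> 2 * s36 * sin (step n)" if "x \<in> diameter ` kitrick_edges n" for x
      using that edge_pairs_dist(2) [OF n] apex_lengths(3) [OF n] unfolding diameter_kitrick_edges by auto
    show "2 * s36 * sin (step n) \<in> diameter ` kitrick_edges n"
      unfolding diameter_kitrick_edges using apex_edge_pairs(3) apex_lengths(3) [OF n]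
      by (intro image_eqI [of _ _ "(gp n 1 (- 1), gp n 1 1)"]) (simp_all only: prod.case dist_commute)
  qed
  show "Min (diameter ` kitrick_edges n) = 2 * sin (step n / 2)"
  proof (rule Min_eqI [OF fin])
    show "2 * sin (step n / 2) \<le> x" if "x \<in> diameter ` kitrick_edges n" for x
      using that edge_pairs_dist(1) [OF n] apex_lengths(1) [OF n] unfolding diameter_kitrick_edges by auto
    show "2 * sin (step n / 2) \<in> diameter ` kitrick_edges n"
      unfolding diameter_kitrick_edges using apex_edge_pairs(1) apex_lengths(1) [OF n]
      by (intro image_eqI [of _ _ "(gp n 0 0, gp n 1 1)"]) (simp_all only: prod.case)
  qed
qed

lemma half_step: "0 < step n / 2" "step n / 2 < pi / 2" "0 < sin (step n / 2)"
proof -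
  show h: "0 < step n / 2" "step n / 2 < pi / 2" using step_pos [OF n] step_bound [OF n] pi_gt3 by auto
  then show "0 < sin (step n / 2)" by (intro sin_gt_zero) auto
qed

lemma kitrick_ratio_eq: "kitrick_ratio n = 2 * s36 * cos (step n / 2)"
proof -
  have "sin (step n) = 2 * sin (step n / 2) * cos (step n / 2)" using sin_double [of "step n / 2"] by simp
  then show ?thesis using half_step by (simp add: kitrick_ratio_def edge_ratio_def Max_Min_kitrick_edges)
qed

lemma kitrick_ratio_less: "kitrick_ratio n < 2 * s36"
proof -
  have "cos (step n / 2) < cos 0" using half_step by (intro cos_monotone_0_pi) auto
  then show ?thesis by (simp add: kitrick_ratio_eq)
qed

text \<open>An inclusion between the sets of edges suffices: on the smaller set the maximum can only
  decrease and the minimum only increase.\<close>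

lemma edge_ratio_kitrick_hull: "edge_ratio {E. E edge_of kitrick_hull n} \<le> kitrick_ratio n"
proof -
  let ?A = "diameter ` {E. E edge_of kitrick_hull n}" and ?B = "diameter ` kitrick_edges n"
  have fin: "finite ?B" unfolding diameter_kitrick_edges using finite_edge_pairs by simp
  have sub: "?A \<subseteq> ?B" using edge_of_kitrick_hull by blast
  have ne: "?A \<noteq> {}" using kitrick_hull_has_edge by blast
  have "Min ?B \<le> Min ?A" by (rule Min_antimono [OF sub ne fin])
  moreover have "Max ?A \<le> Max ?B" by (rule Max_mono [OF sub ne fin])
  moreover have "0 < Min ?B" unfolding Max_Min_kitrick_edges using half_step by simp
  moreover have "0 \<le> Max ?B" unfolding Max_Min_kitrick_edges using half_step step_pos [OF n] step_bound [OF n] pi_gt3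
    by (intro mult_nonneg_nonneg sin_ge_zero) auto
  ultimately show ?thesis unfolding kitrick_ratio_def edge_ratio_def by (intro frac_le) auto
qed

end

section \<open>The number of faces\<close>

text \<open>The midpoints are compared through the sums of the ends of the five edges, whose
  coordinates are visibly different.\<close>

lemma rot_power_mid_inject:
  assumes "k < 5" "l < 5" "(rot ^^ k) mid = (rot ^^ l) mid"
  shows "k = l"
proof -
  define s where "s k = (rot ^^ k) vtx + (rot ^^ k) vtx'" for k
  have mid: "(rot ^^ k) mid = (1 / (2 * golden)) *\<^sub>R s k" for k
    by (simp only: mid_eq s_def linear_add linear_cmul W_linear [OF rot_power_in_W])
  have "s k = s l" using assms(3) golden_pos unfolding mid by simp
  moreover have s: "s 0 = vector [0, 0, 2 * golden]" "s 1 = vector [1, golden, golden + 1]"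
    "s 2 = vector [golden + 1, 1, golden]" "s 3 = vector [golden + 1, - 1, golden]" "s 4 = vector [1, - golden, golden + 1]"
    by (simp_all add: s_def numeral_eq_Suc rot_gens vec_eq_iff forall_3) (simp_all add: gen_defs)
  moreover have "k \<in> {0, 1, 2, 3, 4}" "l \<in> {0, 1, 2, 3, 4}" using assms(1,2) by auto
  ultimately show ?thesis
    using golden_bounds by (elim insertE emptyE) (simp_all only: s vector3_eq_iff, simp_all)
qed

lemma card_centres12: "card centres12 = 12"
proof -
  have "golden \<noteq> 0" "golden \<noteq> 1" "golden \<noteq> - 1" "golden \<noteq> - golden" "- golden \<noteq> 1" "- golden \<noteq> golden"
    "0 \<noteq> golden" "1 \<noteq> golden" "- 1 \<noteq> golden" "1 \<noteq> - golden"
    using golden_bounds by auto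
  then show ?thesis unfolding centres12_def by (simp add: vector3_eq_iff)
qed

text \<open>Let x be \<open>ctr\<close> or \<open>mid\<close>. On the generators
  \<open>x \<bullet> w z\<close> is at most \<open>x \<bullet> z\<close>, with equality at y, where
  both \<open>ctr\<close> and \<open>mid\<close> have positive weight. Hence
  \<open>x \<bullet> w x = x \<bullet> x\<close>, and equal norms give w x = x.\<close>

lemma W_fixes_gens:
  assumes "w \<in> W" "w y = y" "y \<in> chamber" "0 < y $ 1" "0 < hgt y"
  shows "w ctr = ctr" "w mid = mid"
proof -
  have lin: "linear (\<lambda>y. x \<bullet> w y)" "linear (\<lambda>y. x \<bullet> y)" for x
    using linear_inner_W [OF assms(1)] linear_inner_W [OF W_id] by simp_all
  have self: "w x = x" if "x \<bullet> w x = x \<bullet> x" for x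
  proof -
    have "(w x - x) \<bullet> (w x - x) = 0"
      using that W_inner [OF assms(1), of x x] by (simp add: inner_diff_left inner_diff_right inner_commute)
    then show ?thesis by simp
  qed
  have fixed: "x \<bullet> w ctr = x \<bullet> ctr" "x \<bullet> w mid = x \<bullet> mid" if x: "x \<in> {ctr, vtx, mid}" "x \<bullet> w y = x \<bullet> y" for x
  proof -
    have "x \<bullet> w z \<le> x \<bullet> z" if "z \<in> {ctr, vtx, mid}" for z
      using that gens_in_chamber by (intro W_inner_le_gen [OF assms(1) _ x(1)]) auto
    then have le: "x \<bullet> w ctr \<le> x \<bullet> ctr" "x \<bullet> w vtx \<le> x \<bullet> vtx" "x \<bullet> w mid \<le> x \<bullet> mid" by simp_all
    show "x \<bullet> w ctr = x \<bullet> ctr" by (rule chamber_le(2) [OF lin le assms(3) x(2) assms(4)])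
    show "x \<bullet> w mid = x \<bullet> mid" by (rule chamber_le(4) [OF lin le assms(3) x(2) assms(5)])
  qed
  show "w ctr = ctr" "w mid = mid" by (rule self, rule fixed; simp add: assms(2))+
qed

lemma s2_involution: "s2 (s2 x) = x"
  by (rule reflect_reflect [OF norm_root]) simp

lemma s2_components: "s2 x $ 1 = x $ 1" "s2 x $ 2 = - x $ 2" "s2 x $ 3 = x $ 3"
  by (subst vector3_components [of x], simp only: s2_vector, simp)+

text \<open>Folding x and y into the northern half puts both into the chamber, where w combined with
  the foldings must fix the point. As \<open>s2\<close> fixes \<open>ctr\<close> and
  \<open>mid\<close>, the conclusion passes back to w.\<close>

lemma W_fold:
  assumes w: "w \<in> W" "w x = y"
    and x: "0 < x $ 1" "0 < hgt x" "0 < hgt (s2 x)" and y: "0 < y $ 1" "0 < hgt y" "0 < hgt (s2 y)"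
  shows "w ctr = ctr" "w mid = mid"
proof -
  define f where "f z = (if 0 \<le> z $ 2 then (\<lambda>u. u) else s2)" for z :: "real^3"
  have f: "f z \<in> W" "f z ctr = ctr" "f z mid = mid" "f z (f z u) = u" for z u
    by (simp_all add: f_def W_id s2_in_W s2_gens s2_involution)
  have ch: "f z z \<in> chamber" "0 < f z z $ 1" "0 < hgt (f z z)" if "0 < z $ 1" "0 < hgt z" "0 < hgt (s2 z)" for z
    using that by (auto simp: f_def chamber_def s2_components)
  let ?g = "\<lambda>z. f y (w (f x z))"
  have g: "?g \<in> W" by (rule W_compose [OF f(1) W_compose [OF w(1) f(1)]])
  have gx: "?g (f x x) = f y y" by (simp add: f(4) w(2))
  have "?g (f x x) = f x x"
    by (rule W_chamber_unique [OF g ch(1) [OF x]]) (simp add: gx ch(1) [OF y])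
  note fixed = W_fixes_gens [OF g this ch [OF x]]
  show "w ctr = ctr" using arg_cong [OF fixed(1), of "f y"] by (simp only: f)
  show "w mid = mid" using arg_cong [OF fixed(2), of "f y"] by (simp only: f)
qed

context
  fixes n :: nat
  assumes n: "0 < n"
begin

lemma sin_glat_inject:
  assumes "sin (glat n k) = sin (glat n l)" "- int n \<le> k" "k \<le> int n" "- int n \<le> l" "l \<le> int n"
  shows "k = l"
proof -
  have less: "sin (glat n k) < sin (glat n l)" if "k < l" "- int n \<le> k" "l \<le> int n" for k l
    using glat_less [OF n that] glat_bounds [OF n, of k] glat_bounds [OF n, of l]
    by (intro sin_monotone_2pi) auto
  show ?thesis using less [of k l] less [of l k] assms by (cases k l rule: linorder_cases) auto
qed

lemma gp_column_inject:
  assumes "gp n i k = gp n c k" "i \<le> n" "c \<le> n"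
  shows "i = c"
proof -
  have less: "gp n c k \<noteq> gp n i k" if "i < c" "c \<le> n" for i c
  proof
    assume eq: "gp n c k = gp n i k"
    have "gp n c k \<bullet> gp n i k = 1" unfolding eq using norm_gp [OF n, of i k] by (simp add: dot_square_norm)
    then have "(cos (glat n k))\<^sup>2 * cos (glon n c - glon n i) + (sin (glat n k))\<^sup>2 = 1"
      by (simp add: gp_def inner_pt power2_eq_square)
    then have "(cos (glat n k))\<^sup>2 * cos (glon n c - glon n i) = (cos (glat n k))\<^sup>2 * 1"
      using sin_cos_squared_add [of "glat n k"] unfolding mult_1_right by linarith
    then have "cos (glon n c - glon n i) = cos 0" using glat_bounds(3) [OF n, of k] by simp
    moreover have "cos (glon n c - glon n i) < cos 0"
      using glon_less [OF n that] glon_bounds [OF n, of c] glon_bounds [OF n, of i] that pi_gt3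
      by (intro cos_monotone_0_pi) auto
    ultimately show False by simp
  qed
  show ?thesis using less [of i c] less [of c i] assms by (cases i c rule: linorder_cases) auto
qed

text \<open>The second coordinates identify the parallels and hence j; the pattern of meridians at
  two neighbouring parallels then determines i.\<close>

lemma face_vertices_inject:
  assumes ij: "i < n" "\<bar>j\<bar> \<le> int i" and ij': "i' < n" "\<bar>j'\<bar> \<le> int i'"
    and eq: "face_vertices n i j = face_vertices n i' j'"
  shows "i = i'" "j = j'"
proof -
  have comp: "zz n i k $ 2 = sin (glat n k)" for i k by (simp add: zz_def gp_def pt_components)
  have row: "k = l" if "zz n i k = zz n i' l" "k \<in> {j - 1, j, j + 1}" "l \<in> {j' - 1, j', j' + 1}" for k l
    using that(2,3) ij ij' arg_cong [OF that(1), of "\<lambda>v. v $ 2"] unfolding comp by (intro sin_glat_inject) auto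
  have "\<forall>k\<in>{j - 1, j, j + 1}. \<exists>l\<in>{j' - 1, j', j' + 1}. zz n i k = zz n i' l"
    using eq unfolding face_vertices_def by (auto simp: set_eq_iff)
  then have same: "k \<in> {j' - 1, j', j' + 1} \<and> zz n i k = zz n i' k" if "k \<in> {j - 1, j, j + 1}" for k
    using that row by metis
  show "j = j'" using same [of "j - 1"] same [of "j + 1"] by auto
  have col: "(if even (k - int i) then i else i + 1) = (if even (k - int i') then i' else i' + 1)"
    if "k \<in> {j - 1, j, j + 1}" for k
    by (rule gp_column_inject [OF conjunct2 [OF same [OF that], unfolded zz_def]]) (use ij(1) ij'(1) in auto)
  have "even (j + 1 - int k) \<longleftrightarrow> odd (j - int k)" for k by presburger
  then show "i = i'" using col [of j] col [of "j + 1"]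
    by (cases "even (j - int i)"; cases "even (j - int i')") simp_all
qed

lemma finite_face_vertices: "finite (face_vertices n i j)"
  by (simp add: face_vertices_def)

text \<open>The sum of the vertices is a positive combination, so \<open>W_fold\<close> applies to
  it. It yields the images of \<open>ctr\<close> and \<open>mid\<close> only: \<open>s2\<close>
  fixes both while exchanging the faces j and - j, so w itself is not determined by the
  face.\<close>

lemma W_face_inject:
  assumes w: "w \<in> W" "u \<in> W" and ij: "i < n" "\<bar>j\<bar> \<le> int i" and ij': "i' < n" "\<bar>j'\<bar> \<le> int i'"
    and eq: "w ` face n i j = u ` face n i' j'"
  shows "w ctr = u ctr" "w mid = u mid" "w = u \<Longrightarrow> i = i' \<and> j = j'"
proof -
  have ext: "{v. v extreme_point_of (w ` face n i j)} = w ` face_vertices n i j"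
    if "w \<in> W" "i < n" "\<bar>j\<bar> \<le> int i" for w i j
    using that unfolding face_def orth_hull [OF W_orth [OF that(1)]]
    by (intro extreme_points_of_unit_hull) (auto simp: face_vertices_def W_norm norm_zz)
  have img: "w ` face_vertices n i j = u ` face_vertices n i' j'"
    using ext [OF w(1) ij] ext [OF w(2) ij'] eq by simp
  define \<sigma> where "\<sigma> i j = zz n i (j - 1) + zz n i j + zz n i (j + 1)" for i j
  have sum: "(\<Sum>v\<in>w ` face_vertices n i j. v) = w (\<sigma> i j)" if "w \<in> W" "i < n" "\<bar>j\<bar> \<le> int i" for w i j
  proof -
    have "inj w" by (rule orth_inj [OF W_orth [OF that(1)]])
    then have "(\<Sum>v\<in>w ` face_vertices n i j. v) = (\<Sum>v\<in>face_vertices n i j. w v)"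
      by (subst sum.reindex) (auto intro: inj_on_subset)
    also have "\<dots> = w (\<Sum>v\<in>face_vertices n i j. v)" by (rule linear_sum [OF W_linear [OF that(1)], symmetric])
    also have "(\<Sum>v\<in>face_vertices n i j. v) = \<sigma> i j"
      using zz_distinct [OF that(2,3)] by (simp add: face_vertices_def \<sigma>_def add.assoc)
    finally show ?thesis .
  qed
  have "w (\<sigma> i j) = u (\<sigma> i' j')" unfolding sum [OF w(1) ij, symmetric] sum [OF w(2) ij', symmetric] img ..
  moreover obtain v where v: "v \<in> W" "\<And>x. v (u x) = x" "\<And>x. u (v x) = x" using W_inverse [OF w(2)] by metis
  ultimately have fold: "v (w (\<sigma> i j)) = \<sigma> i' j'" by simp
  have pos: "0 < \<sigma> i j $ 1" "0 < hgt (\<sigma> i j)" "0 < hgt (s2 (\<sigma> i j))" if "i < n" "\<bar>j\<bar> \<le> int i" for i j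
    using positive_combination_interior [OF that, of 1 1 1 "\<sigma> i j"] by (simp_all add: \<sigma>_def)
  note W_fold [OF W_compose [OF v(1) w(1)] fold pos [OF ij] pos [OF ij']]
  then show "w ctr = u ctr" "w mid = u mid" using v(3) by metis+
  show "i = i' \<and> j = j'" if "w = u"
  proof -
    have "inj u" by (rule orth_inj [OF W_orth [OF w(2)]])
    then have "face_vertices n i j = face_vertices n i' j'" using img unfolding that by (simp add: inj_image_eq_iff)
    then show ?thesis using face_vertices_inject [OF ij ij'] by blast
  qed
qed

lemma s2_face: "s2 ` face n i j = face n i (- j)"
proof -
  have "s2 (zz n i k) = zz n i (- k)" for k by (simp add: zz_def s2_gp [OF n])
  note z = this [of "j - 1"] this [of j] this [of "j + 1"]
  have "- (j - 1) = - j + 1" "- (j + 1) = - j - 1" by simp_all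
  then show "s2 ` face n i j = face n i (- j)"
    unfolding W_face [OF s2_in_W] z unfolding face_def face_vertices_def by (simp only: insert_commute)
qed

text \<open>Twelve centres, each with a chosen group element, times five rotations, times n^2 faces
  of the standard triangle. Reflections add nothing, because \<open>s2\<close> permutes the faces of
  that triangle.\<close>

lemma card_kitrick_faces: "card (kitrick_faces n) = 60 * n\<^sup>2"
proof -
  have "\<forall>c\<in>centres12. \<exists>w. w \<in> W \<and> w ctr = c" using W_transitive_centres by blast
  then obtain t where t: "t c \<in> W \<and> t c ctr = c" if "c \<in> centres12" for c by metis
  define I where "I = Sigma {..<n} (\<lambda>i. {- int i..int i})"
  define r where "r c k = (\<lambda>x. t c ((rot ^^ k) x))" for c k
  have r: "r c k \<in> W" "r c k ctr = c" if "c \<in> centres12" for c k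
  proof -
    show "r c k \<in> W" unfolding r_def by (rule W_compose [OF conjunct1 [OF t [OF that]] rot_power_in_W])
    show "r c k ctr = c" using t [OF that] by (simp add: r_def rot_power_ctr)
  qed
  let ?f = "\<lambda>((c, k), (i, j)). r c k ` face n i j"
  have "inj_on ?f ((centres12 \<times> {..<5}) \<times> I)"
  proof (rule inj_onI)
    fix p q assume p: "p \<in> (centres12 \<times> {..<5}) \<times> I" and q: "q \<in> (centres12 \<times> {..<5}) \<times> I" and eq: "?f p = ?f q"
    obtain c k i j where pq1: "p = ((c, k), (i, j))" by (cases p) auto
    obtain c' k' i' j' where pq2: "q = ((c', k'), (i', j'))" by (cases q) auto
    note pq = pq1 pq2
    have ck: "c \<in> centres12" "k < 5" "c' \<in> centres12" "k' < 5" and ij: "i < n" "\<bar>j\<bar> \<le> int i" "i' < n" "\<bar>j'\<bar> \<le> int i'"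
      using p q unfolding pq I_def by auto
    have eq: "r c k ` face n i j = r c' k' ` face n i' j'" using eq unfolding pq by simp
    note inj = W_face_inject [OF r(1) [OF ck(1)] r(1) [OF ck(3)] ij eq]
    have c: "c = c'" using inj(1) r(2) ck by simp
    have "inj (t c)" by (rule orth_inj [OF W_orth [OF conjunct1 [OF t [OF ck(1)]]]])
    then have "(rot ^^ k) mid = (rot ^^ k') mid" using inj(2) unfolding c r_def by (simp add: inj_eq)
    then have k: "k = k'" by (rule rot_power_mid_inject [OF ck(2,4)])
    show "p = q" using inj(3) by (simp add: pq c k)
  qed
  then have "card (?f ` ((centres12 \<times> {..<5}) \<times> I)) = card ((centres12 \<times> {..<5::nat}) \<times> I)" by (rule card_image)
  also have "?f ` ((centres12 \<times> {..<5}) \<times> I) = kitrick_faces n"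
  proof (intro subset_antisym subsetI)
    fix F assume "F \<in> ?f ` ((centres12 \<times> {..<5}) \<times> I)"
    then obtain p where p: "p \<in> (centres12 \<times> {..<5}) \<times> I" "F = ?f p" by blast
    obtain c k i j where eq: "p = ((c, k), (i, j))" by (cases p) auto
    have "c \<in> centres12" "i < n" "\<bar>j\<bar> \<le> int i" "F = r c k ` face n i j" using p unfolding eq I_def by auto
    then show "F \<in> kitrick_faces n" unfolding kitrick_faces_eq [OF n] using r(1) by blast
  next
    fix F assume "F \<in> kitrick_faces n"
    then obtain w i j where w: "w \<in> W" and ij: "i < n" "\<bar>j\<bar> \<le> int i" and F: "F = w ` face n i j"
      by (rule kitrick_faces_cases [OF n])
    have c: "w ctr \<in> centres12" by (rule W_centres12 [OF w ctr_in_centres12])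
    obtain v where v: "v \<in> W" "\<And>x. v (t (w ctr) x) = x" "\<And>x. t (w ctr) (v x) = x" using W_inverse t [OF c] by metis
    have "v (w ctr) = v (t (w ctr) ctr)" using t [OF c] by simp
    then obtain k where k: "k < 5" "(\<lambda>x. v (w x)) = rot ^^ k \<or> (\<lambda>x. v (w x)) = (\<lambda>x. (rot ^^ k) (s2 x))"
      using W_fix_ctr [OF W_compose [OF v(1) w]] v(2) by auto
    define u where "u = r (w ctr) k"
    have "w x = u x" if "(\<lambda>x. v (w x)) = rot ^^ k" for x
      unfolding u_def r_def fun_cong [OF that, symmetric, of x] v(3) ..
    moreover have "w x = u (s2 x)" if "(\<lambda>x. v (w x)) = (\<lambda>x. (rot ^^ k) (s2 x))" for x
      unfolding u_def r_def fun_cong [OF that, symmetric, of x] v(3) ..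
    ultimately have "F = u ` face n i j \<or> F = u ` s2 ` face n i j"
      using k(2) unfolding F image_image by (metis (no_types, lifting) image_cong)
    then obtain j' where j': "\<bar>j'\<bar> \<le> int i" "F = u ` face n i j'"
      unfolding s2_face using ij(2) abs_minus_cancel [of j] by metis
    show "F \<in> ?f ` ((centres12 \<times> {..<5}) \<times> I)"
    proof (rule image_eqI)
      show "F = ?f ((w ctr, k), (i, j'))" by (simp only: prod.case j'(2) u_def)
      have "(i, j') \<in> I" unfolding I_def using ij(1) j'(1) by auto
      then show "((w ctr, k), (i, j')) \<in> (centres12 \<times> {..<5}) \<times> I" using c k(1) by simp
    qed
  qed
  also have "card ((centres12 \<times> {..<5::nat}) \<times> I) = 60 * card I"
    by (simp add: card_cartesian_product card_centres12)
  also have "card I = (\<Sum>i<n. 2 * i + 1)"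
    unfolding I_def by (subst card_SigmaI) (auto intro!: sum.cong)
  also have "\<dots> = n\<^sup>2" by (induction n) (simp_all add: power2_eq_square)
  finally show ?thesis .
qed

end

section \<open>The faces at the centres and the final statement\<close>

context
  fixes n :: nat
  assumes n: "0 < n"
begin

lemma inscribed_triangular_kitrick_hull: "inscribed_triangular (60 * n\<^sup>2) (kitrick_hull n)"
  unfolding inscribed_triangular_def
proof (intro conjI allI impI exI)
  show "polytope (kitrick_hull n)"
    unfolding kitrick_hull_def by (intro polytope_convex_hull finite_kitrick_vertices [OF n])
  show "aff_dim (kitrick_hull n) = 3" by (rule aff_dim_kitrick_hull [OF n])
  show "{v. v extreme_point_of kitrick_hull n} \<subseteq> sphere 0 1"
    unfolding kitrick_hull_def
      extreme_points_of_unit_hull [OF finite_kitrick_vertices [OF n] kitrick_vertices_sphere [OF n]]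
    by (rule kitrick_vertices_sphere [OF n])
  show "card {F. F facet_of kitrick_hull n} = 60 * n\<^sup>2"
    by (simp add: facet_of_kitrick_hull [OF n] card_kitrick_faces [OF n])
  show "2 simplex F" if "F facet_of kitrick_hull n" for F
    using that kitrick_face_simplex [OF n] by (simp add: facet_of_kitrick_hull [OF n])
qed

lemma inf_edge_ratio_le: "inf_edge_ratio (60 * n\<^sup>2) \<le> ereal (kitrick_ratio n)"
  unfolding inf_edge_ratio_def
  by (rule INF_lower2 [of "kitrick_hull n"])
    (simp_all add: inscribed_triangular_kitrick_hull edge_ratio_kitrick_hull [OF n])

text \<open>Up to \<open>s2\<close> the vertex lies in the chamber, as does \<open>c0\<close>, so
  uniqueness in the chamber makes them equal, and the coordinates give the indices. This shows that
  a centre occurs as a vertex only at an apex.\<close>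

lemma W_gp_eq_c0:
  assumes w: "w \<in> W" "w (gp n k l) = c0" and kl: "kitrick_index n k l"
  shows "k = 0" "l = 0"
proof -
  have b: "k \<le> n" "\<bar>l\<bar> \<le> int k" using kl by (simp_all add: kitrick_index_def)
  have c0_chamber: "c0 \<in> chamber" using gp_in_chamber [OF n, of 0 0] by (simp add: gp_0)
  have s2c0: "s2 c0 = c0" using W_c0 [OF s2_in_W] by (simp only: s2_gens c0_def)
  have fold: "v (gp n k l) = c0 \<Longrightarrow> gp n k l = c0" if "v \<in> W" "0 \<le> l" "l \<le> int k" for v l
    using W_chamber_unique [OF that(1) gp_in_chamber [OF n that(2,3) b(1)]] c0_chamber by simp
  have "gp n k l = c0"
  proof (cases "0 \<le> l")
    case True
    then show ?thesis using fold [OF w(1) True] w(2) b(2) by simp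
  next
    case False
    have "w (s2 (gp n k (- l))) = c0" unfolding s2_gp [OF n] using w(2) by simp
    then have "gp n k (- l) = c0" using False b(2) by (intro fold [OF W_compose [OF w(1) s2_in_W]]) auto
    then have "s2 (gp n k (- l)) = c0" by (simp only: s2c0)
    then show ?thesis by (simp add: s2_gp [OF n])
  qed
  then have eq: "gp n k l = gp n 0 0" by (simp only: gp_0)
  have "gp n k l $ 2 = gp n 0 0 $ 2" by (simp only: eq)
  then have "sin (glat n l) = sin (glat n 0)" by (simp add: gp_def pt_components)
  then show l: "l = 0" using b by (intro sin_glat_inject [OF n]) auto
  have "gp n k 0 = gp n 0 0" using eq by (simp only: l)
  then show "k = 0" by (rule gp_column_inject [OF n]) (use b in auto)
qed

lemma kitrick_points_apex:
  assumes "w \<in> W"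
  shows "kitrick_point n (w c0, w a0, w b0) 0 0 = w (gp n 0 0)"
    "kitrick_point n (w c0, w a0, w b0) 1 1 = w (gp n 1 1)"
    "kitrick_point n (w c0, w a0, w b0) 1 (- 1) = w (gp n 1 (- 1))"
  using n by (intro kitrick_point_W [OF assms n]; simp)+

lemma W_apex_face:
  assumes "w \<in> W"
  shows "kitrick_apex_face n (w c0, w a0, w b0) = w ` face n 0 0"
proof -
  have "zz n 0 (0 - 1) = gp n 1 (- 1)" "zz n 0 0 = gp n 0 0" "zz n 0 (0 + 1) = gp n 1 1"
    by (simp_all add: zz_def)
  note z = this
  show ?thesis
    unfolding W_face [OF assms] z kitrick_apex_face_def kitrick_points_apex [OF assms]
    by (simp only: insert_commute)
qed

lemma apex_faces: "{F \<in> kitrick_faces n. \<exists>G. G facet_of dodecahedron \<and> sph_centre G \<in> F} =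
    kitrick_apex_face n ` base_triangles"
proof (intro subset_antisym subsetI)
  fix F assume "F \<in> {F \<in> kitrick_faces n. \<exists>G. G facet_of dodecahedron \<and> sph_centre G \<in> F}"
  then obtain G where F: "F \<in> kitrick_faces n" and G: "G facet_of dodecahedron" "sph_centre G \<in> F" by blast
  obtain u where u: "u \<in> W" "G = u ` top_facet" using G(1) unfolding facet_of_dodecahedron by blast
  have centre: "sph_centre G = u c0"
    by (simp add: u(2) sph_centre_orth_image W_orth [OF u(1)] sph_centre_top_facet c0_def)
  obtain w i j where w: "w \<in> W" and ij: "i < n" "\<bar>j\<bar> \<le> int i" and Fw: "F = w ` face n i j"
    by (rule kitrick_faces_cases [OF n F])
  obtain v where v: "v \<in> W" "\<And>x. v (w x) = x" "\<And>x. w (v x) = x" using W_inverse [OF w] by metis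
  have "u c0 \<in> w ` face n i j" using G(2) by (simp add: centre Fw)
  then have "v (u c0) \<in> face n i j" using v(2) by auto
  moreover have "norm (v (u c0)) = 1" using axes_orthonormal by (simp add: W_norm v(1) u(1) norm_eq_1)
  moreover have "face_vertices n i j \<subseteq> sphere 0 1" by (simp add: face_vertices_def norm_zz [OF ij])
  \<comment> \<open>A point of the unit sphere in an inscribed triangle is one of its
    vertices.\<close>
  ultimately have "v (u c0) \<in> face_vertices n i j"
    using unit_in_convex_hull_unit [OF finite_face_vertices [OF n]] unfolding face_def by blast
  then obtain m where m: "m \<in> {j - 1, j, j + 1}" "v (u c0) = zz n i m" unfolding face_vertices_def by blast
  obtain c where c: "c \<in> {i, i + 1}" "zz n i m = gp n c m" "kitrick_index n c m"
    using zz_bounds(5) [OF ij m(1)] by blast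
  obtain x where x: "x \<in> W" "\<And>y. x (v (u y)) = y" using W_inverse [OF W_compose [OF v(1) u(1)]] by metis
  have "x (gp n c m) = c0" unfolding c(2) [symmetric] m(2) [symmetric] by (rule x(2))
  note zero = W_gp_eq_c0 [OF x(1) this c(3)]
  then have "i = 0" using c(1) by auto
  then have "i = 0" "j = 0" using ij(2) by auto
  then have "F = kitrick_apex_face n (w c0, w a0, w b0)" by (simp add: Fw W_apex_face [OF w])
  then show "F \<in> kitrick_apex_face n ` base_triangles" unfolding base_triangles_eq using w by blast
next
  fix F assume "F \<in> kitrick_apex_face n ` base_triangles"
  then obtain w where w: "w \<in> W" "F = w ` face n 0 0"
    unfolding base_triangles_eq using W_apex_face by auto
  have "F \<in> kitrick_faces n" unfolding kitrick_faces_eq [OF n] w(2)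
    by (intro CollectI exI [of _ w] exI [of _ 0]) (simp add: w(1) n)
  moreover have "w ` top_facet facet_of dodecahedron" unfolding facet_of_dodecahedron using w(1) by blast
  moreover have "c0 \<in> face n 0 0" unfolding face_def by (rule hull_inc) (simp add: face_vertices_def zz_def gp_0)
  then have "sph_centre (w ` top_facet) \<in> F"
    by (simp add: w(2) sph_centre_orth_image W_orth [OF w(1)] sph_centre_top_facet flip: c0_def)
  ultimately show "F \<in> {F \<in> kitrick_faces n. \<exists>G. G facet_of dodecahedron \<and> sph_centre G \<in> F}" by blast
qed

lemma apex_edges:
  assumes "T \<in> base_triangles"
  defines "A \<equiv> kitrick_point n T 0 0" and "B \<equiv> kitrick_point n T 1 1" and "C \<equiv> kitrick_point n T 1 (- 1)"
  shows "dist A B = dist A C"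
    "{closed_segment B C, closed_segment A B, closed_segment A C} \<subseteq> kitrick_edges n"
    "E \<in> kitrick_edges n \<Longrightarrow> dist A B \<le> diameter E \<and> diameter E \<le> dist B C"
proof -
  obtain w where w: "w \<in> W" "T = (w c0, w a0, w b0)" using assms(1) unfolding base_triangles_eq by blast
  have ABC: "A = w (gp n 0 0)" "B = w (gp n 1 1)" "C = w (gp n 1 (- 1))"
    unfolding A_def B_def C_def w(2) using kitrick_points_apex [OF w(1)] by auto
  have dist: "dist (w p) (w q) = dist p q" for p q
    using W_norm [OF w(1), of "p - q"] by (simp add: dist_norm linear_diff [OF W_linear [OF w(1)]])
  show "dist A B = dist A C" unfolding ABC dist by (simp only: apex_lengths [OF n])
  have edge: "closed_segment (w p) (w q) \<in> kitrick_edges n" if "(p, q) \<in> edge_pairs n" for p q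
    unfolding kitrick_edges_eq [OF n] using that w(1) by blast
  show "{closed_segment B C, closed_segment A B, closed_segment A C} \<subseteq> kitrick_edges n"
    using apex_edge_pairs [OF n, THEN edge] unfolding ABC closed_segment_commute [of "w (gp n 1 1)"]
    by simp
  show "dist A B \<le> diameter E \<and> diameter E \<le> dist B C" if "E \<in> kitrick_edges n"
    using kitrick_edge_diameter [OF n that] edge_pairs_dist [OF n] unfolding ABC dist by metis
qed

lemma kitrick_ratio_arccos:
  "kitrick_ratio n = 2 * sin (pi / 5) * cos (arccos (cot (pi / 5) / sqrt 3) / (2 * real n))"
  by (simp add: kitrick_ratio_eq [OF n] s36_def step_def side_def mult.commute)

end

theorem proposition2:
  shows "(\<forall>n::nat. n \<ge> 1 \<longrightarrow>
      card (kitrick_faces n) = 60 * n\<^sup>2 \<and> (\<forall>F\<in>kitrick_faces n. 2 simplex F) \<and>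
      kitrick_vertices n \<subseteq> sphere 0 1 \<and>
      inf_edge_ratio (60 * n\<^sup>2) \<le> ereal (kitrick_ratio n) \<and>
      kitrick_ratio n = 2 * sin (pi / 5) * cos (arccos (cot (pi / 5) / sqrt 3) / (2 * real n)) \<and>
      kitrick_ratio n < 2 * sin (pi / 5) \<and>
      {F \<in> kitrick_faces n. \<exists>G. G facet_of dodecahedron \<and> sph_centre G \<in> F} =
        kitrick_apex_face n ` base_triangles \<and>
      (\<forall>T\<in>base_triangles.
         let A = kitrick_point n T 0 0; B = kitrick_point n T 1 1; C = kitrick_point n T 1 (- 1)
         in dist A B = dist A C \<and>
            {closed_segment B C, closed_segment A B, closed_segment A C} \<subseteq> kitrick_edges n \<and>
            (\<forall>E\<in>kitrick_edges n. dist A B \<le> diameter E \<and> diameter E \<le> dist B C))) \<and>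
    37.37 \<le> arccos (cot (pi / 5) / sqrt 3) * 180 / pi \<and>
    arccos (cot (pi / 5) / sqrt 3) * 180 / pi < 37.38 \<and>
    liminf inf_edge_ratio \<le> ereal (2 * sin (pi / 5))"
proof (intro conjI allI impI ballI)
  fix n :: nat
  assume "n \<ge> 1"
  then have n: "0 < n" by simp
  show "card (kitrick_faces n) = 60 * n\<^sup>2" by (rule card_kitrick_faces [OF n])
  show "2 simplex F" if "F \<in> kitrick_faces n" for F using that by (rule kitrick_face_simplex [OF n])
  show "kitrick_vertices n \<subseteq> sphere 0 1" by (rule kitrick_vertices_sphere [OF n])
  show "inf_edge_ratio (60 * n\<^sup>2) \<le> ereal (kitrick_ratio n)" by (rule inf_edge_ratio_le [OF n])
  show "kitrick_ratio n = 2 * sin (pi / 5) * cos (arccos (cot (pi / 5) / sqrt 3) / (2 * real n))"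
    by (rule kitrick_ratio_arccos [OF n])
  show "kitrick_ratio n < 2 * sin (pi / 5)" using kitrick_ratio_less [OF n] by (simp only: s36_def)
  show "{F \<in> kitrick_faces n. \<exists>G. G facet_of dodecahedron \<and> sph_centre G \<in> F} =
    kitrick_apex_face n ` base_triangles" by (rule apex_faces [OF n])
  show "let A = kitrick_point n T 0 0; B = kitrick_point n T 1 1; C = kitrick_point n T 1 (- 1)
     in dist A B = dist A C \<and>
        {closed_segment B C, closed_segment A B, closed_segment A C} \<subseteq> kitrick_edges n \<and>
        (\<forall>E\<in>kitrick_edges n. dist A B \<le> diameter E \<and> diameter E \<le> dist B C)"
    if "T \<in> base_triangles" for T
    unfolding Let_def using apex_edges [OF n that] by blast
next
  show "37.37 \<le> arccos (cot (pi / 5) / sqrt 3) * 180 / pi"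
    "arccos (cot (pi / 5) / sqrt 3) * 180 / pi < 37.38"
    using side_bounds unfolding side_def by simp_all
next
  \<comment> \<open>The shift to \<open>Suc k\<close> keeps the index of K_n at least 1 along the
    subsequence.\<close>
  let ?r = "\<lambda>k. 60 * (Suc k)\<^sup>2"
  have "strict_mono ?r" by (rule strict_monoI) (simp add: power_strict_mono)
  then have "liminf inf_edge_ratio \<le> liminf (inf_edge_ratio \<circ> ?r)" by (rule liminf_subseq_mono)
  also have "\<dots> \<le> liminf (\<lambda>k. ereal (2 * sin (pi / 5)))"
  proof (intro Liminf_mono always_eventually allI)
    fix k
    have "inf_edge_ratio (?r k) \<le> ereal (kitrick_ratio (Suc k))" by (rule inf_edge_ratio_le) simp
    also have "\<dots> \<le> ereal (2 * sin (pi / 5))" using kitrick_ratio_less [of "Suc k"] by (simp add: s36_def)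
    finally show "(inf_edge_ratio \<circ> ?r) k \<le> ereal (2 * sin (pi / 5))" by simp
  qed
  also have "\<dots> = ereal (2 * sin (pi / 5))" by (rule Liminf_const) simp
  finally show "liminf inf_edge_ratio \<le> ereal (2 * sin (pi / 5))" .
qed

end
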